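(* Let $\{\alpha_i\}_{i\ge0}$ and $\{\beta_{i,j}\}_{i\ge0,\,j\ge1}$ be arrays of real numbers and $Q:\mathbb{R}\to\mathbb{R}$ a measurable function such that, for some constant $c_Q>0$, $|Q(x)|\le c_Q|x|$ for all $x\in\mathbb{R}$, and $$K_Q:=\sum_{i=0}^\infty\alpha_i^2\sum_{k=0}^\infty c_Q^{2k+2}\sum_{j_1=1}^\infty\beta_{i,j_1}^2\cdots\sum_{j_k=1}^\infty\beta_{i+j_1+\dots+j_{k-1},\,j_k}^2<\infty .$$ Let $\{X_t\}$ be the (unique) solution of the projective equation with zero mean $$X_t=\sum_{s\le t}\zeta_s\,Q\Big(\alpha_{t-s}+\sum_{s<u\le t}\beta_{t-u,u-s}\big(\mathrm{E}_{[u,t]}X_t-\mathrm{E}_{[u+1,t]}X_t\big)\Big),\qquad t\in\mathbb{Z}.$$ Assume in addition that $Q$ is Lipschitz, i.e. there is $c_L>0$ with $|Q(x)-Q(y)|\le c_L|x-y|$ for all $x,y\in\mathbb{R}$, and that there exist $\kappa>0$ and $0<d<1/2$ such that $$b_j:=Q(\alpha_j)\sim\kappa\,j^{d-1},\qquad j\to\infty,$$ and $$\bar\beta_j:=\max_{0\le i<j}|\beta_{i,j-i}|=o(b_j),\qquad j\to\infty.$$ Then, as $t\to\infty$, $$\mathrm{E}X_0X_t\ \sim\ \sum_{k=0}^\infty b_kb_{t+k}\ \sim\ \kappa_d^2\,t^{2d-1},\qquad \kappa_d^2:=\kappa^2B(d,1-2d),$$ where $B(\cdot,\cdot)$ is the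 beta function. Moreover, as $n\to\infty$, $$n^{-1/2-d}\sum_{t=1}^{[n\tau]}X_t\ \longrightarrow_{D[0,1]}\ c_{\kappa,d}\,B_H(\tau),$$ where $B_H$ is a fractional Brownian motion with parameter $H=d+\tfrac12$ and variance $\mathrm{E}B_H^2(t)=t^{2H}$, and $c_{\kappa,d}^2:=\dfrac{\kappa^2B(d,1-2d)}{d(1+2d)}$.
   Context: $\{\zeta_t,\,t\in\mathbb{Z}\}$ is a sequence of i.i.d. real random variables with $\mathrm{E}\zeta_0=0$, $\mathrm{E}\zeta_0^2=1$. For integers $s\le t$, $\mathcal{F}_{[s,t]}:=\sigma\{\zeta_u:u\in[s,t]\}$; for $s>t$, $\mathcal{F}_{[s,t]}$ is the trivial sigma-algebra. $\mathrm{E}_{[s,t]}[\xi]:=\mathrm{E}[\xi\,|\,\mathcal{F}_{[s,t]}]$. A projective process is a random sequence $\{Y_t,\,t\in\mathbb{Z}\}$ of square integrable, $\sigma\{\zeta_u:u\le t\}$-measurable random variables of the form $Y_t=\mathrm{E}Y_t+\sum_{s\le t}g_{s,t}\zeta_s$, where $g_{s,t}$ is $\mathcal{F}_{[s+1,t]}$-measurable for $s<t$, $g_{t,t}$ is deterministic, and $\sum_{s\le t}\mathrm{E}g_{s,t}^2<\infty$ for all $t$. A solution of the projective equation is a projective process $\{X_t\}$ such that the sum over $s\le t$ of the second moments of the coefficients multiplying $\zeta_s$ on the right-hand side is finite and the equation holds for every $t\in\mathbb{Z}$; under the stated conditions ($|Q(x)|\le c_Q|x|$, $K_Q<\infty$)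 such a solution exists and is unique, and it is strictly stationary. In $K_Q$ the $k=0$ term of the sum over $k$ is $c_Q^2$. $\sim$ means that the ratio of the two sides tends to 1. $\longrightarrow_{D[0,1]}$ denotes weak convergence of random processes in the Skorohod space $D[0,1]$ and $[\cdot]$ is the integer part. *)

theory Defs
  imports "HOL-Probability.Probability" "HOL-Library.Landau_Symbols"
begin

definition std_iid :: "'a measure \<Rightarrow> (int \<Rightarrow> 'a \<Rightarrow> real) \<Rightarrow> bool" where
  "std_iid M \<zeta> \<longleftrightarrow>
     prob_space M \<and>
     prob_space.indep_vars M (\<lambda>_. borel) \<zeta> UNIV \<and>
     (\<forall>t. distr M borel (\<zeta> t) = distr M borel (\<zeta> 0)) \<and>
     integrable M (\<lambda>\<omega>. (\<zeta> 0 \<omega>)\<^sup>2) \<and>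
     (\<integral>\<omega>. \<zeta> 0 \<omega> \<partial>M) = 0 \<and>
     (\<integral>\<omega>. (\<zeta> 0 \<omega>)\<^sup>2 \<partial>M) = 1"

definition sigma_of :: "'a measure \<Rightarrow> (int \<Rightarrow> 'a \<Rightarrow> real) \<Rightarrow> int set \<Rightarrow> 'a measure" where
  "sigma_of M \<zeta> A = sigma (space M) {\<zeta> u -` B \<inter> space M |u B. u \<in> A \<and> B \<in> sets borel}"

text \<open>For \<open>s > t\<close> the interval \<open>{s..t}\<close> is empty and \<open>sigma_of M \<zeta> {s..t}\<close> is the trivial
  sigma-algebra, so that \<open>Eint M \<zeta> s t \<xi>\<close> is then the (constant) mean of \<open>\<xi>\<close>.\<close>

definition Eint :: "'a measure \<Rightarrow> (int \<Rightarrow> 'a \<Rightarrow> real) \<Rightarrow> int \<Rightarrow> int \<Rightarrow> ('a \<Rightarrow> real) \<Rightarrow> 'a \<Rightarrow> real" where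
  "Eint M \<zeta> s t \<xi> = real_cond_exp M (sigma_of M \<zeta> {s..t}) \<xi>"

text \<open>\<open>Z = (\<Sum>s\<le>t. f s)\<close>, the series being understood in mean square.\<close>

definition ms_sums_le :: "'a measure \<Rightarrow> (int \<Rightarrow> 'a \<Rightarrow> real) \<Rightarrow> int \<Rightarrow> ('a \<Rightarrow> real) \<Rightarrow> bool" where
  "ms_sums_le M f t Z \<longleftrightarrow>
     (\<lambda>n. \<integral>\<^sup>+\<omega>. ennreal ((Z \<omega> - (\<Sum>s\<in>{t - int n..t}. f s \<omega>))\<^sup>2) \<partial>M) \<longlonglongrightarrow> 0"

text \<open>\<open>\<Sum>s\<le>t. E (f s)\<^sup>2\<close>, with value in \<open>[0,\<infinity>]\<close>.\<close>

definition sum_second_moments :: "'a measure \<Rightarrow> (int \<Rightarrow> 'a \<Rightarrow> real) \<Rightarrow> int \<Rightarrow> ennreal" where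
  "sum_second_moments M f t = (\<Sum>n. \<integral>\<^sup>+\<omega>. ennreal ((f (t - int n) \<omega>)\<^sup>2) \<partial>M)"

definition projective_process :: "'a measure \<Rightarrow> (int \<Rightarrow> 'a \<Rightarrow> real) \<Rightarrow> (int \<Rightarrow> 'a \<Rightarrow> real) \<Rightarrow> bool" where
  "projective_process M \<zeta> Y \<longleftrightarrow>
     (\<forall>t. Y t \<in> borel_measurable (sigma_of M \<zeta> {..t}) \<and> integrable M (\<lambda>\<omega>. (Y t \<omega>)\<^sup>2)) \<and>
     (\<exists>g :: int \<Rightarrow> int \<Rightarrow> 'a \<Rightarrow> real.
        (\<forall>s t. s < t \<longrightarrow> g s t \<in> borel_measurable (sigma_of M \<zeta> {s + 1..t})) \<and>
        (\<forall>t. \<exists>c. \<forall>\<omega>\<in>space M. g t t \<omega> = c) \<and>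
        (\<forall>t. sum_second_moments M (\<lambda>s. g s t) t < \<infinity>) \<and>
        (\<forall>t. ms_sums_le M (\<lambda>s \<omega>. g s t \<omega> * \<zeta> s \<omega>) t (\<lambda>\<omega>. Y t \<omega> - (\<integral>x. Y t x \<partial>M))))"

text \<open>The coefficient of \<open>\<zeta> s\<close> on the right-hand side of the equation. Only the values
  \<open>\<beta> i j\<close> with \<open>j \<ge> 1\<close> are ever used.\<close>

definition proj_coeff ::
  "'a measure \<Rightarrow> (int \<Rightarrow> 'a \<Rightarrow> real) \<Rightarrow> (real \<Rightarrow> real) \<Rightarrow> (nat \<Rightarrow> real) \<Rightarrow> (nat \<Rightarrow> nat \<Rightarrow> real) \<Rightarrow>
   (int \<Rightarrow> 'a \<Rightarrow> real) \<Rightarrow> int \<Rightarrow> int \<Rightarrow> 'a \<Rightarrow> real" where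
  "proj_coeff M \<zeta> Q \<alpha> \<beta> X s t \<omega> =
     Q (\<alpha> (nat (t - s)) +
        (\<Sum>u\<in>{s<..t}. \<beta> (nat (t - u)) (nat (u - s)) *
           (Eint M \<zeta> u t (X t) \<omega> - Eint M \<zeta> (u + 1) t (X t) \<omega>)))"

definition projective_solution ::
  "'a measure \<Rightarrow> (int \<Rightarrow> 'a \<Rightarrow> real) \<Rightarrow> (real \<Rightarrow> real) \<Rightarrow> (nat \<Rightarrow> real) \<Rightarrow> (nat \<Rightarrow> nat \<Rightarrow> real) \<Rightarrow>
   (int \<Rightarrow> 'a \<Rightarrow> real) \<Rightarrow> bool" where
  "projective_solution M \<zeta> Q \<alpha> \<beta> X \<longleftrightarrow>
     projective_process M \<zeta> X \<and>
     (\<forall>t. sum_second_moments M (\<lambda>s. proj_coeff M \<zeta> Q \<alpha> \<beta> X s t) t < \<infinity>) \<and>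
     (\<forall>t. ms_sums_le M (\<lambda>s \<omega>. \<zeta> s \<omega> * proj_coeff M \<zeta> Q \<alpha> \<beta> X s t \<omega>) t (X t))"

text \<open>\<open>chain_sum \<beta> k i\<close> is the iterated sum
  \<open>\<Sum>j\<^sub>1\<ge>1. \<beta>\<^sup>2(i,j\<^sub>1) \<cdots> \<Sum>j\<^sub>k\<ge>1. \<beta>\<^sup>2(i+j\<^sub>1+\<dots>+j\<^sub>k\<^sub>-\<^sub>1, j\<^sub>k)\<close>.\<close>

primrec chain_sum :: "(nat \<Rightarrow> nat \<Rightarrow> real) \<Rightarrow> nat \<Rightarrow> nat \<Rightarrow> ennreal" where
  "chain_sum \<beta> 0 i = 1"
| "chain_sum \<beta> (Suc k) i = (\<Sum>j. ennreal ((\<beta> i (Suc j))\<^sup>2) * chain_sum \<beta> k (i + Suc j))"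

definition K_Q :: "real \<Rightarrow> (nat \<Rightarrow> real) \<Rightarrow> (nat \<Rightarrow> nat \<Rightarrow> real) \<Rightarrow> ennreal" where
  "K_Q c \<alpha> \<beta> = (\<Sum>i. ennreal ((\<alpha> i)\<^sup>2) * (\<Sum>k. ennreal (c ^ (2 * k + 2)) * chain_sum \<beta> k i))"

text \<open>Meaningful for \<open>j \<ge> 1\<close> only; it is used asymptotically, so \<open>j = 0\<close> plays no role.\<close>

definition beta_bar :: "(nat \<Rightarrow> nat \<Rightarrow> real) \<Rightarrow> nat \<Rightarrow> real" where
  "beta_bar \<beta> j = Max ((\<lambda>i. \<bar>\<beta> i (j - i)\<bar>) ` {0..<j})"

definition D01 :: "(real \<Rightarrow> real) set" where
  "D01 = {x \<in> extensional {0..1}.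
            (\<forall>t\<in>{0..<1}. (x \<longlongrightarrow> x t) (at_right t)) \<and>
            (\<forall>t\<in>{0<..1}. \<exists>l. (x \<longlongrightarrow> l) (at_left t))}"

definition time_changes :: "(real \<Rightarrow> real) set" where
  "time_changes = {l. continuous_on {0..1} l \<and> strict_mono_on {0..1} l \<and> l 0 = 0 \<and> l 1 = 1}"

definition skorohod_set :: "(real \<Rightarrow> real) \<Rightarrow> (real \<Rightarrow> real) \<Rightarrow> real set" where
  "skorohod_set x y =
     {e. 0 < e \<and> (\<exists>l\<in>time_changes. \<forall>t\<in>{0..1}. \<bar>l t - t\<bar> \<le> e \<and> \<bar>x t - y (l t)\<bar> \<le> e)}"

text \<open>Outside \<open>D01\<close> the value is irrelevant; it is made \<open>0\<close> there only for symmetry.\<close>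

definition skorohod_dist :: "(real \<Rightarrow> real) \<Rightarrow> (real \<Rightarrow> real) \<Rightarrow> real" where
  "skorohod_dist x y = (if x \<in> D01 \<and> y \<in> D01 then Inf (skorohod_set x y) else 0)"

lemma time_changes_range:
  assumes "l \<in> time_changes" "t \<in> {0..1}"
  shows "l t \<in> {0..1}"
proof -
  have m: "strict_mono_on {0..1} l" "l 0 = 0" "l 1 = 1"
    using assms by (auto simp: time_changes_def)
  then have "mono_on {0..1} l" by (simp add: strict_mono_on_imp_mono_on)
  then have "l 0 \<le> l t" "l t \<le> l 1"
    using assms(2) by (auto simp: mono_on_def)
  then show ?thesis using m by auto
qed

lemma time_changes_comp:
  assumes "l \<in> time_changes" "m \<in> time_changes"
  shows "(\<lambda>t. m (l t)) \<in> time_changes"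
proof -
  have "continuous_on {0..1} (\<lambda>t. m (l t))"
    by (rule continuous_on_compose2[of "{0..1}" m])
      (use assms time_changes_range[OF assms(1)] in \<open>auto simp: time_changes_def\<close>)
  moreover have "strict_mono_on {0..1} (\<lambda>t. m (l t))"
    using assms time_changes_range[OF assms(1)]
    by (auto simp: time_changes_def strict_mono_on_def)
  ultimately show ?thesis using assms by (auto simp: time_changes_def)
qed

lemma time_changes_inverse:
  assumes "l \<in> time_changes"
  obtains m where "m \<in> time_changes" "\<And>t. t \<in> {0..1} \<Longrightarrow> m (l t) = t"
    "\<And>t. t \<in> {0..1} \<Longrightarrow> l (m t) = t"
proof -
  have l: "continuous_on {0..1} l" "strict_mono_on {0..1} l" "l 0 = 0" "l 1 = 1"
    using assms by (auto simp: time_changes_def)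
  have inj: "inj_on l {0..1}" using l(2) by (rule strict_mono_on_imp_inj_on)
  have im: "l ` {0..1} = {0..1}"
  proof
    show "l ` {0..1} \<subseteq> {0..1}" using time_changes_range[OF assms] by blast
    show "{0..1} \<subseteq> l ` {0..1}"
    proof
      fix y :: real assume "y \<in> {0..1}"
      then obtain x where "0 \<le> x" "x \<le> 1" "l x = y"
        using IVT'[of l 0 y 1] l by auto
      then show "y \<in> l ` {0..1}" by auto
    qed
  qed
  define m where "m = the_inv_into {0..1} l"
  have ml: "m (l t) = t" if "t \<in> {0..1}" for t
    unfolding m_def using the_inv_into_f_f[OF inj that] .
  have lm: "l (m t) = t" if "t \<in> {0..1}" for t
    unfolding m_def using f_the_inv_into_f[OF inj] that im by auto
  have mr: "m t \<in> {0..1}" if "t \<in> {0..1}" for t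
    using that ml im by (metis imageE)
  have "continuous_on (l ` {0..1}) m"
    by (rule continuous_on_inv) (use l ml in auto)
  moreover have "strict_mono_on {0..1} m"
  proof (rule strict_mono_onI)
    fix r s :: real assume rs: "r \<in> {0..1}" "s \<in> {0..1}" "r < s"
    show "m r < m s"
    proof (rule ccontr)
      assume "\<not> m r < m s"
      then have "l (m s) \<le> l (m r)"
        using strict_mono_on_leD[OF l(2)] mr rs by auto
      then show False using lm rs by auto
    qed
  qed
  moreover have "m 0 = 0" "m 1 = 1" using ml[of 0] ml[of 1] l by auto
  ultimately have "m \<in> time_changes" using im by (auto simp: time_changes_def)
  then show thesis using that ml lm by blast
qed

lemma D01_bounded:
  assumes "x \<in> D01"
  obtains B where "\<And>t. t \<in> {0..1} \<Longrightarrow> \<bar>x t\<bar> \<le> B"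
proof -
  have R: "\<exists>d>0. \<exists>B. \<forall>s\<in>{t<..<t+d} \<inter> {0..1}. \<bar>x s\<bar> \<le> B" if "t \<in> {0..1}" for t
  proof (cases "t < 1")
    case True
    have "(x \<longlongrightarrow> x t) (at_right t)" using assms that True by (auto simp: D01_def)
    then have "eventually (\<lambda>s. dist (x s) (x t) < 1) (at_right t)"
      by (rule tendstoD) simp
    then obtain b where b: "b > t" "\<And>s. t < s \<Longrightarrow> s < b \<Longrightarrow> dist (x s) (x t) < 1"
      unfolding eventually_at_right_field by blast
    have "\<bar>x s\<bar> \<le> \<bar>x t\<bar> + 1" if "s \<in> {t<..<t+(b-t)} \<inter> {0..1}" for s
      using b(2)[of s] that by (auto simp: dist_real_def)
    then show ?thesis using b(1) by (intro exI[of _ "b-t"] conjI exI[of _ "\<bar>x t\<bar> + 1"]) auto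
  next
    case False
    then show ?thesis by (intro exI[of _ 1]) auto
  qed
  have L: "\<exists>d>0. \<exists>B. \<forall>s\<in>{t-d<..<t} \<inter> {0..1}. \<bar>x s\<bar> \<le> B" if "t \<in> {0..1}" for t
  proof (cases "0 < t")
    case True
    then have "t \<in> {0<..1}" using that by auto
    then obtain l where "(x \<longlongrightarrow> l) (at_left t)" using assms unfolding D01_def by blast
    then have "eventually (\<lambda>s. dist (x s) l < 1) (at_left t)"
      by (rule tendstoD) simp
    then obtain b where b: "b < t" "\<And>s. b < s \<Longrightarrow> s < t \<Longrightarrow> dist (x s) l < 1"
      unfolding eventually_at_left_field by blast
    have "\<bar>x s\<bar> \<le> \<bar>l\<bar> + 1" if "s \<in> {t-(t-b)<..<t} \<inter> {0..1}" for s
      using b(2)[of s] that by (auto simp: dist_real_def)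
    then show ?thesis using b(1) by (intro exI[of _ "t-b"] conjI exI[of _ "\<bar>l\<bar> + 1"]) auto
  next
    case False
    then show ?thesis by (intro exI[of _ 1]) auto
  qed
  have "\<exists>B. \<forall>t\<in>{0..1}\<inter>{0..1}. \<bar>x t\<bar> \<le> B"
  proof (rule Bolzano[of 0 1 "\<lambda>u v. \<exists>B. \<forall>t\<in>{u..v}\<inter>{0..1}. \<bar>x t\<bar> \<le> B"])
    show "(0::real) \<le> 1" by simp
  next
    fix a b c :: real
    assume "\<exists>B. \<forall>t\<in>{a..b}\<inter>{0..1}. \<bar>x t\<bar> \<le> B" "\<exists>B. \<forall>t\<in>{b..c}\<inter>{0..1}. \<bar>x t\<bar> \<le> B"
    then obtain B C where "\<forall>t\<in>{a..b}\<inter>{0..1}. \<bar>x t\<bar> \<le> B" "\<forall>t\<in>{b..c}\<inter>{0..1}. \<bar>x t\<bar> \<le> C"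
      by blast
    then have "\<forall>t\<in>{a..c}\<inter>{0..1}. \<bar>x t\<bar> \<le> max B C"
      by (auto simp: le_max_iff_disj)
    then show "\<exists>B. \<forall>t\<in>{a..c}\<inter>{0..1}. \<bar>x t\<bar> \<le> B" by blast
  next
    fix t :: real assume t: "0 \<le> t" "t \<le> 1"
    obtain d1 B1 where 1: "d1 > 0" "\<forall>s\<in>{t<..<t+d1} \<inter> {0..1}. \<bar>x s\<bar> \<le> B1"
      using R[of t] t by auto
    obtain d2 B2 where 2: "d2 > 0" "\<forall>s\<in>{t-d2<..<t} \<inter> {0..1}. \<bar>x s\<bar> \<le> B2"
      using L[of t] t by auto
    have "\<forall>s\<in>{a..b}\<inter>{0..1}. \<bar>x s\<bar> \<le> max \<bar>x t\<bar> (max B1 B2)"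
      if ab: "a \<le> t" "t \<le> b" "b - a < min d1 d2" for a b
    proof
      fix s assume s: "s \<in> {a..b}\<inter>{0..1}"
      consider "s = t" | "s < t" | "s > t" by linarith
      then show "\<bar>x s\<bar> \<le> max \<bar>x t\<bar> (max B1 B2)"
      proof cases
        case 2
        then have "s \<in> {t-d2<..<t} \<inter> {0..1}" using s ab by auto
        then have "\<bar>x s\<bar> \<le> B2"
          using \<open>\<forall>s\<in>{t-d2<..<t} \<inter> {0..1}. \<bar>x s\<bar> \<le> B2\<close> by blast
        then show ?thesis by simp
      next
        case 3
        then have "s \<in> {t<..<t+d1} \<inter> {0..1}" using s ab by auto
        then have "\<bar>x s\<bar> \<le> B1" using 1(2) by blast
        then show ?thesis by simp
      qed auto
    qed
    then show "\<exists>d>0. \<forall>a b. a \<le> t \<and> t \<le> b \<and> b - a < d \<longrightarrow>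
        (\<exists>B. \<forall>t\<in>{a..b}\<inter>{0..1}. \<bar>x t\<bar> \<le> B)"
      using 1 2 by (intro exI[of _ "min d1 d2"]) (auto intro!: exI)
  qed
  then show thesis using that unfolding Int_absorb by blast
qed

lemma skorohod_set_nonempty:
  assumes "x \<in> D01" "y \<in> D01"
  shows "skorohod_set x y \<noteq> {}"
proof -
  obtain B where B: "\<And>t. t \<in> {0..1} \<Longrightarrow> \<bar>x t\<bar> \<le> B" using D01_bounded[OF assms(1)] by blast
  obtain C where C: "\<And>t. t \<in> {0..1} \<Longrightarrow> \<bar>y t\<bar> \<le> C" using D01_bounded[OF assms(2)] by blast
  have id: "(\<lambda>t. t) \<in> time_changes" by (auto simp: time_changes_def strict_mono_on_def)
  have "\<bar>x t - y t\<bar> \<le> B + C + 1" if "t \<in> {0..1}" for t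
    using B[OF that] C[OF that] by linarith
  moreover have "0 < B + C + 1" using B[of 0] C[of 0] by auto
  ultimately have "B + C + 1 \<in> skorohod_set x y"
    using id by (auto simp: skorohod_set_def intro!: bexI[of _ "\<lambda>t. t"])
  then show ?thesis by blast
qed

lemma skorohod_set_bdd_below: "bdd_below (skorohod_set x y)"
  by (rule bdd_belowI[of _ 0]) (auto simp: skorohod_set_def)

lemma skorohod_set_commute_subset: "skorohod_set x y \<subseteq> skorohod_set y x"
proof
  fix e assume "e \<in> skorohod_set x y"
  then obtain l where l: "0 < e" "l \<in> time_changes"
    "\<forall>t\<in>{0..1}. \<bar>l t - t\<bar> \<le> e \<and> \<bar>x t - y (l t)\<bar> \<le> e"
    by (auto simp: skorohod_set_def)
  obtain m where m: "m \<in> time_changes" "\<And>t. t \<in> {0..1} \<Longrightarrow> l (m t) = t"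
    using time_changes_inverse[OF l(2)] by blast
  have "\<bar>m t - t\<bar> \<le> e \<and> \<bar>y t - x (m t)\<bar> \<le> e" if "t \<in> {0..1}" for t
    using l(3)[rule_format, OF time_changes_range[OF m(1) that]] m(2)[OF that]
    by (auto simp: abs_minus_commute)
  then show "e \<in> skorohod_set y x" using l(1) m(1) unfolding skorohod_set_def by blast
qed

lemma skorohod_dist_commute: "skorohod_dist x y = skorohod_dist y x"
  using skorohod_set_commute_subset[of x y] skorohod_set_commute_subset[of y x]
  by (auto simp: skorohod_dist_def)

lemma skorohod_set_triangle:
  assumes "a \<in> skorohod_set x y" "b \<in> skorohod_set y z"
  shows "a + b \<in> skorohod_set x z"
proof -
  obtain l where l: "0 < a" "l \<in> time_changes"
    "\<forall>t\<in>{0..1}. \<bar>l t - t\<bar> \<le> a \<and> \<bar>x t - y (l t)\<bar> \<le> a"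
    using assms(1) by (auto simp: skorohod_set_def)
  obtain m where m: "0 < b" "m \<in> time_changes"
    "\<forall>t\<in>{0..1}. \<bar>m t - t\<bar> \<le> b \<and> \<bar>y t - z (m t)\<bar> \<le> b"
    using assms(2) by (auto simp: skorohod_set_def)
  have "\<bar>m (l t) - t\<bar> \<le> a + b \<and> \<bar>x t - z (m (l t))\<bar> \<le> a + b" if "t \<in> {0..1}" for t
    using l(3)[rule_format, OF that] m(3)[rule_format, OF time_changes_range[OF l(2) that]]
    by linarith
  then show ?thesis
    using l(1) m(1) time_changes_comp[OF l(2) m(2)]
    by (auto simp: skorohod_set_def intro!: bexI[of _ "\<lambda>t. m (l t)"])
qed

lemma skorohod_dist_eq_0:
  assumes x: "x \<in> D01" and y: "y \<in> D01" and 0: "skorohod_dist x y = 0"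
  shows "x = y"
proof -
  have small: "\<exists>l\<in>time_changes. \<forall>t\<in>{0..1}. \<bar>l t - t\<bar> \<le> e \<and> \<bar>x t - y (l t)\<bar> \<le> e"
    if "e > 0" for e
  proof -
    have "Inf (skorohod_set x y) < e" using 0 x y that by (simp add: skorohod_dist_def)
    then obtain a where "a \<in> skorohod_set x y" "a < e"
      using cInf_lessD[OF skorohod_set_nonempty[OF x y]] by blast
    then obtain l where "l \<in> time_changes"
      "\<forall>t\<in>{0..1}. \<bar>l t - t\<bar> \<le> a \<and> \<bar>x t - y (l t)\<bar> \<le> a" "a < e"
      by (auto simp: skorohod_set_def)
    then show ?thesis by (meson less_imp_le order_trans)
  qed
  have inner: "x t = y t" if t: "t \<in> {0..<1}" for t
  proof (rule ccontr)
    assume ne: "x t \<noteq> y t"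
    define e where "e = \<bar>x t - y t\<bar> / 4"
    have e: "e > 0" using ne by (simp add: e_def)
    have rx: "(x \<longlongrightarrow> x t) (at_right t)" and ry: "(y \<longlongrightarrow> y t) (at_right t)"
      using x y t by (auto simp: D01_def)
    obtain b where b: "b > t" "\<And>s. t < s \<Longrightarrow> s < b \<Longrightarrow> dist (x s) (x t) < e"
      using tendstoD[OF rx e] unfolding eventually_at_right_field by blast
    obtain c where c: "c > t" "\<And>s. t < s \<Longrightarrow> s < c \<Longrightarrow> dist (y s) (y t) < e"
      using tendstoD[OF ry e] unfolding eventually_at_right_field by blast
    define r where "r = (min (min b c) 1 - t) / 2"
    have r: "r > 0" "t + 2 * r \<le> b" "t + 2 * r \<le> c" "t + 2 * r \<le> 1"
      using b(1) c(1) t by (auto simp: r_def min_def field_simps)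
    have "min e (r / 2) > 0" using e r by simp
    from small[OF this] obtain l where l: "l \<in> time_changes"
      "\<forall>u\<in>{0..1}. \<bar>l u - u\<bar> \<le> min e (r / 2) \<and> \<bar>x u - y (l u)\<bar> \<le> min e (r / 2)"
      by blast
    have "t + r \<in> {0..1}" using r t by auto
    then have lr: "\<bar>l (t + r) - (t + r)\<bar> \<le> r / 2" "\<bar>x (t + r) - y (l (t + r))\<bar> \<le> e"
      using l(2) by auto
    have "\<bar>x (t + r) - x t\<bar> < e" using b(2)[of "t + r"] r by (simp add: dist_real_def)
    moreover have "t < l (t + r)" "l (t + r) < c" using lr(1) r by linarith+
    then have "\<bar>y (l (t + r)) - y t\<bar> < e" using c(2) by (simp add: dist_real_def)
    ultimately have "\<bar>x t - y t\<bar> < 3 * e" using lr(2) by linarith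
    then show False using e by (simp add: e_def)
  qed
  have one: "x 1 = y 1"
  proof (rule ccontr)
    assume ne: "x 1 \<noteq> y 1"
    then have "\<bar>x 1 - y 1\<bar> / 2 > 0" by simp
    from small[OF this] obtain l where l: "l \<in> time_changes"
      "\<forall>t\<in>{0..1}. \<bar>l t - t\<bar> \<le> \<bar>x 1 - y 1\<bar> / 2 \<and> \<bar>x t - y (l t)\<bar> \<le> \<bar>x 1 - y 1\<bar> / 2" by blast
    have "l 1 = 1" using l(1) by (simp add: time_changes_def)
    then have "\<bar>x 1 - y 1\<bar> \<le> \<bar>x 1 - y 1\<bar> / 2" using l(2) by (metis atLeastAtMost_iff order_refl zero_le_one)
    then show False using ne by simp
  qed
  show ?thesis
  proof (rule extensionalityI[of _ "{0..1}"])
    show "x \<in> extensional {0..1}" "y \<in> extensional {0..1}" using x y by (auto simp: D01_def)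
    show "x t = y t" if "t \<in> {0..1}" for t
      using that inner[of t] one by (cases "t = 1") auto
  qed
qed

interpretation skorohod: Metric_space D01 skorohod_dist
proof
  fix x y
  show "0 \<le> skorohod_dist x y"
    using skorohod_set_nonempty[of x y]
    by (auto simp: skorohod_dist_def skorohod_set_def intro!: cInf_greatest)
  show "skorohod_dist x y = skorohod_dist y x" by (rule skorohod_dist_commute)
next
  fix x y assume xy: "x \<in> D01" "y \<in> D01"
  have "skorohod_dist x x \<le> e" if "e > 0" for e
  proof -
    have "e \<in> skorohod_set x x" using that
      by (auto simp: skorohod_set_def time_changes_def strict_mono_on_def intro!: exI[of _ "\<lambda>t. t"])
    then show ?thesis using xy skorohod_set_bdd_below by (auto simp: skorohod_dist_def intro: cInf_lower)
  qed
  then have "skorohod_dist x x \<le> 0" by (rule field_le_epsilon[of _ 0, simplified])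
  moreover have "0 \<le> skorohod_dist x x" using xy skorohod_set_nonempty[of x x]
    by (auto simp: skorohod_dist_def skorohod_set_def intro!: cInf_greatest)
  ultimately show "(skorohod_dist x y = 0) = (x = y)"
    using skorohod_dist_eq_0[OF xy] by auto
next
  fix x y z assume xyz: "x \<in> D01" "y \<in> D01" "z \<in> D01"
  show "skorohod_dist x z \<le> skorohod_dist x y + skorohod_dist y z"
  proof (rule field_le_epsilon)
    fix e :: real assume "0 < e"
    then have "Inf (skorohod_set x y) < Inf (skorohod_set x y) + e / 2"
      "Inf (skorohod_set y z) < Inf (skorohod_set y z) + e / 2" by auto
    then obtain a b where ab: "a \<in> skorohod_set x y" "a < Inf (skorohod_set x y) + e / 2"
      "b \<in> skorohod_set y z" "b < Inf (skorohod_set y z) + e / 2"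
      by (meson cInf_lessD skorohod_set_nonempty xyz)
    have "Inf (skorohod_set x z) \<le> a + b"
      using skorohod_set_triangle[OF ab(1,3)] skorohod_set_bdd_below by (rule cInf_lower)
    then show "skorohod_dist x z \<le> skorohod_dist x y + skorohod_dist y z + e"
      using ab xyz by (simp add: skorohod_dist_def)
  qed
qed

definition skorohod_topology :: "(real \<Rightarrow> real) topology" where
  "skorohod_topology = skorohod.mtopology"

definition skorohod_borel :: "(real \<Rightarrow> real) measure" where
  "skorohod_borel = sigma D01 {U. openin skorohod_topology U}"

definition path01 :: "(real \<Rightarrow> 'a \<Rightarrow> real) \<Rightarrow> 'a \<Rightarrow> real \<Rightarrow> real" where
  "path01 Y \<omega> = (\<lambda>\<tau>\<in>{0..1}. Y \<tau> \<omega>)"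

text \<open>Weak convergence in \<open>D[0,1]\<close> of the processes \<open>Y n\<close> (on \<open>M\<close>) to the process \<open>Z\<close> (on \<open>N\<close>);
  all of them are required to be (Borel measurable) random elements of \<open>D[0,1]\<close>.\<close>

definition weak_conv_D01 ::
  "'a measure \<Rightarrow> (nat \<Rightarrow> real \<Rightarrow> 'a \<Rightarrow> real) \<Rightarrow> 'b measure \<Rightarrow> (real \<Rightarrow> 'b \<Rightarrow> real) \<Rightarrow> bool" where
  "weak_conv_D01 M Y N Z \<longleftrightarrow>
     (\<forall>n. path01 (Y n) \<in> measurable M skorohod_borel) \<and>
     path01 Z \<in> measurable N skorohod_borel \<and>
     (\<forall>f. continuous_map skorohod_topology euclideanreal f \<and> bounded (f ` D01) \<longrightarrow>
        (\<lambda>n. \<integral>\<omega>. f (path01 (Y n) \<omega>) \<partial>M) \<longlonglongrightarrow> (\<integral>\<omega>. f (path01 Z \<omega>) \<partial>N))"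

definition gaussian_measure :: "real \<Rightarrow> real \<Rightarrow> real measure" where
  "gaussian_measure \<mu> \<sigma> =
     (if \<sigma> = 0 then return borel \<mu> else density lborel (\<lambda>x. ennreal (normal_density \<mu> \<sigma> x)))"

definition gaussian_process :: "'b measure \<Rightarrow> real set \<Rightarrow> (real \<Rightarrow> 'b \<Rightarrow> real) \<Rightarrow> bool" where
  "gaussian_process N T B \<longleftrightarrow>
     (\<forall>t\<in>T. B t \<in> borel_measurable N) \<and>
     (\<forall>I a. finite I \<and> I \<subseteq> T \<longrightarrow>
        (\<exists>\<mu> \<sigma>. 0 \<le> \<sigma> \<and> distr N borel (\<lambda>\<omega>. \<Sum>t\<in>I. a t * B t \<omega>) = gaussian_measure \<mu> \<sigma>))"

text \<open>The version with continuous sample paths. The covariance gives \<open>E (B t)\<^sup>2 = t powr (2 * H)\<close>.\<close>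

definition fractional_brownian_motion :: "'b measure \<Rightarrow> real \<Rightarrow> (real \<Rightarrow> 'b \<Rightarrow> real) \<Rightarrow> bool" where
  "fractional_brownian_motion N H B \<longleftrightarrow>
     prob_space N \<and> gaussian_process N {0..} B \<and>
     (\<forall>t\<ge>0. (\<integral>\<omega>. B t \<omega> \<partial>N) = 0) \<and>
     (\<forall>s\<ge>0. \<forall>t\<ge>0. (\<integral>\<omega>. B s \<omega> * B t \<omega> \<partial>N) =
        (s powr (2 * H) + t powr (2 * H) - \<bar>t - s\<bar> powr (2 * H)) / 2) \<and>
     (\<forall>\<omega>\<in>space N. continuous_on {0..} (\<lambda>t. B t \<omega>))"

end

(* Let G t s be the coefficient of zeta_s in X_t and b j = Q (alpha j). The projections
   E[X_t | F_[u,t]] - E[X_t | F_[u+1,t]] equal zeta_u (G t u), so the equation becomes a recursion for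
   G t s in terms of the G t u with u > s. Second moments of this recursion together with
   beta_bar = o(b) give ||G t (t - j) - b j||_2 = o(j^(d-1)), uniformly in t. As zeta_s is orthogonal
   to everything built from later innovations, E X_0 X_t = sum_k E G 0 (-k) G t (-k) differs from
   sum_k b_k b_(t+k) by o(t^(2d-1)), and the latter sum is a Riemann sum for a Beta integral.

   For the invariance principle the partial sums of X are compared in L2 with those of the linear
   process with coefficients b_j; characteristic functions of linear forms in iid variables and
   Stone-Weierstrass on a torus (a Cramer-Wold argument) give the finite-dimensional limits. Since
   E (S_(i+l) - S_i)^2 = O(l^(1+2d)) with exponent > 1, dyadic chaining bounds the distance between a
   path and its discretization to the times i/m, uniformly in n. The limit has continuous paths, so
   its discretizations converge too. This settles Lipschitz test functions, from which bounded
   continuous ones are reached by inf-convolution. *)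

theory Submission
  imports Defs "HOL-Real_Asymp.Real_Asymp"
begin

section \<open>Correlations of regularly varying sequences\<close>

text \<open>The coefficients are random, nonlinear functions of later innovations, so the sums are
  not linear forms in independent variables. What replaces linearity is that each term
  \<open>\<zeta> s * G t s\<close> is a martingale difference in reversed time: second moments of
  finite combinations are governed by the coefficients alone, and these by the deterministic kernels
  \<open>b\<close> and \<open>eps\<close>. Rates are expressed as limits of
  \<open>x j * real j powr p\<close> rather than as asymptotic equivalences. Such a limit may be 0,
  so one lemma on correlations and one on double sums serve the main kernel \<open>b\<close>, the
  majorant \<open>bound\<close> and the negligible kernel \<open>eps\<close> alike. No tightness or
  relative compactness argument occurs. Second moment bounds give explicit errors instead: order
  m^(-d) for reading a path only at the times i/m, order L^(-2) for wrapping a vector around a torus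
  of scale L. Both are uniform in large n, so m and L can be fixed before n tends to
  infinity.\<close>

lemma beta_second_kind:
  fixes d :: real
  assumes d: "0 < d" "d < 1/2"
  shows "integrable lborel (\<lambda>u. indicator {0<..} u * (u powr (d - 1) * (1 + u) powr (d
      - 1)))" (is "integrable _ ?f")
    and "(\<integral>u. indicator {0<..} u * (u powr (d - 1) * (1 + u) powr (d - 1)) \<partial>lborel) = Beta d (1 - 2 * d)"
proof -
  define h :: "real \<Rightarrow> real" where "h u = u powr (d - 1) * (1 + u) powr (d - 1)" for u
  \<comment> \<open>The substitution u = v / (1 - v) maps the unit interval onto the half line, with
    1 + u = 1 / (1 - v) and du = (1 - v)^(-2) dv. The powers of 1 - v add up to -2 + 2 (1 - d) = (1
    - 2 d) - 1, hence the second Beta parameter.\<close>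
  define g :: "real \<Rightarrow> real" where "g v = v / (1 - v)" for v
  define g' :: "real \<Rightarrow> real" where "g' v = 1 / (1 - v)\<^sup>2" for v
  let ?S = "{0<..<1::real}"
  have der: "(g has_field_derivative g' v) (at v within ?S)" if "v \<in> ?S" for v
    unfolding g_def g'_def using that
    by (auto intro!: derivative_eq_intros simp: power2_eq_square field_simps)
  have inj: "inj_on g ?S"
    by (auto simp: inj_on_def g_def field_simps)
  have im: "g ` ?S = {0<..}"
  proof
    show "g ` ?S \<subseteq> {0<..}" by (auto simp: g_def)
    show "{0<..} \<subseteq> g ` ?S"
    proof
      fix u :: real assume u: "u \<in> {0<..}"
      then have "u = g (u / (1 + u))" "u / (1 + u) \<in> ?S" by (auto simp: g_def field_simps)
      then show "u \<in> g ` ?S" by blast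
    qed
  qed
  have eq: "\<bar>g' v\<bar> * h (g v) = v powr (d - 1) * (1 - v) powr ((1 - 2 * d) - 1)" if v: "v \<in> ?S" for v
  proof -
    have 1: "1 + g v = 1 / (1 - v)" using v by (simp add: g_def field_simps)
    have 2: "1 / (1 - v)\<^sup>2 = (1 - v) powr (-2)" using v
      by (simp add: powr_minus powr_numeral field_simps)
    have "\<bar>g' v\<bar> * h (g v) = (1 - v) powr (-2) * (v powr (d - 1) * (1 - v) powr (1 - d) * (1 - v) powr (1 - d))"
      using v unfolding h_def 1 unfolding g_def g'_def 2[symmetric]
      by (simp add: powr_divide powr_diff field_simps)
    also have "\<dots> = v powr (d - 1) * ((1 - v) powr (-2) * (1 - v) powr (1 - d) * (1 - v) powr (1 - d))"
      by (simp add: algebra_simps)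
    also have "(1 - v) powr (-2) * (1 - v) powr (1 - d) * (1 - v) powr (1 - d) = (1 - v) powr ((1 - 2 * d) - 1)"
      using v by (simp add: powr_add[symmetric])
    finally show ?thesis .
  qed
  have B: "((\<lambda>v. v powr (d - 1) * (1 - v) powr ((1 - 2 * d) - 1)) has_integral Beta d (1 - 2 * d)) ?S"
    using has_integral_Beta_real[of d "1 - 2 * d"] d by (simp add: has_integral_Icc_iff_Ioo)
  then have B': "((\<lambda>v. \<bar>g' v\<bar> * h (g v)) has_integral Beta d (1 - 2 * d)) ?S"
    using eq by (subst has_integral_cong[OF eq]) auto
  have "(\<lambda>v. \<bar>g' v\<bar> * h (g v)) absolutely_integrable_on ?S"
    using B' by (intro nonnegative_absolutely_integrable_1) (auto simp: h_def integrable_on_def)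
  then have main: "h absolutely_integrable_on {0<..} \<and> integral {0<..} h = Beta d (1 - 2 * d)"
    using has_absolute_integral_change_of_variables_1'[OF _ der inj, of h "Beta d (1 - 2 * d)"] B'
    unfolding im by (auto simp: integral_unique)
  have fh: "?f = (\<lambda>u. indicat_real {0<..} u *\<^sub>R h u)" by (auto simp: h_def)
  have [measurable]: "h \<in> borel_measurable borel" unfolding h_def by measurable
  have 1: "integrable lebesgue ?f" using main unfolding fh set_integrable_def by simp
  show "integrable lborel ?f"
    using 1 by (subst (asm) integrable_completion) auto
  have "(\<integral>u. ?f u \<partial>lborel) = (LINT u:{0<..}|lebesgue. h u)"
    unfolding fh set_lebesgue_integral_def by (rule integral_completion[symmetric]) auto
  also have "\<dots> = Beta d (1 - 2 * d)" using main set_lebesgue_integral_eq_integral(2)[of "{0<..}" h] by simp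
  finally show "(\<integral>u. ?f u \<partial>lborel) = Beta d (1 - 2 * d)" .
qed

text \<open>The fibre over k is the interval [k/t, (k+1)/t) of length 1/t. This turns a series over
  k into an integral over u = k/t, so that Riemann sum limits become instances of dominated
  convergence.\<close>

lemma distr_floor_lborel:
  assumes t: "(t::nat) > 0"
  shows "distr (restrict_space lborel {0..}) (count_space UNIV) (\<lambda>u::real. nat \<lfloor>real t * u\<rfloor>)
    = density (count_space UNIV) (\<lambda>_. ennreal (1 / real t))"
proof (rule measure_eqI_countable[of _ UNIV])
  let ?g = "\<lambda>u::real. nat \<lfloor>real t * u\<rfloor>"
  have m: "?g \<in> measurable (restrict_space lborel {0..}) (count_space UNIV)"
    by (intro measurable_restrict_space1) measurable
  show "emeasure (distr (restrict_space lborel {0..}) (count_space UNIV) ?g) {k}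
     = emeasure (density (count_space UNIV) (\<lambda>_. ennreal (1 / real t))) {k}" for k
  proof -
    have eq: "?g -` {k} \<inter> {0..} = {real k / real t ..< (real k + 1) / real t}"
    proof (intro set_eqI iffI)
      fix u :: real assume "u \<in> ?g -` {k} \<inter> {0..}"
      then have u: "0 \<le> u" "nat \<lfloor>real t * u\<rfloor> = k" by auto
      then have "\<lfloor>real t * u\<rfloor> = int k" using t by auto
      then have "real k \<le> real t * u" "real t * u < real k + 1" by linarith+
      then show "u \<in> {real k / real t ..< (real k + 1) / real t}"
        using t by (simp add: field_simps)
    next
      fix u :: real assume u: "u \<in> {real k / real t ..< (real k + 1) / real t}"
      then have "real k \<le> real t * u" "real t * u < real k + 1" using t by (auto simp: field_simps)
      then have "nat \<lfloor>real t * u\<rfloor> = k" by linarith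
      moreover have "0 \<le> u" using u order_trans[of 0 "real k / real t" u] by auto
      ultimately show "u \<in> ?g -` {k} \<inter> {0..}" by auto
    qed
    have "emeasure (distr (restrict_space lborel {0..}) (count_space UNIV) ?g) {k}
        = emeasure (restrict_space lborel {0..}) (?g -` {k} \<inter> {0..})"
      by (subst emeasure_distr[OF m]) (auto simp: space_restrict_space)
    also have "\<dots> = emeasure lborel {real k / real t ..< (real k + 1) / real t}"
      unfolding eq using t
      by (subst emeasure_restrict_space) (auto intro: order_trans[of 0 "real k / real t"])
    also have "\<dots> = ennreal (1 / real t)"
      using t by (subst emeasure_lborel_Ico) (auto simp: field_simps)
    also have "\<dots> = emeasure (density (count_space UNIV) (\<lambda>_. ennreal (1 / real t))) {k}"
      by (subst emeasure_density) (auto simp: nn_integral_count_space_indicator)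
    finally show ?thesis .
  qed
qed auto

lemma suminf_eq_integral_floor:
  fixes f :: "nat \<Rightarrow> real"
  assumes t: "(t::nat) > 0" and int: "integrable lborel (\<lambda>u. indicator {0..} u * f (nat \<lfloor>real t * u\<rfloor>))"
  shows "summable (\<lambda>k. \<bar>f k\<bar>)" "suminf f = real t * (\<integral>u. indicator {0..} u * f (nat \<lfloor>real t * u\<rfloor>) \<partial>lborel)"
proof -
  let ?g = "\<lambda>u::real. nat \<lfloor>real t * u\<rfloor>"
  let ?D = "density (count_space UNIV) (\<lambda>_::nat. ennreal (1 / real t))"
  have m: "?g \<in> measurable (restrict_space lborel {0..}) (count_space UNIV)"
    by (intro measurable_restrict_space1) measurable
  have "integrable (restrict_space lborel {0..}) (\<lambda>u. f (?g u))"
    using int by (subst integrable_restrict_space) (auto simp: mult.commute)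
  then have "integrable ?D f"
    unfolding distr_floor_lborel[OF t, symmetric]
    by (subst integrable_distr_eq[OF m]) auto
  then have "integrable (count_space UNIV) (\<lambda>k. (1 / real t) *\<^sub>R f k)"
    by (subst (asm) integrable_density) auto
  then have "integrable (count_space UNIV) (\<lambda>k. real t *\<^sub>R ((1 / real t) *\<^sub>R f k))"
    by (rule integrable_scaleR_right)
  then have c: "integrable (count_space UNIV) f" using t by simp
  then show "summable (\<lambda>k. \<bar>f k\<bar>)" by (simp add: integrable_count_space_nat_iff)
  have "(\<integral>u. indicator {0..} u * f (?g u) \<partial>lborel) = (\<integral>u. f (?g u) \<partial>restrict_space lborel {0..})"
    by (subst integral_restrict_space) auto
  also have "\<dots> = integral\<^sup>L ?D f"
    unfolding distr_floor_lborel[OF t, symmetric] by (subst integral_distr[OF m]) auto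
  also have "\<dots> = (\<integral>k. (1 / real t) *\<^sub>R f k \<partial>count_space UNIV)"
    by (subst integral_density) auto
  also have "\<dots> = (1 / real t) * suminf f"
    using integral_count_space_nat[OF c] by simp
  finally show "suminf f = real t * (\<integral>u. indicator {0..} u * f (?g u) \<partial>lborel)"
    using t by simp
qed

text \<open>A convergent sequence is bounded. Passing from k to k + 1 in the power also covers k =
  0, where \<open>real 0 powr (1 - d)\<close> is 0 and the hypothesis gives no information.\<close>

lemma power_bound_of_tendsto:
  fixes x :: "nat \<Rightarrow> real"
  assumes d: "d < 1" and x: "(\<lambda>k. x k * real k powr (1 - d)) \<longlonglongrightarrow> a"
  obtains C where "C \<ge> 0" "\<And>k. \<bar>x k\<bar> \<le> C * real (k + 1) powr (d - 1)"
proof -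
  have "(\<lambda>k. x k * real (k + 1) powr (1 - d)) \<longlonglongrightarrow> a"
  proof -
    have "(\<lambda>k. real (k + 1) powr (1 - d) / real k powr (1 - d)) \<longlonglongrightarrow> 1" by real_asymp
    from tendsto_mult[OF x this]
    have "(\<lambda>k. x k * real k powr (1 - d) * (real (k + 1) powr (1 - d) / real k powr (1 - d))) \<longlonglongrightarrow> a" by simp
    then show ?thesis
      by (rule Lim_transform_eventually)
         (use eventually_gt_at_top[of "0::nat"] in \<open>eventually_elim, auto\<close>)
  qed
  then have "Bseq (\<lambda>k. x k * real (k + 1) powr (1 - d))"
    using convergent_imp_Bseq convergent_def by blast
  then obtain C where C: "C > 0" "\<And>k. norm (x k * real (k + 1) powr (1 - d)) \<le> C" by (auto simp: Bseq_def)
  have "\<bar>x k\<bar> \<le> C * real (k + 1) powr (d - 1)" for k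
  proof -
    have "\<bar>x k\<bar> = \<bar>x k\<bar> * real (k + 1) powr (1 - d) * real (k + 1) powr (d - 1)"
      by (simp add: powr_add[symmetric] mult.assoc)
    also have "\<dots> \<le> C * real (k + 1) powr (d - 1)"
      using C(2)[of k] by (intro mult_right_mono) (auto simp: abs_mult)
    finally show ?thesis .
  qed
  with C(1) show thesis by (intro that[of C]) auto
qed

text \<open>The pointwise part of the Riemann sum limit: an index of size u t turns the power of the
  index into the power of t times u^(d-1).\<close>

lemma tendsto_scaled_index:
  fixes x :: "nat \<Rightarrow> real" and k :: "nat \<Rightarrow> nat"
  assumes x: "(\<lambda>k. x k * real k powr (1 - d)) \<longlonglongrightarrow> a"
    and u: "u > 0" and k: "(\<lambda>t. real (k t) / real t) \<longlonglongrightarrow> u"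
  shows "(\<lambda>t. x (k t) * real t powr (1 - d)) \<longlonglongrightarrow> a * u powr (d - 1)"
proof -
  have fl: "filterlim (\<lambda>t. real (k t) / real t * real t) at_top sequentially"
    by (rule filterlim_tendsto_pos_mult_at_top[OF k u filterlim_real_sequentially])
  have ev: "\<forall>\<^sub>F t in sequentially. real (k t) / real t * real t = real (k t)"
    using eventually_gt_at_top[of "0::nat"] by eventually_elim auto
  have "filterlim (\<lambda>t. real (k t)) at_top sequentially"
    using fl unfolding filterlim_cong[OF refl refl ev] .
  then have kt: "filterlim k at_top sequentially"
    unfolding filterlim_at_top by (auto dest: spec[of _ "real _"])
  have 1: "(\<lambda>t. x (k t) * real (k t) powr (1 - d)) \<longlonglongrightarrow> a" by (rule filterlim_compose[OF x kt])
  have 2: "(\<lambda>t. (real (k t) / real t) powr (d - 1)) \<longlonglongrightarrow> u powr (d - 1)"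
    by (rule tendsto_powr[OF k]) (use u in auto)
  have "\<forall>\<^sub>F t in sequentially. k t > 0" using kt unfolding filterlim_at_top
      by (auto simp: Suc_le_eq dest: spec[of _ 1])
  then have "\<forall>\<^sub>F t in sequentially. x (k t) * real (k t) powr (1 - d) * (real (k t) / real t) powr (d - 1)
      = x (k t) * real t powr (1 - d)"
    using eventually_gt_at_top[of 0]
  proof eventually_elim
    case (elim t)
    then show ?case by (simp add: powr_divide powr_diff field_simps)
  qed
  then show ?thesis by (rule Lim_transform_eventually[OF tendsto_mult[OF 1 2]])
qed

text \<open>With k = t u the sum becomes a Riemann sum of u^(d-1) (1+u)^(d-1), whose integral is the
  Beta value. The limits a and b are arbitrary reals; the value 0 is what later makes the error
  kernels negligible.\<close>

lemma power_sequences_correlation: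
  fixes x y :: "nat \<Rightarrow> real"
  assumes d: "0 < d" "d < 1/2"
    and x: "(\<lambda>k. x k * real k powr (1 - d)) \<longlonglongrightarrow> a"
    and y: "(\<lambda>k. y k * real k powr (1 - d)) \<longlonglongrightarrow> b"
  shows "summable (\<lambda>k. \<bar>x k * y (t + k)\<bar>)"
    and "(\<lambda>t. (\<Sum>k. x k * y (t + k)) * real t powr (1 - 2 * d)) \<longlonglongrightarrow> a * b * Beta d (1 - 2 * d)"
proof -
  obtain C where C: "C \<ge> 0" "\<And>k. \<bar>x k\<bar> \<le> C * real (k + 1) powr (d - 1)"
    using power_bound_of_tendsto[OF _ x] d by auto
  obtain D where D: "D \<ge> 0" "\<And>k. \<bar>y k\<bar> \<le> D * real (k + 1) powr (d - 1)"
    using power_bound_of_tendsto[OF _ y] d by auto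
  \<comment> \<open>The factor t^(2-2d) is the normalization t^(1-2d) times the mesh factor t; it is
    shared out as t^(1-d) to each of the two sequences.\<close>
  define F where "F t u = indicator {0..} u * (x (nat \<lfloor>real t * u\<rfloor>) * y (t + nat \<lfloor>real t * u\<rfloor>))
      * real t powr (2 - 2 * d)"
    for t :: nat and u :: real
  define G where "G u = indicator {0<..} u * (u powr (d - 1) * (1 + u) powr (d - 1))" for u :: real
  have G: "integrable lborel G" "integral\<^sup>L lborel G = Beta d (1 - 2 * d)"
    using beta_second_kind[OF d] by (auto simp: G_def[abs_def])
  have F_meas[measurable]: "F t \<in> borel_measurable lborel" for t
    unfolding F_def by measurable
  \<comment> \<open>The shift by 1 in the power bounds absorbs the floor: n + t u is at most n +
    floor(t u) + 1, and the exponent d - 1 is negative.\<close>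
  have bound1: "\<bar>z (n + nat \<lfloor>real t * u\<rfloor>)\<bar> * real t powr (1 - d) \<le> K * (real n / real t + u) powr (d - 1)"
    if z: "K \<ge> 0" "\<And>k. \<bar>z k\<bar> \<le> K * real (k + 1) powr (d - 1)" and u: "u > 0" and t: "t > 0"
    for z :: "nat \<Rightarrow> real" and n t :: nat and u K
  proof -
    have "real n + real t * u \<le> real (n + nat \<lfloor>real t * u\<rfloor> + 1)" using u t by simp linarith
    then have "real (n + nat \<lfloor>real t * u\<rfloor> + 1) powr (d - 1) \<le> (real n + real t * u) powr (d - 1)"
      using u t d by (intro powr_mono2') (auto intro!: add_nonneg_pos)
    also have "real n + real t * u = real t * (real n / real t + u)" using t by (simp add: field_simps)
    also have "\<dots> powr (d - 1) = real t powr (d - 1) * (real n / real t + u) powr (d - 1)"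
      by (rule powr_mult)
    finally have "\<bar>z (n + nat \<lfloor>real t * u\<rfloor>)\<bar> * real t powr (1 - d)
       \<le> (K * (real t powr (d - 1) * (real n / real t + u) powr (d - 1))) * real t powr (1 - d)"
      by (intro mult_right_mono order_trans[OF z(2)] mult_left_mono z) auto
    also have "\<dots> = K * (real n / real t + u) powr (d - 1) * (real t powr (d - 1) * real t powr (1 - d))"
      by simp
    also have "real t powr (d - 1) * real t powr (1 - d) = 1" using t by (simp add: powr_add[symmetric])
    finally show ?thesis by simp
  qed
  \<comment> \<open>At u = 0 the dominating function \<open>G\<close> vanishes while
    \<open>F t\<close> need not, so this point is removed as a null set.\<close>
  have AE0: "AE u in lborel. u \<noteq> (0::real)" by (rule AE_lborel_singleton)
  have split: "real t powr (2 - 2 * d) = real t powr (1 - d) * real t powr (1 - d)" for t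
    by (simp add: powr_add[symmetric])
  have bd: "norm (F t u) \<le> C * D * G u" if t: "t > 0" and u: "u \<noteq> 0" for t u
  proof (cases "u > 0")
    case True
    have "norm (F t u) = (\<bar>x (0 + nat \<lfloor>real t * u\<rfloor>)\<bar> * real t powr (1 - d)) * (\<bar>y (t + nat \<lfloor>real t * u\<rfloor>)\<bar>
        * real t powr (1 - d))"
      using True by (simp add: F_def split abs_mult)
    also have "\<dots> \<le> (C * (real 0 / real t + u) powr (d - 1)) * (D * (real t / real t + u) powr (d - 1))"
      using True t by (intro mult_mono bound1 C D mult_nonneg_nonneg) auto
    also have "\<dots> = C * D * G u" using True t by (simp add: G_def)
    finally show ?thesis .
  next
    case False
    then show ?thesis using u by (simp add: F_def G_def)
  qed
  have intF: "integrable lborel (F t)" if "t > 0" for t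
    by (rule Bochner_Integration.integrable_bound[OF integrable_mult_right[OF G(1), of "C * D"]])
       (use AE0 bd[OF that] C(1) D(1) in \<open>auto simp: G_def\<close>)
  have intF': "integrable lborel (\<lambda>u. indicator {0..} u * (x (nat \<lfloor>real t * u\<rfloor>) * y (t + nat \<lfloor>real t
      * u\<rfloor>)))" if "t > 0" for t
    using integrable_mult_left[OF intF[OF that], of "1 / real t powr (2 - 2 * d)"] that
    unfolding F_def by simp
  have sumF: "summable (\<lambda>k. \<bar>x k * y (t + k)\<bar>)"
    "(\<Sum>k. x k * y (t + k)) * real t powr (1 - 2 * d) = integral\<^sup>L lborel (F t)" if t: "t > 0" for t
  proof -
    note s = suminf_eq_integral_floor[where f = "\<lambda>k. x k * y (t + k)", OF t intF'[OF t]]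
    show "summable (\<lambda>k. \<bar>x k * y (t + k)\<bar>)" by (rule s(1))
    define I where "I = (\<integral>u. indicator {0..} u * (x (nat \<lfloor>real t * u\<rfloor>) * y (t + nat \<lfloor>real t * u\<rfloor>)) \<partial>lborel)"
    have "integral\<^sup>L lborel (F t) = I * real t powr (2 - 2 * d)"
      unfolding F_def I_def by (rule integral_mult_left_zero)
    also have "real t powr (2 - 2 * d) = real t * real t powr (1 - 2 * d)" using t
      by (simp add: powr_mult_base)
    finally show "(\<Sum>k. x k * y (t + k)) * real t powr (1 - 2 * d) = integral\<^sup>L lborel (F t)"
      using s(2) by (simp add: I_def)
  qed
  show "summable (\<lambda>k. \<bar>x k * y (t + k)\<bar>)"
  proof (cases "t = 0")
    case False
    then show ?thesis using sumF by simp
  next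
    \<comment> \<open>The integral representation needs t > 0. At lag 0 the product is of order
      (k+1)^(2d-2), which is summable because d < 1/2.\<close>
    case True
    have bd2: "\<bar>x k * y k\<bar> \<le> C * D * real (k + 1) powr (2 * d - 2)" for k
    proof -
      have "\<bar>x k * y k\<bar> \<le> (C * real (k + 1) powr (d - 1)) * (D * real (k + 1) powr (d - 1))"
        unfolding abs_mult by (intro mult_mono C D) (use C(1) in auto)
      also have "\<dots> = C * D * (real (k + 1) powr (d - 1) * real (k + 1) powr (d - 1))" by simp
      also have "real (k + 1) powr (d - 1) * real (k + 1) powr (d - 1) = real (k + 1) powr (2 * d - 2)"
        by (simp add: powr_add[symmetric])
      finally show ?thesis .
    qed
    have "summable (\<lambda>k. real (k + 1) powr (2 * d - 2))"
      using d summable_real_powr_iff[of "2 * d - 2"] summable_Suc_iff[of "\<lambda>k. real k powr (2 * d - 2)"] by simp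
    then have "summable (\<lambda>k. C * D * real (k + 1) powr (2 * d - 2))" by (intro summable_mult)
    then have "summable (\<lambda>k. \<bar>x k * y k\<bar>)"
      by (rule summable_comparison_test'[where N = 0]) (use bd2 in simp)
    then show ?thesis using True by simp
  qed
  have "(\<lambda>t. integral\<^sup>L lborel (F t)) \<longlonglongrightarrow> (\<integral>u. a * b * G u \<partial>lborel)"
  proof -
    have "(\<lambda>t. integral\<^sup>L lborel (F (Suc t))) \<longlonglongrightarrow> (\<integral>u. a * b * G u \<partial>lborel)"
    proof (rule integral_dominated_convergence[where w = "\<lambda>u. C * D * G u"])
      show "AE u in lborel. (\<lambda>t. F (Suc t) u) \<longlonglongrightarrow> a * b * G u"
        using AE0
      proof eventually_elim
        case (elim u)
        show ?case
        proof (cases "u > 0")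
          case False
          then show ?thesis using elim by (simp add: F_def G_def)
        next
          case True
          have 1: "(\<lambda>t. real (nat \<lfloor>real t * u\<rfloor>) / real t) \<longlonglongrightarrow> u" using True by real_asymp
          have "(\<lambda>t. real t / real t + real (nat \<lfloor>real t * u\<rfloor>) / real t) \<longlonglongrightarrow> 1 + u"
            by (intro tendsto_add 1) real_asymp
          then have 2: "(\<lambda>t. real (t + nat \<lfloor>real t * u\<rfloor>) / real t) \<longlonglongrightarrow> 1 + u"
            by (simp add: add_divide_distrib)
          have "(\<lambda>t. (x (nat \<lfloor>real t * u\<rfloor>) * real t powr (1 - d)) * (y (t + nat \<lfloor>real t * u\<rfloor>)
              * real t powr (1 - d)))
            \<longlonglongrightarrow> (a * u powr (d - 1)) * (b * (1 + u) powr (d - 1))"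
            using True by (intro tendsto_mult tendsto_scaled_index[OF x _ 1] tendsto_scaled_index[OF y _ 2]) auto
          moreover have "(x (nat \<lfloor>real t * u\<rfloor>) * real t powr (1 - d)) * (y (t + nat \<lfloor>real t * u\<rfloor>)
              * real t powr (1 - d)) = F t u" for t
            using True by (simp add: F_def split)
          moreover have "(a * u powr (d - 1)) * (b * (1 + u) powr (d - 1)) = a * b * G u"
            using True by (simp add: G_def)
          ultimately have "(\<lambda>t. F t u) \<longlonglongrightarrow> a * b * G u" by simp
          then show ?thesis by (rule LIMSEQ_Suc)
        qed
      qed
      show "AE u in lborel. norm (F (Suc t) u) \<le> C * D * G u" for t
        using AE0 by eventually_elim (rule bd, auto)
    qed (use G(1) in auto)
    then show ?thesis by (rule LIMSEQ_imp_Suc)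
  qed
  then have "(\<lambda>t. integral\<^sup>L lborel (F t)) \<longlonglongrightarrow> a * b * Beta d (1 - 2 * d)"
    using G(2) by simp
  then show "(\<lambda>t. (\<Sum>k. x k * y (t + k)) * real t powr (1 - 2 * d)) \<longlonglongrightarrow> a * b * Beta d (1 - 2 * d)"
    by (rule Lim_transform_eventually)
       (rule eventually_mono[OF eventually_gt_at_top[of 0]], rule sumF(2)[symmetric])
qed

section \<open>Partial sums and double sums of power-like sequences\<close>

lemma sum_power_asymp:
  fixes x :: "nat \<Rightarrow> real"
  assumes p: "p > -1" and x: "(\<lambda>j. x j * real j powr (- p)) \<longlonglongrightarrow> K"
  shows "(\<lambda>n. (\<Sum>j=1..n. x j) * real n powr (- p - 1)) \<longlonglongrightarrow> K / (p + 1)"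
proof -
  \<comment> \<open>A Stolz-Cesaro comparison: the increments w j behave like (p + 1) j^p and
    telescope exactly to n^(p+1). It remains to treat y, whose normalized limit is 0.\<close>
  define w where "w j = real j powr (p + 1) - real (j - 1) powr (p + 1)" for j :: nat
  define y where "y j = x j - K / (p + 1) * w j" for j
  have w: "(\<lambda>j. w j * real j powr (- p)) \<longlonglongrightarrow> p + 1"
  proof -
    have "(\<lambda>j. (real (Suc j) powr (p + 1) - real j powr (p + 1)) * real (Suc j) powr (- p)) \<longlonglongrightarrow> p + 1"
      using p by (real_asymp simp: field_simps)
    then have "(\<lambda>j. w (Suc j) * real (Suc j) powr (- p)) \<longlonglongrightarrow> p + 1" by (simp add: w_def)
    then show ?thesis by (rule LIMSEQ_imp_Suc)
  qed
  have sw: "(\<Sum>j=1..n. w j) = real n powr (p + 1)" for n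
    using p by (induction n) (auto simp: w_def)
  have w0: "w j \<ge> 0" for j unfolding w_def using p by (auto intro!: powr_mono2)
  have "(\<lambda>j. x j * real j powr (- p) - K / (p + 1) * (w j * real j powr (- p))) \<longlonglongrightarrow> K - K / (p + 1) * (p + 1)"
    by (intro tendsto_intros x w)
  then have y0: "(\<lambda>j. y j * real j powr (- p)) \<longlonglongrightarrow> 0"
    using p by (simp add: y_def left_diff_distrib mult.assoc)
  have ylim: "(\<lambda>n. (\<Sum>j=1..n. y j) * real n powr (- p - 1)) \<longlonglongrightarrow> 0"
  proof (rule LIMSEQ_I)
    fix e :: real assume e: "e > 0"
    have q: "(p + 1) / 2 > 0" "e / 2 * ((p + 1) / 2) > 0" using p e by auto
    have "\<forall>\<^sub>F j in sequentially. w j * real j powr (- p) > (p + 1) / 2"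
      by (rule order_tendstoD(1)[OF w]) (use p in auto)
    moreover have "\<forall>\<^sub>F j in sequentially. \<bar>y j * real j powr (- p)\<bar> < e / 2 * ((p + 1) / 2)"
      using tendstoD[OF y0 q(2)] by (simp add: dist_real_def)
    ultimately have "\<forall>\<^sub>F j in sequentially. \<bar>y j\<bar> \<le> e / 2 * w j"
      using eventually_gt_at_top[of 0]
    proof eventually_elim
      case (elim j)
      have "\<bar>y j\<bar> * real j powr (- p) < e / 2 * ((p + 1) / 2)" using elim by (simp add: abs_mult)
      also have "\<dots> \<le> e / 2 * (w j * real j powr (- p))" using elim e by (intro mult_left_mono) auto
      finally show ?case using elim by simp
    qed
    then obtain J where J: "\<And>j. j \<ge> J \<Longrightarrow> \<bar>y j\<bar> \<le> e / 2 * w j" by (auto simp: eventually_sequentially)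
    \<comment> \<open>The indices up to J contribute a constant, which n^(-p-1) sends to 0; beyond J
      the terms are dominated by e/2 times the telescoping sum.\<close>
    define A where "A = (\<Sum>j=1..J. \<bar>y j\<bar>)"
    have "(\<lambda>n. A * real n powr (- p - 1)) \<longlonglongrightarrow> 0" using p by real_asymp
    from LIMSEQ_D[OF this, of "e / 2"] e obtain n0 where n0: "\<And>n. n \<ge> n0 \<Longrightarrow> \<bar>A * real n powr (- p - 1)\<bar> < e / 2"
      by auto
    have "norm ((\<Sum>j=1..n. y j) * real n powr (- p - 1) - 0) < e" if n: "n \<ge> max n0 1" for n
    proof -
      have "\<bar>\<Sum>j=1..n. y j\<bar> \<le> (\<Sum>j=1..n. \<bar>y j\<bar>)" by (rule sum_abs)
      also have "\<dots> \<le> (\<Sum>j=1..n. (if j \<le> J then \<bar>y j\<bar> else 0) + e / 2 * w j)"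
        using J w0 e by (intro sum_mono) (auto simp: not_le)
      also have "\<dots> = (\<Sum>j\<in>{1..n} \<inter> {j. j \<le> J}. \<bar>y j\<bar>) + e / 2 * (\<Sum>j=1..n. w j)"
        by (simp add: sum.distrib sum_distrib_left sum.inter_restrict)
      also have "\<dots> \<le> A + e / 2 * real n powr (p + 1)"
        unfolding A_def sw by (intro add_right_mono sum_mono2) auto
      finally have "\<bar>\<Sum>j=1..n. y j\<bar> * real n powr (- p - 1)
          \<le> (A + e / 2 * real n powr (p + 1)) * real n powr (- p - 1)"
        by (rule mult_right_mono) auto
      also have "\<dots> = A * real n powr (- p - 1) + e / 2 * (real n powr (p + 1) * real n powr (- p - 1))"
        by (simp add: algebra_simps)
      also have "real n powr (p + 1) * real n powr (- p - 1) = 1"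
        using n by (simp add: powr_add[symmetric])
      also have "A * real n powr (- p - 1) + e / 2 * 1 < e" using n0[of n] n by auto
      finally show ?thesis by (simp add: abs_mult)
    qed
    then show "\<exists>no. \<forall>n\<ge>no. norm ((\<Sum>j=1..n. y j) * real n powr (- p - 1) - 0) < e" by blast
  qed
  have sx: "(\<Sum>j=1..n. x j) = (\<Sum>j=1..n. y j) + K / (p + 1) * real n powr (p + 1)" for n
    unfolding sw[symmetric] by (simp add: y_def sum_subtractf sum_distrib_left)
  have "\<forall>\<^sub>F n in sequentially. (\<Sum>j=1..n. y j) * real n powr (- p - 1) + K / (p + 1)
     = (\<Sum>j=1..n. x j) * real n powr (- p - 1)"
    using eventually_gt_at_top[of 0]
    by eventually_elim (simp add: sx[simplified] ring_distribs powr_add[symmetric] mult.assoc)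
  then show ?thesis
    using Lim_transform_eventually[OF tendsto_add[OF ylim tendsto_const[of "K / (p + 1)"]]] by auto
qed

text \<open>The covariance of the p-th and q-th partial sums of a stationary sequence with
  autocovariance r.\<close>

definition covsum :: "(nat \<Rightarrow> real) \<Rightarrow> nat \<Rightarrow> nat \<Rightarrow> real" where
  "covsum r p q = (\<Sum>i=1..p. \<Sum>j=1..q. r (nat \<bar>int i - int j\<bar>))"

lemma covsum_commute: "covsum r p q = covsum r q p"
  unfolding covsum_def by (subst sum.swap) (simp add: abs_minus_commute)

lemma covsum_row: "(\<Sum>j=1..n. r (nat \<bar>int (Suc n) - int j\<bar>)) = (\<Sum>j=1..n. r j)"
  by (rule sum.reindex_bij_witness[of _ "\<lambda>j. Suc n - j" "\<lambda>j. Suc n - j"]) (auto simp: of_nat_diff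
      intro!: arg_cong[of _ _ r])

lemma covsum_Suc: "covsum r (Suc n) (Suc n) = covsum r n n + (r 0 + 2 * (\<Sum>j=1..n. r j))"
proof -
  have "covsum r (Suc n) (Suc n) = covsum r n n + (\<Sum>i=1..n. r (nat \<bar>int i - int (Suc n)\<bar>))
      + (\<Sum>j=1..n. r (nat \<bar>int (Suc n) - int j\<bar>)) + r 0"
    unfolding covsum_def by (simp add: sum.distrib)
  also have "(\<Sum>i=1..n. r (nat \<bar>int i - int (Suc n)\<bar>)) = (\<Sum>j=1..n. r (nat \<bar>int (Suc n) - int j\<bar>))"
    by (simp add: abs_minus_commute)
  finally show ?thesis unfolding covsum_row by simp
qed

lemma covsum_shift: "(\<Sum>i=p+1..p+n. \<Sum>j=p+1..p+n. r (nat \<bar>int i - int j\<bar>)) = covsum r n n"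
proof -
  have shift: "(\<Sum>i=p+1..p+n. f i) = (\<Sum>i=1..n. f (p + i))" for f :: "nat \<Rightarrow> real"
    by (rule sum.reindex_bij_witness[of _ "\<lambda>i. p + i" "\<lambda>i. i - p"]) auto
  show ?thesis unfolding covsum_def shift by simp
qed

text \<open>The identity 2 Cov(S_p, S_q) = Var S_p + Var S_q - Var(S_q - S_p), with stationarity
  entering through \<open>covsum_shift\<close>. Only the diagonal p = q then needs asymptotics, and
  the fractional Brownian covariance has the same shape.\<close>

lemma covsum_polarization:
  assumes "p \<le> q"
  shows "2 * covsum r p q = covsum r p p + covsum r q q - covsum r (q - p) (q - p)"
proof -
  obtain n where q: "q = p + n" using assms le_Suc_ex by blast
  let ?r = "\<lambda>i j. r (nat \<bar>int i - int j\<bar>)"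
  have s: "(\<Sum>i=1..q. f i) = (\<Sum>i=1..p. f i) + (\<Sum>i=p+1..p+n. f i)" for f :: "nat \<Rightarrow> real"
    unfolding q by (rule sum.ub_add_nat) simp
  define Z where "Z = (\<Sum>i=1..p. \<Sum>j=p+1..p+n. ?r i j)"
  have "(\<Sum>i=p+1..p+n. \<Sum>j=1..p. ?r i j) = Z"
    unfolding Z_def by (subst sum.swap) (simp add: abs_minus_commute)
  then have "covsum r q q = covsum r p p + Z + Z + covsum r n n"
    using covsum_shift[of r p n] unfolding covsum_def s by (simp add: sum.distrib Z_def)
  moreover have "covsum r p q = covsum r p p + Z"
    unfolding covsum_def s by (simp add: sum.distrib Z_def)
  ultimately show ?thesis by (simp add: q)
qed

text \<open>Two applications of \<open>sum_power_asymp\<close>: exponent 2 d - 1 gives K / (2 d) for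
  the single sum, doubled by symmetry to K / d for the increments of the diagonal, and exponent 2 d
  brings a further division by 2 d + 1.\<close>

lemma covsum_asymp:
  fixes r :: "nat \<Rightarrow> real"
  assumes d: "0 < d" "d < 1/2" and r: "(\<lambda>j. r j * real j powr (1 - 2 * d)) \<longlonglongrightarrow> K"
  shows "(\<lambda>n. covsum r n n * real n powr (- 1 - 2 * d)) \<longlonglongrightarrow> K / (d * (1 + 2 * d))"
proof -
  define s where "s n = r 0 + 2 * (\<Sum>j=1..n-1. r j)" for n
  have cs: "covsum r n n = (\<Sum>j=1..n. s j)" for n
    by (induction n) (auto simp: covsum_Suc s_def, simp add: covsum_def)
  have "(\<lambda>n. (\<Sum>j=1..n. r j) * real n powr (- (2 * d - 1) - 1)) \<longlonglongrightarrow> K / ((2 * d - 1) + 1)"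
    by (rule sum_power_asymp) (use d r in \<open>auto simp: algebra_simps\<close>)
  then have 1: "(\<lambda>n. (\<Sum>j=1..n. r j) * real n powr (- 2 * d)) \<longlonglongrightarrow> K / (2 * d)" by simp
  have "(\<lambda>n. r 0 * real (Suc n) powr (- 2 * d)
      + 2 * (((\<Sum>j=1..n. r j) * real n powr (- 2 * d)) * (real (Suc n) powr (- 2 * d) * real n powr (2 * d))))
      \<longlonglongrightarrow> 0 + 2 * (K / (2 * d) * 1)"
    by (intro tendsto_intros 1) (use d in real_asymp)+
  then have "(\<lambda>n. s (Suc n) * real (Suc n) powr (- (2 * d))) \<longlonglongrightarrow> K / d"
    by (rule Lim_transform_eventually[THEN tendsto_eq_rhs])
       (use eventually_gt_at_top[of "0::nat"] in \<open>eventually_elim, auto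
           simp: s_def algebra_simps powr_minus field_simps\<close>)
  then have "(\<lambda>n. s n * real n powr (- (2 * d))) \<longlonglongrightarrow> K / d" by (rule LIMSEQ_imp_Suc)
  then have "(\<lambda>n. (\<Sum>j=1..n. s j) * real n powr (- (2 * d) - 1)) \<longlonglongrightarrow> K / d / (2 * d + 1)"
    by (rule sum_power_asymp[rotated]) (use d in auto)
  moreover have "- (2 * d) - 1 = - 1 - 2 * d" "K / d / (2 * d + 1) = K / (d * (1 + 2 * d))"
    by (simp_all add: add.commute)
  ultimately show ?thesis
    unfolding cs by metis
qed

section \<open>Square integrable functions of the innovations\<close>

lemma abs_mult_le_squares: "\<bar>a * b\<bar> \<le> a\<^sup>2 + (b::real)\<^sup>2"
proof -
  have "2 * \<bar>a\<bar> * \<bar>b\<bar> \<le> \<bar>a\<bar>\<^sup>2 + \<bar>b\<bar>\<^sup>2" by (rule sum_squares_bound)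
  moreover have "0 \<le> \<bar>a\<bar> * \<bar>b\<bar>" by simp
  ultimately show ?thesis unfolding abs_mult power2_abs by linarith
qed

lemma integrable_mult_square:
  fixes f g :: "'a \<Rightarrow> real"
  assumes [measurable]: "f \<in> borel_measurable M" "g \<in> borel_measurable M"
    and "integrable M (\<lambda>x. (f x)\<^sup>2)" "integrable M (\<lambda>x. (g x)\<^sup>2)"
  shows "integrable M (\<lambda>x. f x * g x)"
  by (rule Bochner_Integration.integrable_bound[OF Bochner_Integration.integrable_add[OF assms(3,4)]])
     (auto intro!: AE_I2 simp: abs_mult_le_squares)

lemma integrable_square_add:
  fixes f g :: "'a \<Rightarrow> real"
  assumes [measurable]: "f \<in> borel_measurable M" "g \<in> borel_measurable M"
    and "integrable M (\<lambda>x. (f x)\<^sup>2)" "integrable M (\<lambda>x. (g x)\<^sup>2)"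
  shows "integrable M (\<lambda>x. (f x + g x)\<^sup>2)"
  unfolding power2_sum using assms integrable_mult_square[OF assms] by (auto simp: mult.assoc)

lemma integrable_square_diff:
  fixes f g :: "'a \<Rightarrow> real"
  assumes [measurable]: "f \<in> borel_measurable M" "g \<in> borel_measurable M"
    and "integrable M (\<lambda>x. (f x)\<^sup>2)" "integrable M (\<lambda>x. (g x)\<^sup>2)"
  shows "integrable M (\<lambda>x. (f x - g x)\<^sup>2)"
  unfolding power2_diff using assms integrable_mult_square[OF assms] by (auto simp: mult.assoc)

lemma integrable_square_sum:
  fixes f :: "'i \<Rightarrow> 'a \<Rightarrow> real"
  assumes "finite I" "\<And>i. i \<in> I \<Longrightarrow> f i \<in> borel_measurable M" "\<And>i. i \<in> I \<Longrightarrow> integrable M (\<lambda>x. (f i x)\<^sup>2)"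
  shows "integrable M (\<lambda>x. (\<Sum>i\<in>I. f i x)\<^sup>2)"
  using assms
proof (induction I)
  case (insert i I)
  then show ?case
    by (simp, intro integrable_square_add borel_measurable_sum) auto
qed simp

lemma Cauchy_Schwarz_integral:
  fixes f g :: "'a \<Rightarrow> real"
  assumes [measurable]: "f \<in> borel_measurable M" "g \<in> borel_measurable M"
    and f: "integrable M (\<lambda>x. (f x)\<^sup>2)" and g: "integrable M (\<lambda>x. (g x)\<^sup>2)"
  shows "\<bar>\<integral>x. f x * g x \<partial>M\<bar> \<le> sqrt (\<integral>x. (f x)\<^sup>2 \<partial>M) * sqrt (\<integral>x. (g x)\<^sup>2 \<partial>M)"
proof -
  note fg = integrable_mult_square[OF assms]
  define A B C where "A = (\<integral>x. (f x)\<^sup>2 \<partial>M)" and "B = (\<integral>x. f x * g x \<partial>M)" and "C = (\<integral>x. (g x)\<^sup>2 \<partial>M)"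
  have nn: "A \<ge> 0" "C \<ge> 0" by (auto simp: A_def C_def)
  have q: "0 \<le> a\<^sup>2 * A - 2 * a * c * B + c\<^sup>2 * C" for a c
  proof -
    have "0 \<le> (\<integral>x. (a * f x - c * g x)\<^sup>2 \<partial>M)" by simp
    also have "(\<lambda>x. (a * f x - c * g x)\<^sup>2) = (\<lambda>x. a\<^sup>2 * (f x)\<^sup>2 - 2 * a * c * (f x * g x) + c\<^sup>2 * (g x)\<^sup>2)"
      by (auto simp: power2_diff power_mult_distrib algebra_simps)
    also have "(\<integral>x. a\<^sup>2 * (f x)\<^sup>2 - 2 * a * c * (f x * g x) + c\<^sup>2 * (g x)\<^sup>2 \<partial>M)
        = a\<^sup>2 * A - 2 * a * c * B + c\<^sup>2 * C"
      using f g fg by (simp add: A_def B_def C_def)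
    finally show ?thesis .
  qed
  have "B\<^sup>2 \<le> A * C"
  proof (cases "C = 0")
    case True
    have "B = 0"
    proof (rule ccontr)
      assume "B \<noteq> 0"
      \<comment> \<open>The quadratic form with a = 1 and this c equals A - (A + 1) = -1.\<close>
      have "0 \<le> A - 2 * ((A + 1) / (2 * B)) * B" using q[of 1 "(A + 1) / (2 * B)"] True by simp
      then show False using \<open>B \<noteq> 0\<close> by simp
    qed
    then show ?thesis using True by simp
  next
    case False
    have "0 \<le> C * (A * C - B\<^sup>2)" using q[of C B] by (simp add: power2_eq_square algebra_simps)
    then show ?thesis using False nn by (simp add: zero_le_mult_iff)
  qed
  then have "\<bar>B\<bar> \<le> sqrt (A * C)" by (simp add: real_le_rsqrt)
  then show ?thesis by (simp add: A_def B_def C_def real_sqrt_mult)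
qed

lemma (in prob_space) expectation_abs_le_sqrt:
  assumes [measurable]: "f \<in> borel_measurable M" and f: "integrable M (\<lambda>x. (f x)\<^sup>2)"
  shows "integrable M f" "expectation (\<lambda>x. \<bar>f x\<bar>) \<le> sqrt (expectation (\<lambda>x. (f x)\<^sup>2))"
proof -
  show "integrable M f" by (rule square_integrable_imp_integrable[OF _ f]) simp
  have "\<bar>\<integral>x. \<bar>f x\<bar> * 1 \<partial>M\<bar> \<le> sqrt (\<integral>x. \<bar>f x\<bar>\<^sup>2 \<partial>M) * sqrt (\<integral>x. 1\<^sup>2 \<partial>M)"
    by (rule Cauchy_Schwarz_integral) (use f in auto)
  then show "expectation (\<lambda>x. \<bar>f x\<bar>) \<le> sqrt (expectation (\<lambda>x. (f x)\<^sup>2))" by (simp add: prob_space)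
qed

section \<open>Independence and orthogonality of innovation series\<close>

locale innovations =
  fixes M :: "'a measure" and \<zeta> :: "int \<Rightarrow> 'a \<Rightarrow> real"
  assumes std_iid: "std_iid M \<zeta>"
begin

sublocale prob_space M using std_iid by (simp add: std_iid_def)

abbreviation \<F> :: "int set \<Rightarrow> 'a measure" where "\<F> \<equiv> sigma_of M \<zeta>"

lemma zeta_measurable[measurable]: "\<zeta> t \<in> borel_measurable M"
  using std_iid unfolding std_iid_def indep_vars_def2 by auto

lemma zeta_distr: "distr M borel (\<zeta> t) = distr M borel (\<zeta> 0)"
  using std_iid unfolding std_iid_def by blast

lemma zeta_square: "integrable M (\<lambda>\<omega>. (\<zeta> t \<omega>)\<^sup>2)" "expectation (\<lambda>\<omega>. (\<zeta> t \<omega>)\<^sup>2) = 1"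
proof -
  have 0: "integrable M (\<lambda>\<omega>. (\<zeta> 0 \<omega>)\<^sup>2)" "expectation (\<lambda>\<omega>. (\<zeta> 0 \<omega>)\<^sup>2) = 1"
    using std_iid by (auto simp: std_iid_def)
  have "integrable (distr M borel (\<zeta> 0)) (\<lambda>x. x\<^sup>2)" using 0 by (subst integrable_distr_eq) auto
  then have "integrable (distr M borel (\<zeta> t)) (\<lambda>x. x\<^sup>2)" by (subst zeta_distr)
  then show "integrable M (\<lambda>\<omega>. (\<zeta> t \<omega>)\<^sup>2)" by (subst (asm) integrable_distr_eq) auto
  have "expectation (\<lambda>\<omega>. (\<zeta> t \<omega>)\<^sup>2) = (\<integral>x. x\<^sup>2 \<partial>distr M borel (\<zeta> t))" by (subst integral_distr) auto
  also have "\<dots> = expectation (\<lambda>\<omega>. (\<zeta> 0 \<omega>)\<^sup>2)" by (subst zeta_distr, subst integral_distr) auto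
  finally show "expectation (\<lambda>\<omega>. (\<zeta> t \<omega>)\<^sup>2) = 1" using 0 by simp
qed

lemma zeta_mean: "integrable M (\<zeta> t)" "expectation (\<zeta> t) = 0"
proof -
  show "integrable M (\<zeta> t)" by (rule expectation_abs_le_sqrt(1)) (auto intro: zeta_square)
  have "expectation (\<zeta> t) = (\<integral>x. x \<partial>distr M borel (\<zeta> t))" by (subst integral_distr) auto
  also have "\<dots> = expectation (\<zeta> 0)" by (subst zeta_distr, subst integral_distr) auto
  finally show "expectation (\<zeta> t) = 0" using std_iid by (simp add: std_iid_def)
qed

lemma space_sigma_of[simp]: "space (\<F> A) = space M"
  unfolding sigma_of_def by (rule space_measure_of) auto

lemma sets_sigma_of: "sets (\<F> A) = sigma_sets (space M) (\<Union>u\<in>A. {\<zeta> u -` B \<inter> space M |B. B \<in> sets borel})"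
  unfolding sigma_of_def
  by (subst sets_measure_of) (auto intro!: arg_cong[of _ _ "sigma_sets (space M)"])

lemma subalgebra_sigma_of: "subalgebra M (\<F> A)"
  unfolding subalgebra_def sets_sigma_of
  by (auto intro!: sets.sigma_sets_subset measurable_sets[OF zeta_measurable] simp del: sets.sigma_sets_subset)

lemma sigma_of_mono: "A \<subseteq> B \<Longrightarrow> sets (\<F> A) \<subseteq> sets (\<F> B)"
  unfolding sets_sigma_of by (intro sigma_sets_mono') auto

lemma measurable_sigma_of_mono: "f \<in> borel_measurable (\<F> A) \<Longrightarrow> A \<subseteq> B \<Longrightarrow> f \<in> borel_measurable (\<F> B)"
  using sigma_of_mono[of A B] unfolding measurable_def by auto

lemma measurable_sigma_ofD: "f \<in> borel_measurable (\<F> A) \<Longrightarrow> f \<in> borel_measurable M"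
  by (rule measurable_from_subalg[OF subalgebra_sigma_of])

lemma zeta_measurable_sigma_of: "u \<in> A \<Longrightarrow> \<zeta> u \<in> borel_measurable (\<F> A)"
  unfolding measurable_def by (auto simp: sets_sigma_of intro!: sigma_sets.Basic)

text \<open>Preimages under a single \<open>\<zeta> u\<close> form an Int-stable family, so
  independence of the individual innovations passes to the sigma-algebras generated by two disjoint
  groups of them.\<close>

lemma indep_var_sigma_of:
  assumes Y: "Y \<in> borel_measurable (\<F> A)" and Z: "Z \<in> borel_measurable (\<F> B)" and AB: "A \<inter> B = {}"
  shows "indep_var borel Y borel Z"
proof -
  let ?E = "\<lambda>u. {\<zeta> u -` B \<inter> space M |B. B \<in> sets borel}"
  have "indep_sets ?E UNIV" using std_iid unfolding std_iid_def indep_vars_def2 by auto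
  then have "indep_sets ?E (\<Union>j. case_bool A B j)" by (rule indep_sets_mono_index[rotated]) simp
  then have "indep_sets (\<lambda>j. sigma_sets (space M) (\<Union>i\<in>case_bool A B j. ?E i)) UNIV"
  proof (rule indep_sets_collect_sigma)
    show "Int_stable (?E i)" for i
      unfolding Int_stable_def
    proof safe
      fix B C :: "real set" assume "B \<in> sets borel" "C \<in> sets borel"
      then show "\<exists>D. \<zeta> i -` B \<inter> space M \<inter> (\<zeta> i -` C \<inter> space M) = \<zeta> i -` D \<inter> space M \<and> D \<in> sets borel"
        by (intro exI[of _ "B \<inter> C"]) auto
    qed
    show "disjoint_family_on (case_bool A B) UNIV"
      using AB by (auto simp: disjoint_family_on_def split: bool.splits)
  qed
  then have "indep_set (sets (\<F> A)) (sets (\<F> B))"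
    unfolding indep_set_def sets_sigma_of by (rule indep_sets_mono_sets) (auto split: bool.splits)
  moreover have "sigma_sets (space M) {Y -` C \<inter> space M |C. C \<in> sets borel} \<subseteq> sets (\<F> A)"
    using measurable_sets[OF Y] sets.sigma_sets_subset[of "{Y -` C \<inter> space M |C. C \<in> sets borel}" "\<F> A"] by auto
  moreover have "sigma_sets (space M) {Z -` C \<inter> space M |C. C \<in> sets borel} \<subseteq> sets (\<F> B)"
    using measurable_sets[OF Z] sets.sigma_sets_subset[of "{Z -` C \<inter> space M |C. C \<in> sets borel}" "\<F> B"] by auto
  ultimately have "indep_set (sigma_sets (space M) {Y -` C \<inter> space M |C. C \<in> sets borel})
     (sigma_sets (space M) {Z -` C \<inter> space M |C. C \<in> sets borel})"
    unfolding indep_set_def by (elim indep_sets_mono_sets) (auto split: bool.splits)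
  then show ?thesis unfolding indep_var_eq using measurable_sigma_ofD[OF Y] measurable_sigma_ofD[OF Z] by auto
qed

lemma zeta_mult:
  assumes g: "g \<in> borel_measurable (\<F> A)" "integrable M g" and u: "u \<notin> A"
  shows "integrable M (\<lambda>\<omega>. \<zeta> u \<omega> * g \<omega>)" "expectation (\<lambda>\<omega>. \<zeta> u \<omega> * g \<omega>) = 0"
proof -
  have i: "indep_var borel (\<zeta> u) borel g"
    by (rule indep_var_sigma_of[of _ "{u}" _ A]) (use g u in \<open>auto intro: zeta_measurable_sigma_of\<close>)
  show "integrable M (\<lambda>\<omega>. \<zeta> u \<omega> * g \<omega>)" by (rule indep_var_integrable[OF i zeta_mean(1) g(2)])
  show "expectation (\<lambda>\<omega>. \<zeta> u \<omega> * g \<omega>) = 0"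
    using indep_var_lebesgue_integral[OF i zeta_mean(1) g(2)] zeta_mean(2) by simp
qed

lemma zeta_mult_square:
  assumes g: "g \<in> borel_measurable (\<F> A)" "integrable M g" and u: "u \<notin> A"
  shows "integrable M (\<lambda>\<omega>. (\<zeta> u \<omega>)\<^sup>2 * g \<omega>)" "expectation (\<lambda>\<omega>. (\<zeta> u \<omega>)\<^sup>2 * g \<omega>) = expectation g"
proof -
  have z: "\<zeta> u \<in> borel_measurable (\<F> {u})" by (rule zeta_measurable_sigma_of) simp
  have "(\<lambda>\<omega>. (\<zeta> u \<omega>)\<^sup>2) \<in> borel_measurable (\<F> {u})" by (intro borel_measurable_power z)
  then have i: "indep_var borel (\<lambda>\<omega>. (\<zeta> u \<omega>)\<^sup>2) borel g"
    by (rule indep_var_sigma_of[of _ "{u}" _ A]) (use g u in auto)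
  show "integrable M (\<lambda>\<omega>. (\<zeta> u \<omega>)\<^sup>2 * g \<omega>)" by (rule indep_var_integrable[OF i zeta_square(1) g(2)])
  show "expectation (\<lambda>\<omega>. (\<zeta> u \<omega>)\<^sup>2 * g \<omega>) = expectation g"
    using indep_var_lebesgue_integral[OF i zeta_square(1) g(2)] zeta_square(2) by simp
qed

text \<open>Predictability in reversed time: the coefficient of \<open>\<zeta> s\<close> is a
  function of the innovations after s. The window has no upper end, so that coefficient families
  belonging to different times t can be combined.\<close>

definition predictable :: "(int \<Rightarrow> 'a \<Rightarrow> real) \<Rightarrow> bool" where
  "predictable g \<longleftrightarrow> (\<forall>s. g s \<in> borel_measurable (\<F> {s<..}) \<and> integrable M (\<lambda>\<omega>. (g s \<omega>)\<^sup>2))"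

lemma predictableD:
  assumes "predictable g"
  shows "g s \<in> borel_measurable (\<F> {s<..})" "g s \<in> borel_measurable M" "integrable M (\<lambda>\<omega>. (g s \<omega>)\<^sup>2)"
    "(\<lambda>\<omega>. \<zeta> s \<omega> * g s \<omega>) \<in> borel_measurable M" "integrable M (\<lambda>\<omega>. (\<zeta> s \<omega> * g s \<omega>)\<^sup>2)"
proof -
  show 1: "g s \<in> borel_measurable (\<F> {s<..})" "integrable M (\<lambda>\<omega>. (g s \<omega>)\<^sup>2)"
    using assms by (auto simp: predictable_def)
  show [measurable]: "g s \<in> borel_measurable M" using measurable_sigma_ofD[OF 1(1)] .
  show "(\<lambda>\<omega>. \<zeta> s \<omega> * g s \<omega>) \<in> borel_measurable M" by measurable
  have "integrable M (\<lambda>\<omega>. (\<zeta> s \<omega>)\<^sup>2 * (g s \<omega>)\<^sup>2)"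
    by (rule zeta_mult_square(1)[OF borel_measurable_power[OF 1(1)] 1(2)]) simp
  then show "integrable M (\<lambda>\<omega>. (\<zeta> s \<omega> * g s \<omega>)\<^sup>2)" by (simp add: power_mult_distrib)
qed

lemma predictable_const: "predictable (\<lambda>s \<omega>. c s)"
  by (simp add: predictable_def)

lemma predictable_sum:
  assumes "finite I" "\<And>i. i \<in> I \<Longrightarrow> predictable (g i)"
  shows "predictable (\<lambda>s \<omega>. \<Sum>i\<in>I. c i * g i s \<omega>)"
  unfolding predictable_def
proof (intro allI conjI)
  fix s
  note p = predictableD[OF assms(2)]
  show "(\<lambda>\<omega>. \<Sum>i\<in>I. c i * g i s \<omega>) \<in> borel_measurable (\<F> {s<..})"
    by (intro borel_measurable_sum borel_measurable_times p) auto
  show "integrable M (\<lambda>\<omega>. (\<Sum>i\<in>I. c i * g i s \<omega>)\<^sup>2)"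
    by (intro integrable_square_sum assms borel_measurable_times) (auto simp: power_mult_distrib intro: p)
qed

lemma predictable_diff:
  assumes "predictable g" "predictable h"
  shows "predictable (\<lambda>s \<omega>. g s \<omega> - h s \<omega>)"
  unfolding predictable_def
  using predictableD[OF assms(1)] predictableD[OF assms(2)]
  by (auto intro!: borel_measurable_diff integrable_square_diff)

text \<open>The innovation with the smaller index is independent of the rest of the product, because
  both coefficients and the other innovation involve only times after s.\<close>

lemma predictable_orthogonal_less:
  assumes g: "predictable g" and h: "predictable h" and "s < s'"
  shows "expectation (\<lambda>\<omega>. (\<zeta> s \<omega> * g s \<omega>) * (\<zeta> s' \<omega> * h s' \<omega>)) = 0"
proof -
  note pg = predictableD[OF g] and ph = predictableD[OF h]
  have "(\<lambda>\<omega>. g s \<omega> * (\<zeta> s' \<omega> * h s' \<omega>)) \<in> borel_measurable (\<F> {s<..})"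
    using \<open>s < s'\<close>
    by (intro borel_measurable_times pg zeta_measurable_sigma_of measurable_sigma_of_mono[OF ph(1)]) auto
  moreover have "integrable M (\<lambda>\<omega>. g s \<omega> * (\<zeta> s' \<omega> * h s' \<omega>))"
    by (intro integrable_mult_square pg ph)
  ultimately have "expectation (\<lambda>\<omega>. \<zeta> s \<omega> * (g s \<omega> * (\<zeta> s' \<omega> * h s' \<omega>))) = 0"
    by (rule zeta_mult) simp
  then show ?thesis by (simp add: mult.assoc)
qed

lemma predictable_orthogonal:
  assumes g: "predictable g" and h: "predictable h"
  shows "expectation (\<lambda>\<omega>. (\<zeta> s \<omega> * g s \<omega>) * (\<zeta> s' \<omega> * h s' \<omega>))
    = (if s = s' then expectation (\<lambda>\<omega>. g s \<omega> * h s \<omega>) else 0)"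
proof -
  consider "s < s'" | "s' < s" | "s = s'" by linarith
  then show ?thesis
  proof cases
    case 1
    then show ?thesis using predictable_orthogonal_less[OF g h 1] by simp
  next
    case 2
    then show ?thesis using predictable_orthogonal_less[OF h g 2] by (simp add: mult.commute)
  next
    case 3
    note pg = predictableD[OF g] and ph = predictableD[OF h]
    have "expectation (\<lambda>\<omega>. (\<zeta> s \<omega>)\<^sup>2 * (g s \<omega> * h s \<omega>)) = expectation (\<lambda>\<omega>. g s \<omega> * h s \<omega>)"
      by (rule zeta_mult_square(2)[where A = "{s<..}"])
         (auto intro!: borel_measurable_times integrable_mult_square pg ph)
    then show ?thesis using 3 by (simp add: power2_eq_square algebra_simps)
  qed
qed

text \<open>Orthogonality kills all pairs s \<noteq> s', and on the diagonal E \<zeta>^2 = 1: an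
  isometry between innovation series and their coefficients.\<close>

lemma expectation_prod_sums:
  assumes g: "predictable g" and h: "predictable h" and I: "finite I" "finite J"
  shows "expectation (\<lambda>\<omega>. (\<Sum>s\<in>I. \<zeta> s \<omega> * g s \<omega>) * (\<Sum>s\<in>J. \<zeta> s \<omega> * h s \<omega>))
    = (\<Sum>s\<in>I \<inter> J. expectation (\<lambda>\<omega>. g s \<omega> * h s \<omega>))"
proof -
  note pg = predictableD[OF g] and ph = predictableD[OF h]
  have int: "integrable M (\<lambda>\<omega>. (\<zeta> s \<omega> * g s \<omega>) * (\<zeta> s' \<omega> * h s' \<omega>))" for s s'
    by (intro integrable_mult_square pg ph)
  have "expectation (\<lambda>\<omega>. (\<Sum>s\<in>I. \<zeta> s \<omega> * g s \<omega>) * (\<Sum>s\<in>J. \<zeta> s \<omega> * h s \<omega>))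
    = (\<Sum>s\<in>I. \<Sum>s'\<in>J. expectation (\<lambda>\<omega>. (\<zeta> s \<omega> * g s \<omega>) * (\<zeta> s' \<omega> * h s' \<omega>)))"
    unfolding sum_product using int
    by (subst Bochner_Integration.integral_sum, auto intro!: Bochner_Integration.integrable_sum sum.cong Bochner_Integration.integral_sum)
  also have "\<dots> = (\<Sum>s\<in>I. if s \<in> J then expectation (\<lambda>\<omega>. g s \<omega> * h s \<omega>) else 0)"
    unfolding predictable_orthogonal[OF g h] using I by (intro sum.cong) (auto simp: sum.delta')
  also have "\<dots> = (\<Sum>s\<in>I \<inter> J. expectation (\<lambda>\<omega>. g s \<omega> * h s \<omega>))"
    using I by (simp add: sum.inter_restrict)
  finally show ?thesis .
qed

lemma square_integrable_sum_predictable: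
  assumes "predictable g" "finite I"
  shows "(\<lambda>\<omega>. \<Sum>s\<in>I. \<zeta> s \<omega> * g s \<omega>) \<in> borel_measurable M" "integrable M (\<lambda>\<omega>. (\<Sum>s\<in>I. \<zeta> s \<omega> * g s \<omega>)\<^sup>2)"
  using predictableD[OF assms(1)] assms(2) by (auto intro!: integrable_square_sum borel_measurable_sum)

lemma expectation_square_sum:
  assumes "predictable g" "finite I"
  shows "expectation (\<lambda>\<omega>. (\<Sum>s\<in>I. \<zeta> s \<omega> * g s \<omega>)\<^sup>2) = (\<Sum>s\<in>I. expectation (\<lambda>\<omega>. (g s \<omega>)\<^sup>2))"
  using expectation_prod_sums[OF assms(1,1) assms(2,2)] by (simp add: power2_eq_square)

lemma expectation_sum_predictable:
  assumes "predictable g" "finite I"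
  shows "expectation (\<lambda>\<omega>. \<Sum>s\<in>I. \<zeta> s \<omega> * g s \<omega>) = 0"
proof -
  have "integrable M (\<lambda>\<omega>. \<zeta> s \<omega> * g s \<omega>)" "expectation (\<lambda>\<omega>. \<zeta> s \<omega> * g s \<omega>) = 0" for s
    using zeta_mult[OF predictableD(1)[OF assms(1)] expectation_abs_le_sqrt(1)[OF predictableD(2,3)[OF assms(1)]]]
    by auto
  then show ?thesis by (simp add: Bochner_Integration.integral_sum)
qed

end

section \<open>The coefficients of the projective process\<close>

text \<open>The second moment recursion for the coefficient at lag j, read with equality: the growth
  bound on Q contributes c^2, and orthogonality turns the square of the linear term into a sum of
  squares. Unrolled, it produces the chains of \<beta>^2 that appear in \<open>K_Q\<close>.\<close>

fun mom_bound :: "real \<Rightarrow> (nat \<Rightarrow> real) \<Rightarrow> (nat \<Rightarrow> nat \<Rightarrow> real) \<Rightarrow> nat \<Rightarrow> real" where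
  "mom_bound c \<alpha> \<beta> j = c\<^sup>2 * ((\<alpha> j)\<^sup>2 + (\<Sum>i<j. (\<beta> i (j - i))\<^sup>2 * mom_bound c \<alpha> \<beta> i))"

declare mom_bound.simps[simp del]

lemma mom_bound_nonneg: "mom_bound c \<alpha> \<beta> j \<ge> 0"
proof (induction j rule: less_induct)
  case (less j)
  then show ?case by (subst mom_bound.simps) (auto intro!: add_nonneg_nonneg sum_nonneg mult_nonneg_nonneg)
qed

text \<open>The partial sum S n reappears on the right side of its own estimate, multiplied by a
  tail of c^2 B. Once this tail is at most 1/2, S n is absorbed and stays below 2 (S J' +
  A).\<close>

lemma summable_mom_bound:
  assumes a: "summable (\<lambda>j. (\<alpha> j)\<^sup>2)" and B: "summable B"
    and le: "\<And>i j. i < j \<Longrightarrow> (\<beta> i (j - i))\<^sup>2 \<le> B j"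
  shows "summable (mom_bound c \<alpha> \<beta>)"
proof -
  let ?u = "mom_bound c \<alpha> \<beta>"
  note u0 = mom_bound_nonneg[of c \<alpha> \<beta>]
  define S where "S n = (\<Sum>j<n. ?u j)" for n
  have S0: "S n \<ge> 0" for n unfolding S_def by (intro sum_nonneg u0)
  have "summable (\<lambda>j. c\<^sup>2 * B j)" using B by (rule summable_mult)
  from suminf_exist_split[OF _ this, of "1/2"] obtain J where J: "\<And>n. n \<ge> J
      \<Longrightarrow> norm (\<Sum>i. c\<^sup>2 * B (i + n)) < 1/2" by auto
  \<comment> \<open>Beyond \<open>J'\<close> the recursion is a contraction with factor \<open>1/2\<close>.\<close>
  define J' where "J' = max J 1"
  \<comment> \<open>At j = 0 the hypothesis \<open>le\<close> is empty and B 0 may be negative; this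
    is why J' is at least 1.\<close>
  have B0: "B j \<ge> 0" if "j \<ge> 1" for j using le[of 0 j] that order_trans[OF zero_le_power2] by fastforce
  have tail: "(\<Sum>j=J'..<n. c\<^sup>2 * B j) \<le> 1/2" for n
  proof -
    have s: "summable (\<lambda>i. c\<^sup>2 * B (i + J'))" using B by (intro summable_mult summable_ignore_initial_segment)
    have "(\<Sum>j=J'..<n. c\<^sup>2 * B j) = (\<Sum>i<n - J'. c\<^sup>2 * B (i + J'))"
      by (rule sum.reindex_bij_witness[of _ "\<lambda>i. i + J'" "\<lambda>j. j - J'"]) auto
    also have "\<dots> \<le> (\<Sum>i. c\<^sup>2 * B (i + J'))"
      by (rule sum_le_suminf[OF s]) (auto intro!: mult_nonneg_nonneg B0 simp: J'_def)
    also have "\<dots> \<le> 1/2" using J[of J'] by (simp add: J'_def)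
    finally show ?thesis .
  qed
  define A where "A = c\<^sup>2 * (\<Sum>j. (\<alpha> j)\<^sup>2)"
  have bnd: "S n \<le> 2 * (S J' + A)" for n
  proof (cases "n \<le> J'")
    case True
    then have "S n \<le> S J'" unfolding S_def by (intro sum_mono2 u0) auto
    moreover have "A \<ge> 0" unfolding A_def using a by (intro mult_nonneg_nonneg suminf_nonneg) auto
    ultimately show ?thesis using S0[of J'] by argo
  next
    case False
    have uj: "?u j \<le> c\<^sup>2 * (\<alpha> j)\<^sup>2 + c\<^sup>2 * B j * S n" if j: "j \<in> {J'..<n}" for j
    proof -
      have "(\<Sum>i<j. (\<beta> i (j - i))\<^sup>2 * ?u i) \<le> (\<Sum>i<j. B j * ?u i)"
        by (intro sum_mono mult_right_mono le u0) auto
      also have "\<dots> = B j * S j" by (simp add: S_def sum_distrib_left)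
      also have "\<dots> \<le> B j * S n"
        using j B0[of j] u0 unfolding S_def by (intro mult_left_mono sum_mono2) (auto simp: J'_def)
      finally have "(\<Sum>i<j. (\<beta> i (j - i))\<^sup>2 * ?u i) \<le> B j * S n" .
      from mult_left_mono[OF this, of "c\<^sup>2"] show ?thesis
        by (subst mom_bound.simps) (simp add: distrib_left mult.assoc)
    qed
    have "S n = S J' + (\<Sum>j=J'..<n. ?u j)"
      unfolding S_def using False by (metis atLeast0LessThan le_cases sum.atLeastLessThan_concat zero_le)
    also have "(\<Sum>j=J'..<n. ?u j) \<le> (\<Sum>j=J'..<n. c\<^sup>2 * (\<alpha> j)\<^sup>2 + c\<^sup>2 * B j * S n)"
      by (intro sum_mono uj)
    also have "\<dots> = c\<^sup>2 * (\<Sum>j=J'..<n. (\<alpha> j)\<^sup>2) + (\<Sum>j=J'..<n. c\<^sup>2 * B j) * S n"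
      by (simp add: sum.distrib sum_distrib_left sum_distrib_right)
    also have "\<dots> \<le> A + 1/2 * S n"
      unfolding A_def using a by (intro add_mono mult_left_mono mult_right_mono tail S0 sum_le_suminf) auto
    finally show ?thesis by simp
  qed
  show ?thesis
    by (rule summableI_nonneg_bounded[of _ "2 * (S J' + A)"]) (use u0 bnd in \<open>auto simp: S_def\<close>)
qed

section \<open>Projections of the solution and moments of its coefficients\<close>

locale projective_model = innovations +
  fixes Q :: "real \<Rightarrow> real" and \<alpha> :: "nat \<Rightarrow> real" and \<beta> :: "nat \<Rightarrow> nat \<Rightarrow> real"
    and X :: "int \<Rightarrow> 'a \<Rightarrow> real" and c\<^sub>Q c\<^sub>L :: real
  assumes Q_meas[measurable]: "Q \<in> borel_measurable borel"
    and Q_bound: "\<And>x. \<bar>Q x\<bar> \<le> c\<^sub>Q * \<bar>x\<bar>"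
    and Q_Lip: "c\<^sub>L > 0" "\<And>x y. \<bar>Q x - Q y\<bar> \<le> c\<^sub>L * \<bar>x - y\<bar>"
    and sol: "projective_solution M \<zeta> Q \<alpha> \<beta> X"
begin

text \<open>The coefficient of \<open>\<zeta> s\<close> in \<open>X t\<close>; the time \<open>t\<close> comes first, so that \<open>G t\<close> is
  a predictable family indexed by \<open>s\<close>.\<close>

definition G :: "int \<Rightarrow> int \<Rightarrow> 'a \<Rightarrow> real" where
  "G t s \<omega> = (if s \<le> t then proj_coeff M \<zeta> Q \<alpha> \<beta> X s t \<omega> else 0)"

definition XN :: "nat \<Rightarrow> int \<Rightarrow> 'a \<Rightarrow> real" where
  "XN n t \<omega> = (\<Sum>s\<in>{t - int n..t}. \<zeta> s \<omega> * G t s \<omega>)"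

lemma X_measurable[measurable]: "X t \<in> borel_measurable M"
  using sol measurable_sigma_ofD unfolding projective_solution_def projective_process_def by blast

lemma X_square: "integrable M (\<lambda>\<omega>. (X t \<omega>)\<^sup>2)"
  using sol unfolding projective_solution_def projective_process_def by blast

lemma Eint_measurable: "Eint M \<zeta> u t Y \<in> borel_measurable (\<F> {u..t})"
  unfolding Eint_def by (rule borel_measurable_cond_exp)

lemma G_measurable: "G t s \<in> borel_measurable (\<F> {s<..})"
proof -
  have [measurable]: "Eint M \<zeta> u t Y \<in> borel_measurable (\<F> {s<..})" if "s < u" for u Y
    by (rule measurable_sigma_of_mono[OF Eint_measurable]) (use that in auto)
  have "(\<lambda>\<omega>. \<alpha> (nat (t - s)) +
        (\<Sum>u\<in>{s<..t}. \<beta> (nat (t - u)) (nat (u - s)) *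
           (Eint M \<zeta> u t (X t) \<omega> - Eint M \<zeta> (u + 1) t (X t) \<omega>))) \<in> borel_measurable (\<F> {s<..})"
    by (intro borel_measurable_add borel_measurable_sum borel_measurable_times borel_measurable_diff) auto
  from measurable_compose[OF this Q_meas] show ?thesis
    unfolding G_def proj_coeff_def by (cases "s \<le> t") auto
qed

lemma predictable_G: "predictable (G t)"
  unfolding predictable_def
proof (intro allI conjI G_measurable)
  fix s
  have [measurable]: "G t s \<in> borel_measurable M" by (rule measurable_sigma_ofD[OF G_measurable])
  show "integrable M (\<lambda>\<omega>. (G t s \<omega>)\<^sup>2)"
  proof (cases "s \<le> t")
    case True
    have "sum_second_moments M (\<lambda>s. proj_coeff M \<zeta> Q \<alpha> \<beta> X s t) t < \<infinity>"
      using sol unfolding projective_solution_def by blast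
    then have fin: "(\<Sum>n. \<integral>\<^sup>+\<omega>. ennreal ((proj_coeff M \<zeta> Q \<alpha> \<beta> X (t - int n) t \<omega>)\<^sup>2) \<partial>M) < \<infinity>"
      by (simp add: sum_second_moments_def)
    define a where "a n = (\<integral>\<^sup>+\<omega>. ennreal ((proj_coeff M \<zeta> Q \<alpha> \<beta> X (t - int n) t \<omega>)\<^sup>2) \<partial>M)" for n
    have "sum a {..<Suc (nat (t - s))} \<le> suminf a" by (rule sum_le_suminf) auto
    moreover have "a (nat (t - s)) \<le> sum a {..<Suc (nat (t - s))}" by simp
    ultimately have "a (nat (t - s)) < \<infinity>" using fin unfolding a_def[symmetric] by (meson order_le_less_trans)
    then have "(\<integral>\<^sup>+\<omega>. ennreal ((G t s \<omega>)\<^sup>2) \<partial>M) < \<infinity>"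
      using True by (simp add: a_def G_def)
    then show ?thesis by (intro integrableI_nonneg) auto
  qed (simp add: G_def)
qed

lemma XN_measurable[measurable]: "XN n t \<in> borel_measurable M"
  and XN_square: "integrable M (\<lambda>\<omega>. (XN n t \<omega>)\<^sup>2)"
  using square_integrable_sum_predictable[OF predictable_G[of t], of "{t - int n..t}"]
      by (auto simp: XN_def[abs_def])

lemma XN_diff_square: "integrable M (\<lambda>\<omega>. (X t \<omega> - XN n t \<omega>)\<^sup>2)"
  by (intro integrable_square_diff X_square XN_square) auto

lemma XN_tendsto: "(\<lambda>n. expectation (\<lambda>\<omega>. (X t \<omega> - XN n t \<omega>)\<^sup>2)) \<longlonglongrightarrow> 0"
proof -
  have "ms_sums_le M (\<lambda>s \<omega>. \<zeta> s \<omega> * proj_coeff M \<zeta> Q \<alpha> \<beta> X s t \<omega>) t (X t)"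
    using sol unfolding projective_solution_def by blast
  moreover have "(\<Sum>s\<in>{t - int n..t}. \<zeta> s \<omega> * proj_coeff M \<zeta> Q \<alpha> \<beta> X s t \<omega>) = XN n t \<omega>" for n \<omega>
    unfolding XN_def by (intro sum.cong) (auto simp: G_def)
  ultimately have "(\<lambda>n. \<integral>\<^sup>+\<omega>. ennreal ((X t \<omega> - XN n t \<omega>)\<^sup>2) \<partial>M) \<longlonglongrightarrow> 0"
    by (simp add: ms_sums_le_def)
  then have "(\<lambda>n. ennreal (expectation (\<lambda>\<omega>. (X t \<omega> - XN n t \<omega>)\<^sup>2))) \<longlonglongrightarrow> ennreal 0"
    by (subst (asm) nn_integral_eq_integral[OF XN_diff_square]) auto
  then show ?thesis by (subst (asm) tendsto_ennreal_iff) auto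
qed

lemma integrable_X: "integrable M (X t)"
  by (rule expectation_abs_le_sqrt(1)) (auto intro: X_square)

lemma XN_tendsto_L1: "(\<lambda>n. expectation (\<lambda>\<omega>. \<bar>X t \<omega> - XN n t \<omega>\<bar>)) \<longlonglongrightarrow> 0"
proof (rule tendsto_sandwich[OF _ _ tendsto_const])
  show "\<forall>\<^sub>F n in sequentially. 0 \<le> expectation (\<lambda>\<omega>. \<bar>X t \<omega> - XN n t \<omega>\<bar>)" by simp
  show "\<forall>\<^sub>F n in sequentially. expectation (\<lambda>\<omega>. \<bar>X t \<omega> - XN n t \<omega>\<bar>)
      \<le> sqrt (expectation (\<lambda>\<omega>. (X t \<omega> - XN n t \<omega>)\<^sup>2))"
    by (intro always_eventually allI expectation_abs_le_sqrt(2) XN_diff_square) auto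
  show "(\<lambda>n. sqrt (expectation (\<lambda>\<omega>. (X t \<omega> - XN n t \<omega>)\<^sup>2))) \<longlonglongrightarrow> 0"
    using tendsto_real_sqrt[OF XN_tendsto] by simp
qed

text \<open>For s < u the innovation \<open>\<zeta> s\<close> is independent of the conditioning
  event and \<open>G t s\<close> jointly, so \<open>\<zeta> s * G t s\<close> integrates to 0 over
  every such event. Convergence of the truncated series in L1 carries this over to X t.\<close>

lemma Eint_X: "AE \<omega> in M. Eint M \<zeta> u t (X t) \<omega> = (\<Sum>s\<in>{u..t}. \<zeta> s \<omega> * G t s \<omega>)"
proof -
  interpret F: finite_measure_subalgebra M "\<F> {u..t}"
    by unfold_locales (rule subalgebra_sigma_of)
  have intz: "integrable M (\<lambda>\<omega>. \<zeta> s \<omega> * G t s \<omega>)" for s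
    by (rule expectation_abs_le_sqrt(1); rule predictableD[OF predictable_G])
  show ?thesis unfolding Eint_def
  proof (rule F.real_cond_exp_charact[OF _ integrable_X])
    show "integrable M (\<lambda>\<omega>. \<Sum>s = u..t. \<zeta> s \<omega> * G t s \<omega>)"
      using intz by auto
    show "(\<lambda>\<omega>. \<Sum>s = u..t. \<zeta> s \<omega> * G t s \<omega>) \<in> borel_measurable (\<F> {u..t})"
    proof (intro borel_measurable_sum borel_measurable_times)
      fix s assume s: "s \<in> {u..t}"
      then show "\<zeta> s \<in> borel_measurable (\<F> {u..t})" by (rule zeta_measurable_sigma_of)
      \<comment> \<open>\<open>G_measurable\<close> bounds the window of innovations only from
        below. Here it is also bounded by t, because every projection inside the coefficient is
        taken on an interval [v, t] with v > s.\<close>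
      have "(\<lambda>\<omega>. \<alpha> (nat (t - s)) +
        (\<Sum>v\<in>{s<..t}. \<beta> (nat (t - v)) (nat (v - s)) *
           (Eint M \<zeta> v t (X t) \<omega> - Eint M \<zeta> (v + 1) t (X t) \<omega>))) \<in> borel_measurable (\<F> {u..t})"
        by (intro borel_measurable_add borel_measurable_sum borel_measurable_times borel_measurable_diff
            borel_measurable_const measurable_sigma_of_mono[OF Eint_measurable]) (use s in auto)
      from measurable_compose[OF this Q_meas] show "G t s \<in> borel_measurable (\<F> {u..t})"
        unfolding G_def proj_coeff_def by (cases "s \<le> t") auto
    qed
    fix A assume A: "A \<in> sets (\<F> {u..t})"
    have AM[measurable]: "A \<in> sets M" using A subalgebra_sigma_of unfolding subalgebra_def by auto
    have iA: "integrable M (\<lambda>\<omega>. indicat_real A \<omega> * f \<omega>)" if "integrable M f" for f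
      using integrable_mult_indicator[OF AM that] by simp
    have intXN: "integrable M (XN n t)" for n
      by (rule expectation_abs_le_sqrt(1)) (auto intro: XN_square)
    have zero: "expectation (\<lambda>\<omega>. indicat_real A \<omega> * (\<zeta> s \<omega> * G t s \<omega>)) = 0" if "s < u" for s
    proof -
      have "A \<in> sets (\<F> {s<..})" using A sigma_of_mono[of "{u..t}" "{s<..}"] that by fastforce
      then have "(\<lambda>\<omega>. indicat_real A \<omega> * G t s \<omega>) \<in> borel_measurable (\<F> {s<..})"
        by (intro borel_measurable_times borel_measurable_indicator G_measurable)
      moreover have "integrable M (G t s)"
        by (rule expectation_abs_le_sqrt(1); rule predictableD[OF predictable_G])
      then have "integrable M (\<lambda>\<omega>. indicat_real A \<omega> * G t s \<omega>)" by (rule iA)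
      ultimately have "expectation (\<lambda>\<omega>. \<zeta> s \<omega> * (indicat_real A \<omega> * G t s \<omega>)) = 0"
        by (rule zeta_mult) simp
      then show ?thesis by (simp add: mult.left_commute)
    qed
    have eq: "expectation (\<lambda>\<omega>. indicat_real A \<omega> * XN n t \<omega>)
        = expectation (\<lambda>\<omega>. indicat_real A \<omega> * (\<Sum>s = u..t. \<zeta> s \<omega> * G t s \<omega>))" if n: "n \<ge> nat (t - u)" for n
    proof -
      have "expectation (\<lambda>\<omega>. indicat_real A \<omega> * XN n t \<omega>)
          = (\<Sum>s\<in>{t - int n..t}. expectation (\<lambda>\<omega>. indicat_real A \<omega> * (\<zeta> s \<omega> * G t s \<omega>)))"
        unfolding XN_def sum_distrib_left by (intro Bochner_Integration.integral_sum iA intz)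
      also have "\<dots> = (\<Sum>s\<in>{u..t}. expectation (\<lambda>\<omega>. indicat_real A \<omega> * (\<zeta> s \<omega> * G t s \<omega>)))"
        by (rule sum.mono_neutral_right) (use n zero in auto)
      also have "\<dots> = expectation (\<lambda>\<omega>. indicat_real A \<omega> * (\<Sum>s = u..t. \<zeta> s \<omega> * G t s \<omega>))"
        unfolding sum_distrib_left by (intro Bochner_Integration.integral_sum[symmetric] iA intz)
      finally show ?thesis .
    qed
    have "(\<lambda>n. expectation (\<lambda>\<omega>. indicat_real A \<omega> * XN n t \<omega>)) \<longlonglongrightarrow> expectation (\<lambda>\<omega>. indicat_real A \<omega> * X t \<omega>)"
    proof (rule LIM_zero_cancel, rule Lim_null_comparison[OF _ XN_tendsto_L1])
      show "\<forall>\<^sub>F n in sequentially. norm (expectation (\<lambda>\<omega>. indicat_real A \<omega> * XN n t \<omega>)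
          - expectation (\<lambda>\<omega>. indicat_real A \<omega> * X t \<omega>))
         \<le> expectation (\<lambda>\<omega>. \<bar>X t \<omega> - XN n t \<omega>\<bar>)"
      proof (intro always_eventually allI)
        fix n
        have "norm (expectation (\<lambda>\<omega>. indicat_real A \<omega> * XN n t \<omega>) - expectation (\<lambda>\<omega>. indicat_real A \<omega> * X t \<omega>))
          = \<bar>expectation (\<lambda>\<omega>. indicat_real A \<omega> * XN n t \<omega> - indicat_real A \<omega> * X t \<omega>)\<bar>"
          using iA[OF intXN] iA[OF integrable_X] by (simp add: Bochner_Integration.integral_diff)
        also have "\<dots> \<le> expectation (\<lambda>\<omega>. \<bar>indicat_real A \<omega> * XN n t \<omega> - indicat_real A \<omega> * X t \<omega>\<bar>)"
          by (rule integral_abs_bound)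
        also have "\<dots> \<le> expectation (\<lambda>\<omega>. \<bar>X t \<omega> - XN n t \<omega>\<bar>)"
          by (intro integral_mono integrable_abs Bochner_Integration.integrable_diff iA intXN integrable_X)
             (auto simp: indicator_def abs_minus_commute)
        finally show "norm (expectation (\<lambda>\<omega>. indicat_real A \<omega> * XN n t \<omega>)
            - expectation (\<lambda>\<omega>. indicat_real A \<omega> * X t \<omega>))
           \<le> expectation (\<lambda>\<omega>. \<bar>X t \<omega> - XN n t \<omega>\<bar>)" .
      qed
    qed
    moreover have "(\<lambda>n. expectation (\<lambda>\<omega>. indicat_real A \<omega> * XN n t \<omega>)) \<longlonglongrightarrow>
        expectation (\<lambda>\<omega>. indicat_real A \<omega> * (\<Sum>s = u..t. \<zeta> s \<omega> * G t s \<omega>))"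
      by (rule tendsto_eventually) (use eq in \<open>auto simp: eventually_sequentially\<close>)
    ultimately have "expectation (\<lambda>\<omega>. indicat_real A \<omega> * X t \<omega>) = expectation (\<lambda>\<omega>. indicat_real A \<omega> * (\<Sum>s
        = u..t. \<zeta> s \<omega> * G t s \<omega>))"
      by (rule LIMSEQ_unique)
    then show "(LINT \<omega>:A|M. X t \<omega>) = (LINT \<omega>:A|M. (\<Sum>s = u..t. \<zeta> s \<omega> * G t s \<omega>))"
      by (simp add: set_lebesgue_integral_def)
  qed
qed

text \<open>Consecutive projections differ by the single term at u. The equation thus refers to its
  own coefficients at times after s and no longer to X.\<close>

lemma G_recursion:
  assumes "s \<le> t"
  shows "AE \<omega> in M. G t s \<omega> = Q (\<alpha> (nat (t - s)) +
    (\<Sum>u\<in>{s<..t}. \<zeta> u \<omega> * (\<beta> (nat (t - u)) (nat (u - s)) * G t u \<omega>)))"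
proof -
  \<comment> \<open>The range extends to t + 1, since u = t also calls for the projection on the
    empty interval, where the sum is 0.\<close>
  have "AE \<omega> in M. \<forall>u\<in>{s<..t+1}. Eint M \<zeta> u t (X t) \<omega> = (\<Sum>s\<in>{u..t}. \<zeta> s \<omega> * G t s \<omega>)"
    by (rule AE_finite_allI) (auto intro: Eint_X)
  then show ?thesis
  proof eventually_elim
    case (elim \<omega>)
    have "Eint M \<zeta> u t (X t) \<omega> - Eint M \<zeta> (u + 1) t (X t) \<omega> = \<zeta> u \<omega> * G t u \<omega>" if "u \<in> {s<..t}" for u
    proof -
      have "{u..t} = insert u {u+1..t}" using that by auto
      then show ?thesis using elim that by simp
    qed
    then show ?case using assms unfolding G_def[of t s] proj_coeff_def
      by (auto intro!: arg_cong[of _ _ Q] sum.cong)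
  qed
qed

abbreviation mb :: "nat \<Rightarrow> real" where "mb \<equiv> mom_bound c\<^sub>Q \<alpha> \<beta>"

text \<open>The random part of the argument of Q. It is itself a predictable series, hence centred
  with an explicit variance.\<close>

definition Lin :: "int \<Rightarrow> int \<Rightarrow> 'a \<Rightarrow> real" where
  "Lin t s \<omega> = (\<Sum>u\<in>{s<..t}. \<zeta> u \<omega> * (\<beta> (nat (t - u)) (nat (u - s)) * G t u \<omega>))"

lemma linear_part:
  shows "Lin t s \<in> borel_measurable M" "integrable M (\<lambda>\<omega>. (Lin t s \<omega>)\<^sup>2)" "expectation (Lin t s) = 0"
    "expectation (\<lambda>\<omega>. (Lin t s \<omega>)\<^sup>2) = (\<Sum>u\<in>{s<..t}. (\<beta> (nat (t - u)) (nat (u - s)))\<^sup>2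
        * expectation (\<lambda>\<omega>. (G t u \<omega>)\<^sup>2))"
proof -
  have "predictable (\<lambda>u \<omega>. (\<beta> (nat (t - u)) (nat (u - s)) * G t u \<omega>))"
    unfolding predictable_def power_mult_distrib
    by (intro allI conjI borel_measurable_times borel_measurable_const integrable_mult_right predictableD[OF predictable_G])
  note p = square_integrable_sum_predictable[OF this, of "{s<..t}"] expectation_square_sum[OF this, of "{s<..t}"]
    expectation_sum_predictable[OF this, of "{s<..t}"]
  show "Lin t s \<in> borel_measurable M" "integrable M (\<lambda>\<omega>. (Lin t s \<omega>)\<^sup>2)" "expectation (Lin t s) = 0"
    "expectation (\<lambda>\<omega>. (Lin t s \<omega>)\<^sup>2) = (\<Sum>u\<in>{s<..t}. (\<beta> (nat (t - u)) (nat (u - s)))\<^sup>2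
        * expectation (\<lambda>\<omega>. (G t u \<omega>)\<^sup>2))"
    using p unfolding Lin_def[abs_def] by (auto simp: power_mult_distrib)
qed

lemma sum_past_reindex:
  assumes "s \<le> t"
  shows "(\<Sum>u\<in>{s<..t}. f (nat (t - u)) (nat (u - s))) = (\<Sum>i<nat (t - s). f i (nat (t - s) - i))"
  by (rule sum.reindex_bij_witness[of _ "\<lambda>i. t - int i" "\<lambda>u. nat (t - u)"])
     (use assms in \<open>auto simp: nat_diff_distrib nat_less_iff intro!: arg_cong2[of _ _ _ _ f]\<close>)

text \<open>Induction on the lag t - s, as the recursion involves only the smaller lags t - u. The
  cross term with \<alpha> disappears because \<open>Lin t s\<close> has mean zero.\<close>

lemma G_second_moment: "s \<le> t \<Longrightarrow> expectation (\<lambda>\<omega>. (G t s \<omega>)\<^sup>2) \<le> mb (nat (t - s))"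
proof (induction "nat (t - s)" arbitrary: s rule: less_induct)
  case less
  define L where "L = Lin t s"
  note L = linear_part[of t s, folded L_def]
  let ?a = "\<alpha> (nat (t - s))"
  have [measurable]: "L \<in> borel_measurable M" "G t s \<in> borel_measurable M"
      by (simp_all add: L(1) predictableD(2)[OF predictable_G])
  have iL: "integrable M L" by (rule expectation_abs_le_sqrt(1); rule L)
  have sq: "integrable M (\<lambda>\<omega>. (?a + L \<omega>)\<^sup>2)" by (rule integrable_square_add) (use L in auto)
  have "expectation (\<lambda>\<omega>. (G t s \<omega>)\<^sup>2) \<le> expectation (\<lambda>\<omega>. c\<^sub>Q\<^sup>2 * (?a + L \<omega>)\<^sup>2)"
  proof (rule integral_mono_AE)
    show "integrable M (\<lambda>\<omega>. (G t s \<omega>)\<^sup>2)" by (rule predictableD[OF predictable_G])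
    show "integrable M (\<lambda>\<omega>. c\<^sub>Q\<^sup>2 * (?a + L \<omega>)\<^sup>2)" using sq by simp
    show "AE \<omega> in M. (G t s \<omega>)\<^sup>2 \<le> c\<^sub>Q\<^sup>2 * (?a + L \<omega>)\<^sup>2"
      using G_recursion[OF less.prems]
    proof eventually_elim
      case (elim \<omega>)
      have "\<bar>G t s \<omega>\<bar>\<^sup>2 \<le> (c\<^sub>Q * \<bar>?a + L \<omega>\<bar>)\<^sup>2"
        unfolding elim L_def Lin_def by (intro power_mono Q_bound) auto
      then show ?case by (simp add: power_mult_distrib)
    qed
  qed
  also have "\<dots> = c\<^sub>Q\<^sup>2 * expectation (\<lambda>\<omega>. ?a\<^sup>2 + (L \<omega>)\<^sup>2 + 2 * ?a * L \<omega>)"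
    by (simp add: power2_sum)
  also have "expectation (\<lambda>\<omega>. ?a\<^sup>2 + (L \<omega>)\<^sup>2 + 2 * ?a * L \<omega>) = ?a\<^sup>2 + expectation (\<lambda>\<omega>. (L \<omega>)\<^sup>2)"
    using L iL by (simp add: prob_space)
  also have "expectation (\<lambda>\<omega>. (L \<omega>)\<^sup>2) \<le> (\<Sum>u\<in>{s<..t}. (\<beta> (nat (t - u)) (nat (u - s)))\<^sup>2 * mb (nat (t - u)))"
    unfolding L(4) using less by (intro sum_mono mult_left_mono) auto
  also have "\<dots> = (\<Sum>i<nat (t - s). (\<beta> i (nat (t - s) - i))\<^sup>2 * mb i)"
    by (rule sum_past_reindex[OF less.prems, of "\<lambda>i j. (\<beta> i j)\<^sup>2 * mb i"])
  finally show ?case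
    by (subst mom_bound.simps) (simp add: mult_left_mono)
qed

text \<open>A bound, uniform in t, for the L2 distance between the coefficient at lag j and the
  constant Q (\<alpha> j).\<close>

definition eps :: "nat \<Rightarrow> real" where
  "eps j = sqrt (c\<^sub>L\<^sup>2 * (\<Sum>i<j. (\<beta> i (j - i))\<^sup>2 * mb i))"

lemma eps_nonneg: "eps j \<ge> 0"
  unfolding eps_def by (intro real_sqrt_ge_zero mult_nonneg_nonneg sum_nonneg mom_bound_nonneg) auto

text \<open>The Lipschitz bound cancels \<alpha> and leaves \<open>Lin t s\<close>, whose second
  moment is controlled by \<open>G_second_moment\<close>.\<close>

lemma G_approx:
  assumes st: "s \<le> t"
  shows "expectation (\<lambda>\<omega>. (G t s \<omega> - Q (\<alpha> (nat (t - s))))\<^sup>2) \<le> (eps (nat (t - s)))\<^sup>2"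
proof -
  define L where "L = Lin t s"
  note L = linear_part[of t s, folded L_def]
  let ?a = "\<alpha> (nat (t - s))"
  have [measurable]: "L \<in> borel_measurable M" "G t s \<in> borel_measurable M"
      by (simp_all add: L(1) predictableD(2)[OF predictable_G])
  have "expectation (\<lambda>\<omega>. (G t s \<omega> - Q ?a)\<^sup>2) \<le> expectation (\<lambda>\<omega>. c\<^sub>L\<^sup>2 * (L \<omega>)\<^sup>2)"
  proof (rule integral_mono_AE)
    show "integrable M (\<lambda>\<omega>. (G t s \<omega> - Q ?a)\<^sup>2)"
      by (intro integrable_square_diff predictableD[OF predictable_G]) auto
    show "integrable M (\<lambda>\<omega>. c\<^sub>L\<^sup>2 * (L \<omega>)\<^sup>2)" using L by simp
    show "AE \<omega> in M. (G t s \<omega> - Q ?a)\<^sup>2 \<le> c\<^sub>L\<^sup>2 * (L \<omega>)\<^sup>2"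
      using G_recursion[OF st]
    proof eventually_elim
      case (elim \<omega>)
      have "\<bar>G t s \<omega> - Q ?a\<bar>\<^sup>2 \<le> (c\<^sub>L * \<bar>(?a + L \<omega>) - ?a\<bar>)\<^sup>2"
        unfolding elim L_def Lin_def by (intro power_mono Q_Lip(2)) auto
      then show ?case by (simp add: power_mult_distrib)
    qed
  qed
  also have "\<dots> = c\<^sub>L\<^sup>2 * expectation (\<lambda>\<omega>. (L \<omega>)\<^sup>2)" by simp
  also have "expectation (\<lambda>\<omega>. (L \<omega>)\<^sup>2) \<le> (\<Sum>u\<in>{s<..t}. (\<beta> (nat (t - u)) (nat (u - s)))\<^sup>2 * mb (nat (t - u)))"
    unfolding L(4) using G_second_moment by (intro sum_mono mult_left_mono) auto
  also have "\<dots> = (\<Sum>i<nat (t - s). (\<beta> i (nat (t - s) - i))\<^sup>2 * mb i)"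
    by (rule sum_past_reindex[OF st, of "\<lambda>i j. (\<beta> i j)\<^sup>2 * mb i"])
  also have "c\<^sub>L\<^sup>2 * \<dots> = (eps (nat (t - s)))\<^sup>2"
    unfolding eps_def by (subst real_sqrt_pow2) (auto intro!: mult_nonneg_nonneg sum_nonneg mom_bound_nonneg)
  finally show ?thesis by (simp add: mult_left_mono)
qed

end

section \<open>Characteristic functions of linear forms\<close>

text \<open>With d = f - F and h = g - H one has F H - f g = d h - d g - f h, and Cauchy-Schwarz
  bounds each product by norms of which at least one tends to 0.\<close>

lemma L2_inner_tendsto:
  fixes f g :: "'a \<Rightarrow> real" and F H :: "nat \<Rightarrow> 'a \<Rightarrow> real"
  assumes [measurable]: "f \<in> borel_measurable M" "g \<in> borel_measurable M"
    "\<And>n. F n \<in> borel_measurable M" "\<And>n. H n \<in> borel_measurable M"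
    and f: "integrable M (\<lambda>x. (f x)\<^sup>2)" and g: "integrable M (\<lambda>x. (g x)\<^sup>2)"
    and F: "\<And>n. integrable M (\<lambda>x. (F n x)\<^sup>2)" and H: "\<And>n. integrable M (\<lambda>x. (H n x)\<^sup>2)"
    and limF: "(\<lambda>n. \<integral>x. (f x - F n x)\<^sup>2 \<partial>M) \<longlonglongrightarrow> 0" and limH: "(\<lambda>n. \<integral>x. (g x - H n x)\<^sup>2 \<partial>M) \<longlonglongrightarrow> 0"
  shows "(\<lambda>n. \<integral>x. F n x * H n x \<partial>M) \<longlonglongrightarrow> (\<integral>x. f x * g x \<partial>M)"
proof -
  define N where "N u = sqrt (\<integral>x. (u x)\<^sup>2 \<partial>M)" for u :: "'a \<Rightarrow> real"
  note dF = integrable_square_diff[OF assms(1) assms(3) f F]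
  note dH = integrable_square_diff[OF assms(2) assms(4) g H]
  have lF: "(\<lambda>n. N (\<lambda>x. f x - F n x)) \<longlonglongrightarrow> 0" and lH: "(\<lambda>n. N (\<lambda>x. g x - H n x)) \<longlonglongrightarrow> 0"
    using tendsto_real_sqrt[OF limF] tendsto_real_sqrt[OF limH] by (simp_all add: N_def)
  let ?e = "\<lambda>n. N (\<lambda>x. f x - F n x) * N (\<lambda>x. g x - H n x) + N (\<lambda>x. f x - F n x) * N g + N f * N (\<lambda>x. g x
      - H n x)"
  have "?e \<longlonglongrightarrow> 0 * 0 + 0 * N g + N f * 0" by (intro tendsto_intros lF lH)
  then have e: "?e \<longlonglongrightarrow> 0" by simp
  show ?thesis
  proof (rule LIM_zero_cancel, rule Lim_null_comparison[OF _ e], intro always_eventually allI)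
    fix n
    let ?d = "\<lambda>x. f x - F n x" and ?h = "\<lambda>x. g x - H n x"
    have i: "integrable M (\<lambda>x. ?d x * ?h x)" "integrable M (\<lambda>x. ?d x * g x)" "integrable M (\<lambda>x. f x * ?h x)"
      "integrable M (\<lambda>x. f x * g x)" "integrable M (\<lambda>x. F n x * H n x)"
      by (intro integrable_mult_square dF dH f g F H, measurable)+
    have "(\<integral>x. F n x * H n x \<partial>M) - (\<integral>x. f x * g x \<partial>M) = (\<integral>x. F n x * H n x - f x * g x \<partial>M)"
      using i by simp
    also have "(\<lambda>x. F n x * H n x - f x * g x) = (\<lambda>x. ?d x * ?h x - ?d x * g x - f x * ?h x)"
      by (auto simp: algebra_simps)
    also have "(\<integral>x. ?d x * ?h x - ?d x * g x - f x * ?h x \<partial>M)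
       = (\<integral>x. ?d x * ?h x \<partial>M) - (\<integral>x. ?d x * g x \<partial>M) - (\<integral>x. f x * ?h x \<partial>M)"
      using i by simp
    finally have "\<bar>(\<integral>x. F n x * H n x \<partial>M) - (\<integral>x. f x * g x \<partial>M)\<bar>
       \<le> \<bar>\<integral>x. ?d x * ?h x \<partial>M\<bar> + \<bar>\<integral>x. ?d x * g x \<partial>M\<bar> + \<bar>\<integral>x. f x * ?h x \<partial>M\<bar>" by linarith
    also have "\<dots> \<le> ?e n"
      unfolding N_def by (intro add_mono Cauchy_Schwarz_integral dF dH f g) measurable
    finally show "norm ((\<integral>x. F n x * H n x \<partial>M) - (\<integral>x. f x * g x \<partial>M)) \<le> ?e n" by simp
  qed
qed

lemma iexp_diff_le: "cmod (iexp x - iexp y) \<le> \<bar>x - y\<bar>"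
proof -
  have "iexp x - iexp y = iexp y * (iexp (x - y) - 1)"
    by (simp add: right_diff_distrib exp_add[symmetric] algebra_simps)
  then have "cmod (iexp x - iexp y) = cmod (iexp (x - y) - 1)" by (simp add: norm_mult)
  also have "\<dots> \<le> \<bar>x - y\<bar>" using iexp_approx1[of "x - y" 0] by simp
  finally show ?thesis .
qed

lemma exp_minus_approx:
  fixes y :: real assumes "y \<ge> 0" shows "\<bar>exp (- y) - (1 - y)\<bar> \<le> y\<^sup>2 / 2"
proof (cases "y = 0")
  case False
  then have y: "y > 0" using assms by simp
  obtain t where t: "t > 0" "t < y" "exp (- y) = (\<Sum>m<2. (- 1) ^ m / fact m * (y - 0) ^ m)
      + exp (- t) / fact 2 * (y - 0) ^ 2"
  proof -
    have "\<exists>t>0. t < y \<and> (\<lambda>x. exp (- x)) y = (\<Sum>m<2. (\<lambda>m x. (- 1) ^ m * exp (- x)) m 0 / fact m * y ^ m)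
        + (\<lambda>m x. (- 1) ^ m * exp (- x)) 2 t / fact 2 * y ^ 2"
      by (rule Maclaurin) (use y in \<open>auto intro!: derivative_eq_intros\<close>)
    then show thesis using that by auto
  qed
  have "exp (- y) - (1 - y) = exp (- t) / 2 * y\<^sup>2" using t(3) by (simp add: numeral_2_eq_2)
  moreover have "exp (- t) \<le> 1" using t(1) by simp
  then have "exp (- t) / 2 * y\<^sup>2 \<le> 1 / 2 * y\<^sup>2" by (intro mult_right_mono) auto
  moreover have "0 \<le> exp (- t) / 2 * y\<^sup>2" by simp
  ultimately show ?thesis by linarith
qed simp

context innovations
begin

text \<open>The Lindeberg-type remainder of \<open>char_approx3'\<close>. The minimum with the
  square keeps it finite without a third moment, and dominated convergence makes it vanish as x
  tends to 0.\<close>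

definition psi :: "real \<Rightarrow> real" where
  "psi x = expectation (\<lambda>\<omega>. min (6 * (\<zeta> 0 \<omega>)\<^sup>2) (\<bar>x\<bar> * \<bar>\<zeta> 0 \<omega>\<bar> ^ 3)) / 6"

lemma psi_integrable: "integrable M (\<lambda>\<omega>. min (6 * (\<zeta> 0 \<omega>)\<^sup>2) (\<bar>x\<bar> * \<bar>\<zeta> 0 \<omega>\<bar> ^ 3))"
  by (rule Bochner_Integration.integrable_bound[OF integrable_mult_right[OF zeta_square(1)[of 0], of 6]])
     (auto intro!: AE_I2)

lemma psi_mono: "\<bar>x\<bar> \<le> y \<Longrightarrow> psi x \<le> psi y"
  unfolding psi_def
  by (intro divide_right_mono integral_mono psi_integrable min.mono mult_right_mono) auto

lemma psi_tendsto: assumes "x \<longlonglongrightarrow> 0" shows "(\<lambda>n. psi (x n)) \<longlonglongrightarrow> 0"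
proof -
  have "(\<lambda>n. expectation (\<lambda>\<omega>. min (6 * (\<zeta> 0 \<omega>)\<^sup>2) (\<bar>x n\<bar> * \<bar>\<zeta> 0 \<omega>\<bar> ^ 3))) \<longlonglongrightarrow> expectation (\<lambda>\<omega>. 0)"
  proof (rule integral_dominated_convergence[where w = "\<lambda>\<omega>. 6 * (\<zeta> 0 \<omega>)\<^sup>2"])
    show "AE \<omega> in M. (\<lambda>n. min (6 * (\<zeta> 0 \<omega>)\<^sup>2) (\<bar>x n\<bar> * \<bar>\<zeta> 0 \<omega>\<bar> ^ 3)) \<longlonglongrightarrow> 0"
    proof (intro AE_I2)
      fix \<omega>
      have "(\<lambda>n. min (6 * (\<zeta> 0 \<omega>)\<^sup>2) (\<bar>x n\<bar> * \<bar>\<zeta> 0 \<omega>\<bar> ^ 3)) \<longlonglongrightarrow> min (6 * (\<zeta> 0 \<omega>)\<^sup>2) (\<bar>0\<bar> * \<bar>\<zeta> 0 \<omega>\<bar> ^ 3)"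
        by (intro tendsto_intros assms)
      then show "(\<lambda>n. min (6 * (\<zeta> 0 \<omega>)\<^sup>2) (\<bar>x n\<bar> * \<bar>\<zeta> 0 \<omega>\<bar> ^ 3)) \<longlonglongrightarrow> 0" by simp
    qed
  qed (use zeta_square(1)[of 0] in \<open>auto intro!: AE_I2\<close>)
  then show ?thesis unfolding psi_def by (simp add: tendsto_divide_zero)
qed

text \<open>Both characteristic functions are compared with 1 - c^2 / 2. The two remainders are c^2
  times psi c and (c^2 / 2)^2 / 2, that is c^2 times c^2 / 8.\<close>

lemma char_zeta_approx:
  "cmod (char (distr M borel (\<zeta> 0)) c - of_real (exp (- (c\<^sup>2 / 2)))) \<le> c\<^sup>2 * (psi c + c\<^sup>2 / 8)"
proof -
  have 1: "cmod (char (distr M borel (\<zeta> 0)) c - (1 - c\<^sup>2 * 1 / 2))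
      \<le> c\<^sup>2 / 6 * expectation (\<lambda>\<omega>. min (6 * (\<zeta> 0 \<omega>)\<^sup>2) (\<bar>c\<bar> * \<bar>\<zeta> 0 \<omega>\<bar> ^ 3))"
    using char_approx3'[of "\<zeta> 0" 1 _ c] zeta_mean[of 0] zeta_square[of 0] by simp
  have 2: "cmod (of_real (exp (- (c\<^sup>2 / 2))) - (1 - c\<^sup>2 / 2)) \<le> (c\<^sup>2 / 2)\<^sup>2 / 2"
  proof -
    have "cmod (of_real (exp (- (c\<^sup>2 / 2))) - (1 - c\<^sup>2 / 2))
        = cmod (of_real (exp (- (c\<^sup>2 / 2)) - (1 - c\<^sup>2 / 2)))"
      by simp
    also have "\<dots> \<le> (c\<^sup>2 / 2)\<^sup>2 / 2" unfolding norm_of_real by (rule exp_minus_approx) simp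
    finally show ?thesis .
  qed
  have "cmod (char (distr M borel (\<zeta> 0)) c - of_real (exp (- (c\<^sup>2 / 2))))
     \<le> c\<^sup>2 / 6 * expectation (\<lambda>\<omega>. min (6 * (\<zeta> 0 \<omega>)\<^sup>2) (\<bar>c\<bar> * \<bar>\<zeta> 0 \<omega>\<bar> ^ 3)) + (c\<^sup>2 / 2)\<^sup>2 / 2"
    using norm_triangle_ineq4[of "char (distr M borel (\<zeta> 0)) c - (1 - c\<^sup>2 / 2)" "of_real (exp (- (c\<^sup>2 / 2)))
        - (1 - c\<^sup>2 / 2)"] 1 2
    by simp
  also have "\<dots> = c\<^sup>2 * (psi c + c\<^sup>2 / 8)" by (simp add: psi_def field_simps)
  finally show ?thesis .
qed

text \<open>Products of numbers of modulus at most 1 differ by at most the sum of the differences of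
  their factors. The factor next to the total variance is small as soon as m is: this is the
  negligibility condition of the Lindeberg argument.\<close>

lemma char_linear_form:
  assumes I: "finite I" and m: "\<And>s. s \<in> I \<Longrightarrow> \<bar>c s\<bar> \<le> m"
  shows "cmod ((CLINT \<omega>|M. iexp (\<Sum>s\<in>I. c s * \<zeta> s \<omega>)) - of_real (exp (- ((\<Sum>s\<in>I. (c s)\<^sup>2) / 2))))
     \<le> (\<Sum>s\<in>I. (c s)\<^sup>2) * (psi m + m\<^sup>2 / 8)"
proof -
  let ?\<phi> = "char (distr M borel (\<zeta> 0))"
  interpret D: real_distribution "distr M borel (\<zeta> 0)" by (rule real_distribution_distr) simp
  have iv: "indep_vars (\<lambda>_. borel) \<zeta> I"
    using std_iid indep_vars_subset[of "\<lambda>_. borel" \<zeta> UNIV I] unfolding std_iid_def by auto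
  have iv': "indep_vars (\<lambda>_. borel) (\<lambda>s \<omega>. c s * \<zeta> s \<omega>) I"
    using indep_vars_compose2[OF iv, of "\<lambda>s x. c s * x"] by simp
  have one: "char (distr M borel (\<lambda>\<omega>. c s * \<zeta> s \<omega>)) 1 = ?\<phi> (c s)" for s
  proof -
    have "char (distr M borel (\<lambda>\<omega>. c s * \<zeta> s \<omega>)) 1 = char (distr M borel (\<zeta> s)) (c s)"
      by (simp add: char_def integral_distr)
    then show ?thesis by (simp add: zeta_distr[of s])
  qed
  have "(CLINT \<omega>|M. iexp (\<Sum>s\<in>I. c s * \<zeta> s \<omega>)) = char (distr M borel (\<lambda>\<omega>. \<Sum>s\<in>I. c s * \<zeta> s \<omega>)) 1"
    by (simp add: char_def integral_distr)
  also have "\<dots> = (\<Prod>s\<in>I. ?\<phi> (c s))" unfolding char_distr_sum[OF iv'] one ..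
  finally have L: "(CLINT \<omega>|M. iexp (\<Sum>s\<in>I. c s * \<zeta> s \<omega>)) = (\<Prod>s\<in>I. ?\<phi> (c s))" .
  have R: "complex_of_real (exp (- ((\<Sum>s\<in>I. (c s)\<^sup>2) / 2))) = (\<Prod>s\<in>I. of_real (exp (- ((c s)\<^sup>2 / 2))))"
    unfolding of_real_prod[symmetric] exp_sum[OF I, symmetric] by (simp add: sum_negf sum_divide_distrib)
  have "cmod ((\<Prod>s\<in>I. ?\<phi> (c s)) - (\<Prod>s\<in>I. of_real (exp (- ((c s)\<^sup>2 / 2)))))
     \<le> (\<Sum>s\<in>I. cmod (?\<phi> (c s) - of_real (exp (- ((c s)\<^sup>2 / 2)))))"
    by (rule norm_prod_diff) (auto simp: D.cmod_char_le_1)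
  also have "\<dots> \<le> (\<Sum>s\<in>I. (c s)\<^sup>2 * (psi m + m\<^sup>2 / 8))"
  proof (rule sum_mono)
    fix s assume s: "s \<in> I"
    have "cmod (?\<phi> (c s) - of_real (exp (- ((c s)\<^sup>2 / 2)))) \<le> (c s)\<^sup>2 * (psi (c s) + (c s)\<^sup>2 / 8)"
      by (rule char_zeta_approx)
    also have "\<dots> \<le> (c s)\<^sup>2 * (psi m + m\<^sup>2 / 8)"
      using m[OF s] power_mono[OF m[OF s] abs_ge_zero, of 2]
      by (intro mult_left_mono add_mono psi_mono) auto
    finally show "cmod (?\<phi> (c s) - of_real (exp (- ((c s)\<^sup>2 / 2)))) \<le> (c s)\<^sup>2 * (psi m + m\<^sup>2 / 8)" .
  qed
  finally show ?thesis unfolding L R by (simp add: sum_distrib_right)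
qed

text \<open>Exchanging the two sums gives a single predictable series, to which the isometry
  applies; Cauchy-Schwarz then replaces the random coefficients by their deterministic bounds
  \<eta>.\<close>

lemma second_moment_combination:
  assumes K: "finite K" and I: "finite I" and H: "\<And>k. k \<in> K \<Longrightarrow> predictable (H k)"
    and \<eta>: "\<And>k s. k \<in> K \<Longrightarrow> expectation (\<lambda>\<omega>. (H k s \<omega>)\<^sup>2) \<le> (\<eta> k s)\<^sup>2" "\<And>k s. \<eta> k s \<ge> 0"
  shows "expectation (\<lambda>\<omega>. (\<Sum>k\<in>K. a k * (\<Sum>s\<in>I. \<zeta> s \<omega> * H k s \<omega>))\<^sup>2)
     \<le> (\<Sum>k\<in>K. \<Sum>l\<in>K. \<bar>a k\<bar> * \<bar>a l\<bar> * (\<Sum>s\<in>I. \<eta> k s * \<eta> l s))"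
proof -
  note p = predictableD[OF H]
  have int: "integrable M (\<lambda>\<omega>. H k s \<omega> * H l s \<omega>)" if "k \<in> K" "l \<in> K" for k l s
    by (intro integrable_mult_square p that)
  have sw: "(\<Sum>k\<in>K. a k * (\<Sum>s\<in>I. \<zeta> s \<omega> * H k s \<omega>)) = (\<Sum>s\<in>I. \<zeta> s \<omega> * (\<Sum>k\<in>K. a k * H k s \<omega>))" for \<omega>
    unfolding sum_distrib_left by (subst sum.swap) (simp add: mult_ac)
  have "expectation (\<lambda>\<omega>. (\<Sum>k\<in>K. a k * (\<Sum>s\<in>I. \<zeta> s \<omega> * H k s \<omega>))\<^sup>2)
     = (\<Sum>s\<in>I. expectation (\<lambda>\<omega>. (\<Sum>k\<in>K. a k * H k s \<omega>)\<^sup>2))"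
    unfolding sw by (intro expectation_square_sum predictable_sum K H I)
  also have "\<dots> \<le> (\<Sum>s\<in>I. \<Sum>k\<in>K. \<Sum>l\<in>K. \<bar>a k\<bar> * \<bar>a l\<bar> * (\<eta> k s * \<eta> l s))"
  proof (rule sum_mono)
    fix s assume "s \<in> I"
    have "expectation (\<lambda>\<omega>. (\<Sum>k\<in>K. a k * H k s \<omega>)\<^sup>2)
       = expectation (\<lambda>\<omega>. \<Sum>k\<in>K. \<Sum>l\<in>K. a k * a l * (H k s \<omega> * H l s \<omega>))"
      by (simp add: power2_eq_square sum_product mult_ac)
    also have "\<dots> = (\<Sum>k\<in>K. \<Sum>l\<in>K. a k * a l * expectation (\<lambda>\<omega>. H k s \<omega> * H l s \<omega>))"
      using int by (subst Bochner_Integration.integral_sum; (intro Bochner_Integration.integrable_sum integrable_mult_right sum.cong refl)?; simp)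
    also have "\<dots> \<le> (\<Sum>k\<in>K. \<Sum>l\<in>K. \<bar>a k\<bar> * \<bar>a l\<bar> * (\<eta> k s * \<eta> l s))"
    proof (intro sum_mono)
      fix k l assume kl: "k \<in> K" "l \<in> K"
      have s: "sqrt (expectation (\<lambda>\<omega>. (H k s \<omega>)\<^sup>2)) \<le> \<eta> k s" if "k \<in> K" for k
        using \<eta>(1)[OF that] \<eta>(2) by (intro real_le_lsqrt) auto
      have "\<bar>expectation (\<lambda>\<omega>. H k s \<omega> * H l s \<omega>)\<bar> \<le> sqrt (expectation (\<lambda>\<omega>. (H k s \<omega>)\<^sup>2))
          * sqrt (expectation (\<lambda>\<omega>. (H l s \<omega>)\<^sup>2))"
        by (intro Cauchy_Schwarz_integral p kl)
      also have "\<dots> \<le> \<eta> k s * \<eta> l s" by (intro mult_mono s kl) (auto intro: \<eta>)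
      finally have "\<bar>a k * a l\<bar> * \<bar>expectation (\<lambda>\<omega>. H k s \<omega> * H l s \<omega>)\<bar> \<le> \<bar>a k * a l\<bar> * (\<eta> k s * \<eta> l s)"
        by (rule mult_left_mono) simp
      then have "\<bar>a k * a l * expectation (\<lambda>\<omega>. H k s \<omega> * H l s \<omega>)\<bar> \<le> \<bar>a k\<bar> * \<bar>a l\<bar> * (\<eta> k s * \<eta> l s)"
        by (simp add: abs_mult)
      then show "a k * a l * expectation (\<lambda>\<omega>. H k s \<omega> * H l s \<omega>) \<le> \<bar>a k\<bar> * \<bar>a l\<bar> * (\<eta> k s * \<eta> l s)"
        by linarith
    qed
    finally show "expectation (\<lambda>\<omega>. (\<Sum>k\<in>K. a k * H k s \<omega>)\<^sup>2) \<le> (\<Sum>k\<in>K. \<Sum>l\<in>K. \<bar>a k\<bar> * \<bar>a l\<bar> * (\<eta> k s * \<eta> l s))" .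
  qed
  also have "\<dots> = (\<Sum>k\<in>K. \<Sum>l\<in>K. \<bar>a k\<bar> * \<bar>a l\<bar> * (\<Sum>s\<in>I. \<eta> k s * \<eta> l s))"
    unfolding sum_distrib_left by (subst sum.swap, rule sum.cong[OF refl], rule sum.swap)
  finally show ?thesis .
qed

end

text \<open>The cross covariance at lag j of two moving averages with kernels x and y. The lag falls
  on y, so the order of the kernels matters.\<close>

definition corr :: "(nat \<Rightarrow> real) \<Rightarrow> (nat \<Rightarrow> real) \<Rightarrow> nat \<Rightarrow> real" where
  "corr x y j = (\<Sum>k. x k * y (j + k))"

text \<open>The weight of \<open>\<zeta> s\<close> in a moving average at time t with kernel x.
  Extension by 0 beyond t lets all times share one index set of innovations.\<close>

definition lagged :: "(nat \<Rightarrow> real) \<Rightarrow> int \<Rightarrow> int \<Rightarrow> real" where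
  "lagged x t s = (if s \<le> t then x (nat (t - s)) else 0)"

lemma summable_corr:
  fixes x y :: "nat \<Rightarrow> real"
  assumes "summable (\<lambda>k. (x k)\<^sup>2)" "summable (\<lambda>k. (y k)\<^sup>2)"
  shows "summable (\<lambda>k. x k * y (j + k))"
proof (rule summable_comparison_test'[where N = 0])
  show "summable (\<lambda>k. (x k)\<^sup>2 + (y (k + j))\<^sup>2)"
    using assms by (intro summable_add summable_ignore_initial_segment)
  show "norm (x k * y (j + k)) \<le> (x k)\<^sup>2 + (y (k + j))\<^sup>2" for k
    using abs_mult_le_squares[of "x k" "y (j + k)"] by (simp add: add.commute)
qed

lemma lagged_sum_le:
  assumes I: "finite I" and x: "\<And>k. x k \<ge> 0" and y: "\<And>k. y k \<ge> 0" and tt: "t \<le> t'"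
    and s: "summable (\<lambda>k. x k * y (nat (t' - t) + k))"
  shows "(\<Sum>s\<in>I. lagged x t s * lagged y t' s) \<le> corr x y (nat (t' - t))"
proof -
  have "(\<Sum>s\<in>I. lagged x t s * lagged y t' s) = (\<Sum>s\<in>I \<inter> {..t}. lagged x t s * lagged y t' s)"
    by (rule sum.mono_neutral_right) (use I in \<open>auto simp: lagged_def\<close>)
  also have "\<dots> = (\<Sum>k\<in>(\<lambda>s. nat (t - s)) ` (I \<inter> {..t}). x k * y (nat (t' - t) + k))"
    by (subst sum.reindex)
       (use tt in \<open>auto simp: inj_on_def lagged_def nat_add_distrib[symmetric]
           intro!: sum.cong arg_cong[of _ _ y]\<close>)
  also have "\<dots> \<le> corr x y (nat (t' - t))"
    unfolding corr_def by (rule sum_le_suminf[OF s]) (use I x y in auto)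
  finally show ?thesis .
qed

lemma lagged_sum_tendsto:
  assumes tt: "t \<le> t'" "t \<le> T" and s: "summable (\<lambda>k. x k * y (nat (t' - t) + k))"
  shows "(\<lambda>N. \<Sum>s\<in>{- int N..T}. lagged x t s * lagged y t' s) \<longlonglongrightarrow> corr x y (nat (t' - t))"
proof -
  have eq: "(\<Sum>s\<in>{- int N..T}. lagged x t s * lagged y t' s)
      = (\<Sum>k<nat (t + int N + 1). x k * y (nat (t' - t) + k))" for N
  proof -
    have "(\<Sum>s\<in>{- int N..T}. lagged x t s * lagged y t' s) = (\<Sum>s\<in>{- int N..t}. lagged x t s * lagged y t' s)"
      by (rule sum.mono_neutral_right) (use tt in \<open>auto simp: lagged_def\<close>)
    also have "\<dots> = (\<Sum>k<nat (t + int N + 1). x k * y (nat (t' - t) + k))"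
      by (rule sum.reindex_bij_witness[of _ "\<lambda>k. t - int k" "\<lambda>s. nat (t - s)"])
         (use tt in \<open>auto simp: lagged_def nat_add_distrib[symmetric] intro!: arg_cong[of _ _ y]\<close>)
    finally show ?thesis .
  qed
  have "filterlim (\<lambda>N. nat (t + int N + 1)) at_top sequentially"
    unfolding filterlim_at_top
  proof
    fix Z show "\<forall>\<^sub>F N in sequentially. Z \<le> nat (t + int N + 1)"
      using eventually_ge_at_top[of "nat (int Z - t)"] by eventually_elim linarith
  qed
  from filterlim_compose[OF summable_LIMSEQ[OF s] this] show ?thesis
    unfolding eq corr_def .
qed

section \<open>Comparison with a linear process\<close>

text \<open>Square summability of \<open>b\<close> and \<open>eps\<close> is the interface of the
  comparison with the linear process; decay rates enter afterwards, when the resulting bounds are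
  evaluated.\<close>

locale projective_model_l2 = projective_model +
  assumes summable_b: "summable (\<lambda>k. (Q (\<alpha> k))\<^sup>2)"
    and summable_eps: "summable (\<lambda>k. (eps k)\<^sup>2)"
begin

definition b :: "nat \<Rightarrow> real" where "b j = Q (\<alpha> j)"
definition bound :: "nat \<Rightarrow> real" where "bound j = \<bar>b j\<bar> + eps j"
definition R :: "int \<Rightarrow> int \<Rightarrow> 'a \<Rightarrow> real" where "R t s \<omega> = G t s \<omega> - lagged b t s"
text \<open>Truncation to a window of innovations common to all times up to \<open>T\<close>.\<close>

definition XW :: "nat \<Rightarrow> nat \<Rightarrow> int \<Rightarrow> 'a \<Rightarrow> real" where
  "XW T N t \<omega> = (\<Sum>s\<in>{- int N..int T}. \<zeta> s \<omega> * G t s \<omega>)"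

lemma bound_nonneg: "bound j \<ge> 0" using eps_nonneg by (simp add: bound_def)

lemma summable_squares: "summable (\<lambda>k. (b k)\<^sup>2)" "summable (\<lambda>k. \<bar>b k\<bar>\<^sup>2)" "summable (\<lambda>k. (bound k)\<^sup>2)"
proof -
  show 1: "summable (\<lambda>k. (b k)\<^sup>2)" "summable (\<lambda>k. \<bar>b k\<bar>\<^sup>2)" using summable_b by (simp_all add: b_def)
  show "summable (\<lambda>k. (bound k)\<^sup>2)"
  proof (rule summable_comparison_test'[where N = 0])
    show "summable (\<lambda>k. 2 * ((b k)\<^sup>2 + (eps k)\<^sup>2))" by (intro summable_mult summable_add 1 summable_eps)
    show "norm ((bound k)\<^sup>2) \<le> 2 * ((b k)\<^sup>2 + (eps k)\<^sup>2)" for k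
      using sum_squares_bound[of "\<bar>b k\<bar>" "eps k"]
        abs_of_nonneg[OF zero_le_power2[of "bound k"]]
      by (simp add: bound_def power2_sum)
  qed
qed

lemma predictable_R: "predictable (R t)"
  unfolding R_def[abs_def] by (intro predictable_diff predictable_G predictable_const)

lemma lagged_nonneg: "(\<And>j. x j \<ge> 0) \<Longrightarrow> lagged x t s \<ge> 0"
  by (simp add: lagged_def)

lemma R_second_moment: "expectation (\<lambda>\<omega>. (R t s \<omega>)\<^sup>2) \<le> (lagged eps t s)\<^sup>2"
  using G_approx[of s t] by (auto simp: R_def lagged_def G_def b_def)

lemma R_sqrt: "sqrt (expectation (\<lambda>\<omega>. (R t s \<omega>)\<^sup>2)) \<le> lagged eps t s"
  using R_second_moment lagged_nonneg[of eps] eps_nonneg by (intro real_le_lsqrt) auto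

lemma R_mean: "\<bar>expectation (R t s)\<bar> \<le> lagged eps t s"
proof -
  note p = predictableD[OF predictable_R[of t], of s]
  have "\<bar>expectation (R t s)\<bar> \<le> expectation (\<lambda>\<omega>. \<bar>R t s \<omega>\<bar>)" by (rule integral_abs_bound)
  also have "\<dots> \<le> sqrt (expectation (\<lambda>\<omega>. (R t s \<omega>)\<^sup>2))" by (rule expectation_abs_le_sqrt(2)[OF p(2,3)])
  also have "\<dots> \<le> lagged eps t s" by (rule R_sqrt)
  finally show ?thesis .
qed

lemma R_integrable: "integrable M (R t s)"
  by (rule expectation_abs_le_sqrt(1); rule predictableD[OF predictable_R])

text \<open>Both coefficients are expanded as \<open>lagged b\<close> plus the remainder
  \<open>R\<close>. Each error term contains a remainder: the linear ones are controlled by its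
  mean, the quadratic one by Cauchy-Schwarz.\<close>

lemma G_product:
  "\<bar>expectation (\<lambda>\<omega>. G t s \<omega> * G t' s \<omega>) - lagged b t s * lagged b t' s\<bar>
    \<le> \<bar>lagged b t s\<bar> * lagged eps t' s + lagged eps t s * \<bar>lagged b t' s\<bar> + lagged eps t s * lagged eps t' s"
proof -
  note p = predictableD[OF predictable_R]
  have RR: "integrable M (\<lambda>\<omega>. R t s \<omega> * R t' s \<omega>)" by (intro integrable_mult_square p)
  have "expectation (\<lambda>\<omega>. G t s \<omega> * G t' s \<omega>)
    = expectation (\<lambda>\<omega>. lagged b t s * lagged b t' s + lagged b t s * R t' s \<omega> + lagged b t' s * R t s \<omega>
        + R t s \<omega> * R t' s \<omega>)"
    by (simp add: R_def algebra_simps)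
  also have "\<dots> = lagged b t s * lagged b t' s + lagged b t s * expectation (R t' s) + lagged b t' s
      * expectation (R t s)
     + expectation (\<lambda>\<omega>. R t s \<omega> * R t' s \<omega>)"
    using R_integrable RR by (simp add: prob_space)
  finally have "\<bar>expectation (\<lambda>\<omega>. G t s \<omega> * G t' s \<omega>) - lagged b t s * lagged b t' s\<bar>
     \<le> \<bar>lagged b t s\<bar> * \<bar>expectation (R t' s)\<bar> + \<bar>lagged b t' s\<bar> * \<bar>expectation (R t s)\<bar>
         + \<bar>expectation (\<lambda>\<omega>. R t s \<omega> * R t' s \<omega>)\<bar>"
    unfolding abs_mult[symmetric] by linarith
  also have "\<bar>expectation (\<lambda>\<omega>. R t s \<omega> * R t' s \<omega>)\<bar> \<le> sqrt (expectation (\<lambda>\<omega>. (R t s \<omega>)\<^sup>2))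
      * sqrt (expectation (\<lambda>\<omega>. (R t' s \<omega>)\<^sup>2))"
    by (intro Cauchy_Schwarz_integral p)
  also have "\<dots> \<le> lagged eps t s * lagged eps t' s"
    by (intro mult_mono R_sqrt lagged_nonneg eps_nonneg) auto
  also have "\<bar>lagged b t s\<bar> * \<bar>expectation (R t' s)\<bar> \<le> \<bar>lagged b t s\<bar> * lagged eps t' s"
    by (intro mult_left_mono R_mean) auto
  also have "\<bar>lagged b t' s\<bar> * \<bar>expectation (R t s)\<bar> \<le> lagged eps t s * \<bar>lagged b t' s\<bar>"
    using mult_left_mono[OF R_mean[of t s], of "\<bar>lagged b t' s\<bar>"] by (simp add: mult.commute)
  finally show ?thesis by simp
qed

text \<open>The diagonal t = t' of \<open>G_product\<close>, whose right side completes to a square: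
  in effect Minkowski's inequality.\<close>

lemma G_second_moment': "expectation (\<lambda>\<omega>. (G t s \<omega>)\<^sup>2) \<le> (lagged bound t s)\<^sup>2"
proof -
  have "expectation (\<lambda>\<omega>. (G t s \<omega>)\<^sup>2) \<le> (lagged b t s)\<^sup>2 + \<bar>lagged b t s\<bar> * lagged eps t s + lagged eps t s
      * \<bar>lagged b t s\<bar> + (lagged eps t s)\<^sup>2"
    using G_product[of t s t] by (simp add: power2_eq_square)
  also have "\<dots> = (\<bar>lagged b t s\<bar> + lagged eps t s)\<^sup>2" by (simp add: power2_sum)
  also have "\<bar>lagged b t s\<bar> + lagged eps t s = lagged bound t s" by (simp add: lagged_def bound_def)
  finally show ?thesis .
qed

lemma XW_measurable[measurable]: "XW T N t \<in> borel_measurable M"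
  and XW_square: "integrable M (\<lambda>\<omega>. (XW T N t \<omega>)\<^sup>2)"
  using square_integrable_sum_predictable[OF predictable_G[of t], of "{- int N..int T}"]
      by (auto simp: XW_def[abs_def])

lemma XW_tendsto:
  assumes "k \<le> T"
  shows "(\<lambda>N. expectation (\<lambda>\<omega>. (X (int k) \<omega> - XW T N (int k) \<omega>)\<^sup>2)) \<longlonglongrightarrow> 0"
proof -
  \<comment> \<open>Since the coefficients vanish beyond time k, the common window ending at T
    effectively ends at k and has N + k + 1 terms.\<close>
  have "XW T N (int k) = XN (N + k) (int k)" for N
  proof
    fix \<omega>
    have "XW T N (int k) \<omega> = (\<Sum>s\<in>{- int N..int k}. \<zeta> s \<omega> * G (int k) s \<omega>)"
      unfolding XW_def by (rule sum.mono_neutral_right) (use assms in \<open>auto simp: G_def\<close>)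
    then show "XW T N (int k) \<omega> = XN (N + k) (int k) \<omega>" by (simp add: XN_def)
  qed
  then show ?thesis using LIMSEQ_ignore_initial_segment[OF XN_tendsto[of "int k"], of k] by simp
qed

text \<open>On a finite window the isometry turns the covariance into a sum over s, to which
  \<open>G_product\<close> applies termwise; then the window grows. Two mixed terms appear because
  \<open>corr\<close> is not symmetric in its kernels.\<close>

lemma covariance_approx:
  "\<bar>expectation (\<lambda>\<omega>. X 0 \<omega> * X (int t) \<omega>) - corr b b t\<bar>
    \<le> corr (\<lambda>k. \<bar>b k\<bar>) eps t + corr eps (\<lambda>k. \<bar>b k\<bar>) t + corr eps eps t"
proof -
  have l1: "(\<lambda>N. expectation (\<lambda>\<omega>. XW t N (int 0) \<omega> * XW t N (int t) \<omega>))
      \<longlonglongrightarrow> expectation (\<lambda>\<omega>. X (int 0) \<omega> * X (int t) \<omega>)"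
    by (intro L2_inner_tendsto XW_tendsto X_square XW_square) auto
  have eq: "expectation (\<lambda>\<omega>. XW t N (int 0) \<omega> * XW t N (int t) \<omega>)
      = (\<Sum>s\<in>{- int N..int t}. expectation (\<lambda>\<omega>. G 0 s \<omega> * G (int t) s \<omega>))" for N
    unfolding XW_def by (subst expectation_prod_sums) (auto intro: predictable_G)
  let ?W = "\<lambda>x y N. \<Sum>s\<in>{- int N..int t}. lagged x 0 s * lagged y (int t) s"
  have lim: "?W x y \<longlonglongrightarrow> corr x y t" if "summable (\<lambda>k. (x k)\<^sup>2)" "summable (\<lambda>k. (y k)\<^sup>2)" for x y
    using lagged_sum_tendsto[of 0 "int t" "int t" x y] summable_corr[OF that] by simp
  have labs: "\<bar>lagged b u s\<bar> = lagged (\<lambda>k. \<bar>b k\<bar>) u s" for u s by (simp add: lagged_def)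
  let ?Z = "\<lambda>N. ?W (\<lambda>k. \<bar>b k\<bar>) eps N + ?W eps (\<lambda>k. \<bar>b k\<bar>) N + ?W eps eps N"
  have "\<bar>expectation (\<lambda>\<omega>. XW t N (int 0) \<omega> * XW t N (int t) \<omega>) - ?W b b N\<bar> \<le> ?Z N" for N
  proof -
    have "\<bar>expectation (\<lambda>\<omega>. XW t N (int 0) \<omega> * XW t N (int t) \<omega>) - ?W b b N\<bar>
      = \<bar>\<Sum>s\<in>{- int N..int t}. expectation (\<lambda>\<omega>. G 0 s \<omega> * G (int t) s \<omega>) - lagged b 0 s * lagged b (int t) s\<bar>"
      unfolding eq by (simp add: sum_subtractf)
    also have "\<dots> \<le> (\<Sum>s\<in>{- int N..int t}. \<bar>expectation (\<lambda>\<omega>. G 0 s \<omega> * G (int t) s \<omega>) - lagged b 0 s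
        * lagged b (int t) s\<bar>)"
      by (rule sum_abs)
    also have "\<dots> \<le> (\<Sum>s\<in>{- int N..int t}. \<bar>lagged b 0 s\<bar> * lagged eps (int t) s + lagged eps 0 s
        * \<bar>lagged b (int t) s\<bar> + lagged eps 0 s * lagged eps (int t) s)"
      by (intro sum_mono G_product)
    also have "\<dots> = ?Z N" unfolding labs by (simp add: sum.distrib)
    finally show ?thesis .
  qed
  moreover have "(\<lambda>N. \<bar>expectation (\<lambda>\<omega>. XW t N (int 0) \<omega> * XW t N (int t) \<omega>) - ?W b b N\<bar>)
      \<longlonglongrightarrow> \<bar>expectation (\<lambda>\<omega>. X (int 0) \<omega> * X (int t) \<omega>) - corr b b t\<bar>"
    by (intro tendsto_intros l1 lim summable_squares)
  moreover have "?Z \<longlonglongrightarrow> corr (\<lambda>k. \<bar>b k\<bar>) eps t + corr eps (\<lambda>k. \<bar>b k\<bar>) t + corr eps eps t"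
    by (intro tendsto_intros lim summable_squares summable_eps)
  ultimately show ?thesis by (intro LIMSEQ_le[of _ _ _ _]) auto
qed

lemma lagged_sum_le_abs:
  assumes "finite I" "\<And>k. x k \<ge> 0" "summable (\<lambda>k. (x k)\<^sup>2)"
  shows "(\<Sum>s\<in>I. lagged x (int k) s * lagged x (int l) s) \<le> corr x x (nat \<bar>int k - int l\<bar>)"
proof (cases "k \<le> l")
  case True
  then have "nat \<bar>int k - int l\<bar> = nat (int l - int k)" by simp
  then show ?thesis using lagged_sum_le[of I x x "int k" "int l"] summable_corr[OF assms(3,3)] assms True
      by simp
next
  case False
  then have e: "nat \<bar>int k - int l\<bar> = nat (int k - int l)" by simp
  have "(\<Sum>s\<in>I. lagged x (int l) s * lagged x (int k) s) \<le> corr x x (nat (int k - int l))"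
    by (rule lagged_sum_le) (use assms False summable_corr[OF assms(3,3)] in auto)
  then show ?thesis unfolding e by (simp add: mult.commute)
qed

text \<open>Used with the coefficients \<open>G\<close> and the kernel \<open>bound\<close> for the
  size of partial sums, and with the remainder \<open>R\<close> and the kernel \<open>eps\<close>
  for the error of linearization.\<close>

lemma combination_bound:
  assumes H: "\<And>t. predictable (H t)" and x: "\<And>k. x k \<ge> 0" "summable (\<lambda>k. (x k)\<^sup>2)"
    and Hx: "\<And>t s. expectation (\<lambda>\<omega>. (H t s \<omega>)\<^sup>2) \<le> (lagged x t s)\<^sup>2"
    and a: "\<And>k. \<bar>a k\<bar> \<le> A" and I: "finite I"
  shows "expectation (\<lambda>\<omega>. (\<Sum>k=p+1..p+n. a k * (\<Sum>s\<in>I. \<zeta> s \<omega> * H (int k) s \<omega>))\<^sup>2) \<le> A\<^sup>2 * covsum (corr x x) n n"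
proof -
  have A: "A \<ge> 0" using a[of 0] by linarith
  have "expectation (\<lambda>\<omega>. (\<Sum>k=p+1..p+n. a k * (\<Sum>s\<in>I. \<zeta> s \<omega> * H (int k) s \<omega>))\<^sup>2)
    \<le> (\<Sum>k=p+1..p+n. \<Sum>l=p+1..p+n. \<bar>a k\<bar> * \<bar>a l\<bar> * (\<Sum>s\<in>I. lagged x (int k) s * lagged x (int l) s))"
    by (rule second_moment_combination[where H = "\<lambda>k. H (int k)" and \<eta> = "\<lambda>k. lagged x (int k)"])
       (use H Hx I in \<open>auto intro: lagged_nonneg x\<close>)
  also have "\<dots> \<le> (\<Sum>k=p+1..p+n. \<Sum>l=p+1..p+n. (A * A) * corr x x (nat \<bar>int k - int l\<bar>))"
    by (intro sum_mono mult_mono a lagged_sum_le_abs I x A)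
       (auto intro!: sum_nonneg mult_nonneg_nonneg lagged_nonneg x A)
  also have "\<dots> = A\<^sup>2 * covsum (corr x x) n n"
    unfolding covsum_shift[symmetric, where p = p and n = n] sum_distrib_left by (simp add: power2_eq_square)
  finally show ?thesis .
qed

lemma combination_square:
  fixes a :: "nat \<Rightarrow> real"
  shows "(\<lambda>\<omega>. \<Sum>k\<in>K. a k * X (int k) \<omega>) \<in> borel_measurable M" "integrable M (\<lambda>\<omega>. (\<Sum>k\<in>K. a k * X (int k) \<omega>)\<^sup>2)"
    "(\<lambda>\<omega>. \<Sum>k\<in>K. a k * XW T N (int k) \<omega>) \<in> borel_measurable M" "integrable M (\<lambda>\<omega>. (\<Sum>k\<in>K. a k
        * XW T N (int k) \<omega>)\<^sup>2)"
proof -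
  show "(\<lambda>\<omega>. \<Sum>k\<in>K. a k * X (int k) \<omega>) \<in> borel_measurable M" "(\<lambda>\<omega>. \<Sum>k\<in>K. a k
      * XW T N (int k) \<omega>) \<in> borel_measurable M"
    by measurable
  show "integrable M (\<lambda>\<omega>. (\<Sum>k\<in>K. a k * X (int k) \<omega>)\<^sup>2)" "integrable M (\<lambda>\<omega>. (\<Sum>k\<in>K. a k * XW T N (int k) \<omega>)\<^sup>2)"
    by (cases "finite K"; auto intro!: integrable_square_sum X_square XW_square simp: power_mult_distrib)+
qed

lemma combination_tendsto:
  assumes "\<And>k. k \<in> K \<Longrightarrow> k \<le> T"
  shows "(\<lambda>N. expectation (\<lambda>\<omega>. ((\<Sum>k\<in>K. a k * X (int k) \<omega>) - (\<Sum>k\<in>K. a k * XW T N (int k) \<omega>))\<^sup>2)) \<longlonglongrightarrow> 0"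
proof -
  have int: "integrable M (\<lambda>\<omega>. (X (int k) \<omega> - XW T N (int k) \<omega>)\<^sup>2)" for k N
    by (intro integrable_square_diff X_square XW_square) auto
  have "(\<lambda>N. (\<Sum>k\<in>K. (a k)\<^sup>2) * (\<Sum>k\<in>K. expectation (\<lambda>\<omega>. (X (int k) \<omega> - XW T N (int k) \<omega>)\<^sup>2)))
      \<longlonglongrightarrow> (\<Sum>k\<in>K. (a k)\<^sup>2) * (\<Sum>k\<in>K. 0)"
    by (intro tendsto_intros XW_tendsto assms)
  then have lim: "(\<lambda>N. (\<Sum>k\<in>K. (a k)\<^sup>2) * (\<Sum>k\<in>K. expectation (\<lambda>\<omega>. (X (int k) \<omega> - XW T N (int k) \<omega>)\<^sup>2))) \<longlonglongrightarrow> 0"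
      by simp
  show ?thesis
  proof (rule Lim_null_comparison[OF always_eventually lim], rule allI)
    fix N
    have "expectation (\<lambda>\<omega>. ((\<Sum>k\<in>K. a k * X (int k) \<omega>) - (\<Sum>k\<in>K. a k * XW T N (int k) \<omega>))\<^sup>2)
      = expectation (\<lambda>\<omega>. (\<Sum>k\<in>K. a k * (X (int k) \<omega> - XW T N (int k) \<omega>))\<^sup>2)"
      by (simp add: sum_subtractf right_diff_distrib)
    also have "\<dots> \<le> expectation (\<lambda>\<omega>. (\<Sum>k\<in>K. (a k)\<^sup>2) * (\<Sum>k\<in>K. (X (int k) \<omega> - XW T N (int k) \<omega>)\<^sup>2))"
    proof (rule integral_mono)
      show "integrable M (\<lambda>\<omega>. (\<Sum>k\<in>K. a k * (X (int k) \<omega> - XW T N (int k) \<omega>))\<^sup>2)"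
        by (cases "finite K"; auto intro!: integrable_square_sum int simp: power_mult_distrib)
      show "integrable M (\<lambda>\<omega>. (\<Sum>k\<in>K. (a k)\<^sup>2) * (\<Sum>k\<in>K. (X (int k) \<omega> - XW T N (int k) \<omega>)\<^sup>2))"
        by (intro integrable_mult_right Bochner_Integration.integrable_sum int)
    qed (rule Cauchy_Schwarz_ineq_sum)
    also have "\<dots> = (\<Sum>k\<in>K. (a k)\<^sup>2) * (\<Sum>k\<in>K. expectation (\<lambda>\<omega>. (X (int k) \<omega> - XW T N (int k) \<omega>)\<^sup>2))"
      using int by (simp add: Bochner_Integration.integral_sum)
    finally show "norm (expectation (\<lambda>\<omega>. ((\<Sum>k\<in>K. a k * X (int k) \<omega>) - (\<Sum>k\<in>K. a k * XW T N (int k) \<omega>))\<^sup>2))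
       \<le> (\<Sum>k\<in>K. (a k)\<^sup>2) * (\<Sum>k\<in>K. expectation (\<lambda>\<omega>. (X (int k) \<omega> - XW T N (int k) \<omega>)\<^sup>2))"
      by simp
  qed
qed

text \<open>The case of weights 1 in \<open>combination_bound\<close>, with the window sent to
  infinity. The bound does not depend on the starting point p, as chaining requires.\<close>

lemma partial_sum_bound:
  "expectation (\<lambda>\<omega>. (\<Sum>k=p+1..p+n. X (int k) \<omega>)\<^sup>2) \<le> covsum (corr bound bound) n n"
proof -
  let ?K = "{p+1..p+n}"
  have "(\<lambda>N. expectation (\<lambda>\<omega>. (\<Sum>k\<in>?K. 1 * XW (p+n) N (int k) \<omega>) * (\<Sum>k\<in>?K. 1 * XW (p+n) N (int k) \<omega>)))
     \<longlonglongrightarrow> expectation (\<lambda>\<omega>. (\<Sum>k\<in>?K. 1 * X (int k) \<omega>) * (\<Sum>k\<in>?K. 1 * X (int k) \<omega>))"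
    by (intro L2_inner_tendsto combination_square combination_tendsto) auto
  moreover have "expectation (\<lambda>\<omega>. (\<Sum>k\<in>?K. 1 * XW (p+n) N (int k) \<omega>) * (\<Sum>k\<in>?K. 1 * XW (p+n) N (int k) \<omega>))
      \<le> 1\<^sup>2 * covsum (corr bound bound) n n" for N
    unfolding XW_def power2_eq_square[symmetric, of "sum _ _"]
    by (rule combination_bound) (auto intro: predictable_G bound_nonneg summable_squares G_second_moment')
  ultimately have "expectation (\<lambda>\<omega>. (\<Sum>k\<in>?K. 1 * X (int k) \<omega>) * (\<Sum>k\<in>?K. 1 * X (int k) \<omega>))
      \<le> 1\<^sup>2 * covsum (corr bound bound) n n"
    by (intro LIMSEQ_le_const2) auto
  then show ?thesis by (simp add: power2_eq_square)
qed

lemma lagged_sum_tendsto_abs: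
  assumes "k \<le> T" "l \<le> T"
  shows "(\<lambda>N. \<Sum>s\<in>{- int N..int T}. lagged b (int k) s * lagged b (int l) s) \<longlonglongrightarrow> corr b b (nat \<bar>int k - int l\<bar>)"
proof (cases "k \<le> l")
  case True
  then have "nat \<bar>int k - int l\<bar> = nat (int l - int k)" by simp
  then show ?thesis
    using lagged_sum_tendsto[of "int k" "int l" "int T" b b] summable_corr[OF summable_squares(1,1)] assms True by simp
next
  case False
  then have e: "nat \<bar>int k - int l\<bar> = nat (int k - int l)" by simp
  have "(\<lambda>N. \<Sum>s\<in>{- int N..int T}. lagged b (int l) s * lagged b (int k) s) \<longlonglongrightarrow> corr b b (nat (int k - int l))"
    by (rule lagged_sum_tendsto) (use assms False summable_corr[OF summable_squares(1,1)] in auto)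
  then show ?thesis unfolding e by (simp add: mult.commute)
qed

text \<open>Cauchy-Schwarz against the square summable kernel \<open>b\<close>. With A of order
  n^(-1/2-d) the bound is of order n^(-d), so no single innovation matters in the limit.\<close>

lemma linear_coefficient_bound:
  assumes a: "\<And>k. \<bar>a k\<bar> \<le> A"
  shows "\<bar>\<Sum>k=1..n. a k * lagged b (int k) s\<bar> \<le> A * sqrt (real n * (\<Sum>k. (b k)\<^sup>2))"
proof -
  have A: "A \<ge> 0" using a[of 0] by linarith
  have "(\<Sum>k=1..n. a k * lagged b (int k) s)\<^sup>2 \<le> (\<Sum>k=1..n. (a k)\<^sup>2) * (\<Sum>k=1..n. (lagged b (int k) s)\<^sup>2)"
    by (rule Cauchy_Schwarz_ineq_sum)
  also have "\<dots> \<le> (\<Sum>k=1..n. A\<^sup>2) * (\<Sum>k. (b k)\<^sup>2)"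
  proof (rule mult_mono)
    show "(\<Sum>k=1..n. (a k)\<^sup>2) \<le> (\<Sum>k=1..n. A\<^sup>2)" using a A
        by (intro sum_mono) (simp add: abs_le_square_iff[symmetric])
    have "(\<Sum>k=1..n. (lagged b (int k) s)\<^sup>2) = (\<Sum>k\<in>{1..n} \<inter> {k. s \<le> int k}. (lagged b (int k) s)\<^sup>2)"
      by (rule sum.mono_neutral_right) (auto simp: lagged_def)
    also have "\<dots> = (\<Sum>j\<in>(\<lambda>k. nat (int k - s)) ` ({1..n} \<inter> {k. s \<le> int k}). (b j)\<^sup>2)"
      by (subst sum.reindex) (auto simp: inj_on_def lagged_def)
    also have "\<dots> \<le> (\<Sum>k. (b k)\<^sup>2)" by (rule sum_le_suminf[OF summable_squares(1)]) auto
    finally show "(\<Sum>k=1..n. (lagged b (int k) s)\<^sup>2) \<le> (\<Sum>k. (b k)\<^sup>2)" .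
  qed (auto intro!: sum_nonneg)
  also have "\<dots> = A\<^sup>2 * (real n * (\<Sum>k. (b k)\<^sup>2))" by simp
  finally have "\<bar>\<Sum>k=1..n. a k * lagged b (int k) s\<bar> \<le> sqrt (A\<^sup>2 * (real n * (\<Sum>k. (b k)\<^sup>2)))"
    by (intro real_le_rsqrt) simp
  then show ?thesis using A by (simp add: real_sqrt_mult)
qed

text \<open>Three replacements: X by its windowed version, the random coefficients by
  \<open>b\<close>, and the resulting linear form by a Gaussian variable. The first error and the
  change of variance vanish as the window grows with n fixed; the other two errors form the stated
  bound.\<close>

lemma char_combination:
  fixes a :: "nat \<Rightarrow> real" and n :: nat and A :: real
  assumes a: "\<And>k. \<bar>a k\<bar> \<le> A"
  defines "m \<equiv> A * sqrt (real n * (\<Sum>k. (b k)\<^sup>2))"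
    and "\<sigma>2 \<equiv> \<Sum>k=1..n. \<Sum>l=1..n. a k * a l * corr b b (nat \<bar>int k - int l\<bar>)"
  shows "cmod ((CLINT \<omega>|M. iexp (\<Sum>k=1..n. a k * X (int k) \<omega>)) - of_real (exp (- (\<sigma>2 / 2))))
    \<le> sqrt (A\<^sup>2 * covsum (corr eps eps) n n) + \<sigma>2 * (psi m + m\<^sup>2 / 8)"
proof -
  define I where "I N = {- int N..int n}" for N
  define c where "c s = (\<Sum>k=1..n. a k * lagged b (int k) s)" for s
  define S where "S N = (\<Sum>s\<in>I N. (c s)\<^sup>2)" for N
  define W where "W \<omega> = (\<Sum>k=1..n. a k * X (int k) \<omega>)" for \<omega>
  define V where "V N \<omega> = (\<Sum>k=1..n. a k * XW n N (int k) \<omega>)" for N \<omega>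
  define Y where "Y N \<omega> = (\<Sum>s\<in>I N. c s * \<zeta> s \<omega>)" for N \<omega>
  define D where "D N = expectation (\<lambda>\<omega>. (W \<omega> - V N \<omega>)\<^sup>2)" for N
  note sq = combination_square(1,2)[where a = a and K = "{1..n}"] combination_square(3,4)[where a = a
      and K = "{1..n}" and T = n]
  have [measurable]: "W \<in> borel_measurable M" "V N \<in> borel_measurable M" "Y N \<in> borel_measurable M" for N
    using sq(1,3) by (auto simp: W_def[abs_def] V_def[abs_def] Y_def[abs_def])
  have sqW: "integrable M (\<lambda>\<omega>. (W \<omega>)\<^sup>2)" and sqV: "integrable M (\<lambda>\<omega>. (V N \<omega>)\<^sup>2)" for N
    using sq(2,4) by (auto simp: W_def V_def)
  have YV: "V N \<omega> - Y N \<omega> = (\<Sum>k=0+1..0+n. a k * (\<Sum>s\<in>I N. \<zeta> s \<omega> * R (int k) s \<omega>))" for N \<omega>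
  proof -
    have "Y N \<omega> = (\<Sum>k=1..n. a k * (\<Sum>s\<in>I N. \<zeta> s \<omega> * lagged b (int k) s))"
      unfolding Y_def c_def sum_distrib_left sum_distrib_right by (subst sum.swap) (simp add: mult_ac)
    then show ?thesis
      unfolding V_def XW_def I_def[symmetric] R_def
      by (simp add: sum_subtractf right_diff_distrib)
  qed
  have sqVY: "integrable M (\<lambda>\<omega>. (V N \<omega> - Y N \<omega>)\<^sup>2)" for N
    unfolding YV
    by (intro integrable_square_sum borel_measurable_times borel_measurable_const)
       (auto simp: power_mult_distrib I_def intro!: square_integrable_sum_predictable[OF predictable_R])
  have b1: "expectation (\<lambda>\<omega>. \<bar>V N \<omega> - Y N \<omega>\<bar>) \<le> sqrt (A\<^sup>2 * covsum (corr eps eps) n n)" for N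
  proof -
    have "expectation (\<lambda>\<omega>. \<bar>V N \<omega> - Y N \<omega>\<bar>) \<le> sqrt (expectation (\<lambda>\<omega>. (V N \<omega> - Y N \<omega>)\<^sup>2))"
      by (rule expectation_abs_le_sqrt(2)) (use sqVY in auto)
    also have "\<dots> \<le> sqrt (A\<^sup>2 * covsum (corr eps eps) n n)"
      unfolding YV
      by (intro real_sqrt_le_mono combination_bound a eps_nonneg summable_eps R_second_moment predictable_R) (simp add: I_def)
    finally show ?thesis .
  qed
  have b2: "expectation (\<lambda>\<omega>. \<bar>W \<omega> - V N \<omega>\<bar>) \<le> sqrt (D N)" for N
    unfolding D_def by (intro expectation_abs_le_sqrt(2) integrable_square_diff sqW sqV) auto
  have cd: "cmod ((CLINT \<omega>|M. iexp (f \<omega>)) - (CLINT \<omega>|M. iexp (g \<omega>))) \<le> expectation (\<lambda>\<omega>. \<bar>f \<omega> - g \<omega>\<bar>)"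
    if [measurable]: "f \<in> borel_measurable M" "g \<in> borel_measurable M"
        and fg: "integrable M (\<lambda>\<omega>. (f \<omega> - g \<omega>)\<^sup>2)" for f g
  proof -
    have i: "integrable M (\<lambda>\<omega>. iexp (f \<omega>))" "integrable M (\<lambda>\<omega>. iexp (g \<omega>))"
      by (rule integrable_iexp; simp)+
    have "cmod ((CLINT \<omega>|M. iexp (f \<omega>)) - (CLINT \<omega>|M. iexp (g \<omega>))) = cmod (CLINT \<omega>|M. iexp (f \<omega>) - iexp (g \<omega>))"
      using i by simp
    also have "\<dots> \<le> expectation (\<lambda>\<omega>. cmod (iexp (f \<omega>) - iexp (g \<omega>)))" by (rule integral_norm_bound)
    also have "\<dots> \<le> expectation (\<lambda>\<omega>. \<bar>f \<omega> - g \<omega>\<bar>)"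
      by (intro integral_mono integrable_norm Bochner_Integration.integrable_diff i integrable_abs
          expectation_abs_le_sqrt(1)[OF _ fg] iexp_diff_le) measurable
    finally show ?thesis .
  qed
  have cm: "\<bar>c s\<bar> \<le> m" for s
    unfolding c_def m_def by (rule linear_coefficient_bound[OF a])
  have main: "cmod ((CLINT \<omega>|M. iexp (W \<omega>)) - of_real (exp (- (\<sigma>2 / 2))))
    \<le> sqrt (D N) + sqrt (A\<^sup>2 * covsum (corr eps eps) n n) + S N * (psi m + m\<^sup>2 / 8) + \<bar>exp (- (S N / 2))
        - exp (- (\<sigma>2 / 2))\<bar>" for N
  proof -
    let ?A = "CLINT \<omega>|M. iexp (W \<omega>)" and ?B = "CLINT \<omega>|M. iexp (V N \<omega>)" and ?C = "CLINT \<omega>|M. iexp (Y N \<omega>)"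
    let ?E = "complex_of_real (exp (- (S N / 2)))" and ?F = "complex_of_real (exp (- (\<sigma>2 / 2)))"
    have tri: "cmod (x + y + z + w) \<le> cmod x + cmod y + cmod z + cmod w" for x y z w
      using norm_triangle_ineq[of "x + y + z" w] norm_triangle_ineq[of "x + y" z] norm_triangle_ineq[of x y]
          by linarith
    have "cmod (?A - ?F) \<le> cmod (?A - ?B) + cmod (?B - ?C) + cmod (?C - ?E) + cmod (?E - ?F)"
      using tri[of "?A - ?B" "?B - ?C" "?C - ?E" "?E - ?F"] by simp
    moreover have "cmod (?A - ?B) \<le> sqrt (D N)"
      by (rule order_trans[OF cd b2]) (auto intro!: integrable_square_diff sqW sqV)
    moreover have "cmod (?B - ?C) \<le> sqrt (A\<^sup>2 * covsum (corr eps eps) n n)"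
      by (rule order_trans[OF cd b1]) (auto intro!: sqVY)
    moreover have "cmod (?C - ?E) \<le> S N * (psi m + m\<^sup>2 / 8)"
      unfolding Y_def S_def by (rule char_linear_form) (auto simp: I_def cm)
    moreover have "cmod (?E - ?F) = \<bar>exp (- (S N / 2)) - exp (- (\<sigma>2 / 2))\<bar>"
      unfolding of_real_diff[symmetric] by (rule norm_of_real)
    ultimately show ?thesis by linarith
  qed
  have Slim: "S \<longlonglongrightarrow> \<sigma>2"
  proof -
    have "S N = (\<Sum>k=1..n. \<Sum>l=1..n. a k * a l * (\<Sum>s\<in>I N. lagged b (int k) s * lagged b (int l) s))" for N
    proof -
      let ?f = "\<lambda>s k l. a k * a l * (lagged b (int k) s * lagged b (int l) s)"
      have "S N = (\<Sum>s\<in>I N. \<Sum>k=1..n. \<Sum>l=1..n. ?f s k l)"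
        by (simp add: S_def c_def power2_eq_square sum_product mult_ac)
      also have "\<dots> = (\<Sum>k=1..n. \<Sum>s\<in>I N. \<Sum>l=1..n. ?f s k l)" by (rule sum.swap)
      also have "\<dots> = (\<Sum>k=1..n. \<Sum>l=1..n. \<Sum>s\<in>I N. ?f s k l)" by (intro sum.cong refl sum.swap)
      finally show ?thesis by (simp only: sum_distrib_left)
    qed
    moreover have "(\<lambda>N. \<Sum>k=1..n. \<Sum>l=1..n. a k * a l * (\<Sum>s\<in>I N. lagged b (int k) s * lagged b (int l) s)) \<longlonglongrightarrow> \<sigma>2"
      unfolding \<sigma>2_def I_def by (intro tendsto_sum tendsto_mult tendsto_const lagged_sum_tendsto_abs) auto
    ultimately show ?thesis by (simp add: S_def[abs_def])
  qed
  have Dlim: "D \<longlonglongrightarrow> 0"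
    unfolding D_def W_def V_def by (rule combination_tendsto) auto
  have "(\<lambda>N. sqrt (D N) + sqrt (A\<^sup>2 * covsum (corr eps eps) n n) + S N * (psi m + m\<^sup>2 / 8)
      + \<bar>exp (- (S N / 2)) - exp (- (\<sigma>2 / 2))\<bar>)
    \<longlonglongrightarrow> sqrt 0 + sqrt (A\<^sup>2 * covsum (corr eps eps) n n) + \<sigma>2 * (psi m + m\<^sup>2 / 8) + \<bar>exp (- (\<sigma>2 / 2))
        - exp (- (\<sigma>2 / 2))\<bar>"
    by (intro tendsto_intros Slim Dlim) auto
  then have "cmod ((CLINT \<omega>|M. iexp (W \<omega>)) - of_real (exp (- (\<sigma>2 / 2))))
    \<le> sqrt 0 + sqrt (A\<^sup>2 * covsum (corr eps eps) n n) + \<sigma>2 * (psi m + m\<^sup>2 / 8) + \<bar>exp (- (\<sigma>2 / 2))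
        - exp (- (\<sigma>2 / 2))\<bar>"
    by (rule LIMSEQ_le_const) (use main in auto)
  then show ?thesis by (simp add: W_def)
qed

end

section \<open>The Skorohod space\<close>

text \<open>At t = 1 the value is v m, so m + 1 values are used. Both the rescaled partial sum
  process (with m = n) and its discretization on a coarser grid have this form.\<close>

definition step_path :: "nat \<Rightarrow> (nat \<Rightarrow> real) \<Rightarrow> real \<Rightarrow> real" where
  "step_path m v = (\<lambda>t\<in>{0..1}. v (nat \<lfloor>real m * t\<rfloor>))"

lemma step_path_D01: "step_path m v \<in> D01"
proof -
  have right: "(step_path m v \<longlongrightarrow> step_path m v t) (at_right t)" if t: "t \<in> {0..<1}" for t
  proof (rule tendsto_eventually)
    have "((\<lambda>s. real m * s) \<longlongrightarrow> real m * t) (at_right t)" by (intro tendsto_intros)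
    moreover have "real m * t < real_of_int (\<lfloor>real m * t\<rfloor> + 1)" by linarith
    ultimately have "\<forall>\<^sub>F s in at_right t. real m * s < real_of_int (\<lfloor>real m * t\<rfloor> + 1)"
      by (rule order_tendstoD(2))
    moreover have "\<forall>\<^sub>F s in at_right t. s \<in> {t<..<1}"
      using t by (intro eventually_at_right_real) auto
    ultimately show "\<forall>\<^sub>F s in at_right t. step_path m v s = step_path m v t"
    proof eventually_elim
      case (elim s)
      then have "real m * t \<le> real m * s" by (intro mult_left_mono) auto
      then have "\<lfloor>real m * s\<rfloor> = \<lfloor>real m * t\<rfloor>" using elim by linarith
      then show ?case using elim t by (simp add: step_path_def)
    qed
  qed
  have left: "\<exists>l. (step_path m v \<longlongrightarrow> l) (at_left t)" if t: "t \<in> {0<..1}" for t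
  \<comment> \<open>The case m = 0 occurs, since weak convergence demands measurability for every n
    including 0; the path is then constant.\<close>
  proof (cases "m = 0")
    case True
    have "\<forall>\<^sub>F s in at_left t. s \<in> {0<..<t}" using t by (intro eventually_at_left_real) auto
    then have "\<forall>\<^sub>F s in at_left t. step_path m v s = v 0"
      by eventually_elim (use t True in \<open>auto simp: step_path_def\<close>)
    then show ?thesis by (blast intro: tendsto_eventually)
  next
    case False
    have "((\<lambda>s. real m * s) \<longlongrightarrow> real m * t) (at_left t)" by (intro tendsto_intros)
    moreover have "real_of_int (\<lceil>real m * t\<rceil> - 1) < real m * t" by linarith
    ultimately have "\<forall>\<^sub>F s in at_left t. real_of_int (\<lceil>real m * t\<rceil> - 1) < real m * s"
      by (rule order_tendstoD(1))
    moreover have "\<forall>\<^sub>F s in at_left t. s \<in> {0<..<t}"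
      using t by (intro eventually_at_left_real) auto
    \<comment> \<open>Just left of t the floor is constantly the largest integer strictly below m
      t.\<close>
    ultimately have "\<forall>\<^sub>F s in at_left t. step_path m v s = v (nat (\<lceil>real m * t\<rceil> - 1))"
    proof eventually_elim
      case (elim s)
      then have "real m * s < real m * t" using False by (intro mult_strict_left_mono) auto
      then have "\<lfloor>real m * s\<rfloor> = \<lceil>real m * t\<rceil> - 1" using elim by linarith
      then show ?case using elim t by (simp add: step_path_def)
    qed
    then show ?thesis by (blast intro: tendsto_eventually)
  qed
  show ?thesis using right left unfolding D01_def by (auto simp: step_path_def)
qed

lemma continuous_path_D01:
  assumes f: "continuous_on {0..1} f"
  shows "restrict f {0..1} \<in> D01"
proof -
  have right: "(restrict f {0..1} \<longlongrightarrow> restrict f {0..1} t) (at_right t)" if t: "t \<in> {0..<1}" for t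
  proof -
    have "(f \<longlongrightarrow> f t) (at t within {0..1})" using f t by (auto simp: continuous_on_def)
    then have "(f \<longlongrightarrow> f t) (at t within {t..1})" by (rule tendsto_within_subset) (use t in auto)
    then have "(f \<longlongrightarrow> f t) (at_right t)" using t at_within_Icc_at_right[of t 1] by simp
    moreover have "\<forall>\<^sub>F s in at_right t. s \<in> {t<..<1}" using t by (intro eventually_at_right_real) auto
    then have "\<forall>\<^sub>F s in at_right t. f s = restrict f {0..1} s" by eventually_elim (use t in auto)
    ultimately show ?thesis using t by (auto intro: Lim_transform_eventually)
  qed
  have left: "(restrict f {0..1} \<longlongrightarrow> f t) (at_left t)" if t: "t \<in> {0<..1}" for t
  proof -
    have "(f \<longlongrightarrow> f t) (at t within {0..1})" using f t by (auto simp: continuous_on_def)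
    then have "(f \<longlongrightarrow> f t) (at t within {0..t})" by (rule tendsto_within_subset) (use t in auto)
    then have "(f \<longlongrightarrow> f t) (at_left t)" using t at_within_Icc_at_left[of 0 t] by simp
    moreover have "\<forall>\<^sub>F s in at_left t. s \<in> {0<..<t}" using t by (intro eventually_at_left_real) auto
    then have "\<forall>\<^sub>F s in at_left t. f s = restrict f {0..1} s" by eventually_elim (use t in auto)
    ultimately show ?thesis by (rule Lim_transform_eventually)
  qed
  show ?thesis using right left unfolding D01_def by blast
qed

text \<open>The identity is an admissible time change. The extra r is there because members of
  \<open>skorohod_set\<close> are strictly positive whereas e may be 0.\<close>

lemma skorohod_dist_le_sup:
  assumes "x \<in> D01" "y \<in> D01" "0 \<le> e" "\<And>t. t \<in> {0..1} \<Longrightarrow> \<bar>x t - y t\<bar> \<le> e"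
  shows "skorohod_dist x y \<le> e"
proof (rule field_le_epsilon)
  fix r :: real assume "0 < r"
  then have "e + r \<in> skorohod_set x y"
    using assms(3,4) unfolding skorohod_set_def
    by (auto simp: time_changes_def strict_mono_on_def intro!: exI[of _ "\<lambda>t. t"] add_increasing2)
  then show "skorohod_dist x y \<le> e + r"
    using assms(1,2) skorohod_set_bdd_below by (auto simp: skorohod_dist_def intro: cInf_lower)
qed

lemma openin_skorohod:
  "openin skorohod_topology U \<longleftrightarrow> U \<subseteq> D01 \<and> (\<forall>x\<in>U. \<exists>r>0. \<forall>y\<in>D01. skorohod_dist x y < r \<longrightarrow> y \<in> U)"
proof -
  have "skorohod.mball x r \<subseteq> U \<longleftrightarrow> (\<forall>y\<in>D01. skorohod_dist x y < r \<longrightarrow> y \<in> U)" if "x \<in> D01" for x r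
    unfolding subset_eq Ball_def skorohod.in_mball using that by blast
  then show ?thesis
    unfolding skorohod_topology_def skorohod.openin_mtopology by (metis subsetD)
qed

lemma topspace_skorohod[simp]: "topspace skorohod_topology = D01"
  by (simp add: skorohod_topology_def)

lemma space_skorohod_borel[simp]: "space skorohod_borel = D01"
  unfolding skorohod_borel_def by (rule space_measure_of) (auto simp: openin_skorohod)

lemma sets_skorohod_borel: "sets skorohod_borel = sigma_sets D01 {U. openin skorohod_topology U}"
  unfolding skorohod_borel_def by (rule sets_measure_of) (auto simp: openin_skorohod)

lemma measurable_skorohodI:
  assumes "\<And>\<omega>. \<omega> \<in> space M \<Longrightarrow> F \<omega> \<in> D01"
    and "\<And>U. openin skorohod_topology U \<Longrightarrow> F -` U \<inter> space M \<in> sets M"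
  shows "F \<in> measurable M skorohod_borel"
  unfolding skorohod_borel_def
  by (rule measurable_measure_of) (use assms in \<open>auto simp: openin_skorohod\<close>)

lemma continuous_map_skorohod_measurable:
  assumes "continuous_map skorohod_topology euclideanreal f"
  shows "f \<in> borel_measurable skorohod_borel"
proof (rule borel_measurableI)
  fix S :: "real set" assume "open S"
  then have "openin skorohod_topology {x \<in> D01. f x \<in> S}"
    using assms by (auto simp: continuous_map_def)
  moreover have "f -` S \<inter> space skorohod_borel = {x \<in> D01. f x \<in> S}" by auto
  ultimately show "f -` S \<inter> space skorohod_borel \<in> sets skorohod_borel"
    by (auto simp: sets_skorohod_borel intro: sigma_sets.Basic)
qed

lemma Lipschitz_continuous_map_skorohod:
  fixes f :: "(real \<Rightarrow> real) \<Rightarrow> real"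
  assumes L: "\<And>x y. x \<in> D01 \<Longrightarrow> y \<in> D01 \<Longrightarrow> \<bar>f x - f y\<bar> \<le> L * skorohod_dist x y"
  shows "continuous_map skorohod_topology euclideanreal f"
  unfolding continuous_map_def
proof (intro conjI allI impI)
  fix S :: "real set" assume "openin euclideanreal S"
  then have S: "open S" by simp
  show "openin skorohod_topology {x \<in> topspace skorohod_topology. f x \<in> S}"
    unfolding openin_skorohod
  proof (intro conjI ballI)
    fix x assume x: "x \<in> {x \<in> topspace skorohod_topology. f x \<in> S}"
    then obtain e where e: "e > 0" "\<And>z. \<bar>z - f x\<bar> < e \<Longrightarrow> z \<in> S"
      using S by (auto simp: open_dist dist_real_def)
    show "\<exists>r>0. \<forall>y\<in>D01. skorohod_dist x y < r \<longrightarrow> y \<in> {x \<in> topspace skorohod_topology. f x \<in> S}"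
    proof (intro exI[of _ "e / (\<bar>L\<bar> + 1)"] conjI ballI impI)
      show "e / (\<bar>L\<bar> + 1) > 0" using e by (intro divide_pos_pos) auto
      fix y assume y: "y \<in> D01" "skorohod_dist x y < e / (\<bar>L\<bar> + 1)"
      have "\<bar>f y - f x\<bar> \<le> L * skorohod_dist y x" using L[of y x] x y by simp
      also have "\<dots> \<le> (\<bar>L\<bar> + 1) * skorohod_dist x y"
        unfolding skorohod_dist_commute[of y x] by (intro mult_right_mono) auto
      also have "\<dots> < e" using y(2) by (simp add: pos_less_divide_eq mult.commute)
      finally show "y \<in> {x \<in> topspace skorohod_topology. f x \<in> S}" using e y by simp
    qed
  qed auto
qed auto

text \<open>A step path depends on the coordinates up to m only and is 1-Lipschitz in their maximal
  difference. Measurability with respect to the Skorohod Borel sets thereby reduces to measurability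
  of coordinates.\<close>

lemma open_step_path_vimage:
  assumes U: "openin skorohod_topology U"
  shows "open {v. step_path m v \<in> U}"
proof (subst open_subopen, intro ballI)
  fix v assume "v \<in> {v. step_path m v \<in> U}"
  then obtain r where r: "r > 0" "\<And>y. y \<in> D01 \<Longrightarrow> skorohod_dist (step_path m v) y < r \<Longrightarrow> y \<in> U"
    using U unfolding openin_skorohod by auto
  let ?T = "\<Inter>i\<in>{..m}. (\<lambda>w. w i) -` {v i - r / 2<..<v i + r / 2}"
  have "open ?T"
    by (intro open_INT finite_atMost ballI open_vimage open_greaterThanLessThan continuous_on_product_coordinates)
  moreover have "v \<in> ?T" using r by auto
  moreover have "?T \<subseteq> {v. step_path m v \<in> U}"
  proof safe
    fix w assume w: "w \<in> ?T"
    have "skorohod_dist (step_path m v) (step_path m w) \<le> r / 2"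
    proof (rule skorohod_dist_le_sup[OF step_path_D01 step_path_D01])
      fix t :: real assume t: "t \<in> {0..1}"
      then have "real m * t \<le> real m" by (simp add: mult_left_le)
      then have "nat \<lfloor>real m * t\<rfloor> \<in> {..m}" by simp linarith
      with w have "w (nat \<lfloor>real m * t\<rfloor>) \<in> {v (nat \<lfloor>real m * t\<rfloor>) - r / 2<..<v (nat \<lfloor>real m * t\<rfloor>) + r / 2}"
          by blast
      then have "\<bar>v (nat \<lfloor>real m * t\<rfloor>) - w (nat \<lfloor>real m * t\<rfloor>)\<bar> \<le> r / 2"
        unfolding greaterThanLessThan_iff by linarith
      then show "\<bar>step_path m v t - step_path m w t\<bar> \<le> r / 2" using t by (simp add: step_path_def)
    qed (use r in simp)
    then show "step_path m w \<in> U" using r by (intro r(2) step_path_D01) auto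
  qed
  ultimately show "\<exists>T. open T \<and> v \<in> T \<and> T \<subseteq> {v. step_path m v \<in> U}" by blast
qed

lemma measurable_step_path:
  assumes "\<And>i. (\<lambda>\<omega>. V \<omega> i) \<in> borel_measurable M"
  shows "(\<lambda>\<omega>. step_path m (V \<omega>)) \<in> measurable M skorohod_borel"
proof (rule measurable_skorohodI)
  have V: "V \<in> borel_measurable M" using assms by (rule measurable_coordinatewise_then_product)
  fix U assume "openin skorohod_topology U"
  then have "{v. step_path m v \<in> U} \<in> sets borel" by (intro borel_open open_step_path_vimage)
  from measurable_sets[OF V this] show "(\<lambda>\<omega>. step_path m (V \<omega>)) -` U \<inter> space M \<in> sets M"
    by (simp add: vimage_def)
qed (rule step_path_D01)

lemma continuous_step_path:
  assumes f: "continuous_map skorohod_topology euclideanreal f"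
  shows "continuous_on UNIV (\<lambda>v. f (step_path m v))"
proof (subst continuous_on_open_vimage[OF open_UNIV], intro allI impI)
  fix S :: "real set" assume "open S"
  then have "openin skorohod_topology {x \<in> D01. f x \<in> S}"
    using f by (auto simp: continuous_map_def)
  from open_step_path_vimage[OF this, of m] show "open ((\<lambda>v. f (step_path m v)) -` S \<inter> UNIV)"
    by (simp add: step_path_D01 vimage_def)
qed

text \<open>For bounded f and k \<ge> 0 this is the largest minorant of f that is k-Lipschitz in the
  Skorohod distance.\<close>

definition lip_env :: "((real \<Rightarrow> real) \<Rightarrow> real) \<Rightarrow> real \<Rightarrow> (real \<Rightarrow> real) \<Rightarrow> real" where
  "lip_env f k x = (INF y\<in>D01. f y + k * skorohod_dist x y)"

context
  fixes f :: "(real \<Rightarrow> real) \<Rightarrow> real" and B k :: real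
  assumes f_bound: "\<And>x. x \<in> D01 \<Longrightarrow> \<bar>f x\<bar> \<le> B" and k: "k \<ge> 0"
begin

lemma lip_env_bdd: "bdd_below ((\<lambda>y. f y + k * skorohod_dist x y) ` D01)"
  using f_bound k by (intro bdd_belowI2[of _ "- B"]) (force intro: add_increasing2)

lemma lip_env_le: "x \<in> D01 \<Longrightarrow> y \<in> D01 \<Longrightarrow> lip_env f k x \<le> f y + k * skorohod_dist x y"
  unfolding lip_env_def by (intro cINF_lower lip_env_bdd)

lemma lip_env_ge:
  assumes "\<And>y. y \<in> D01 \<Longrightarrow> c \<le> f y + k * skorohod_dist x y"
  shows "c \<le> lip_env f k x"
  unfolding lip_env_def by (rule cINF_greatest) (use assms step_path_D01 in blast)+

lemma lip_env_le_self: "x \<in> D01 \<Longrightarrow> lip_env f k x \<le> f x"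
  using lip_env_le[of x x] by simp

lemma lip_env_bound: "x \<in> D01 \<Longrightarrow> \<bar>lip_env f k x\<bar> \<le> B"
proof -
  assume x: "x \<in> D01"
  have "- B \<le> lip_env f k x" by (rule lip_env_ge) (use f_bound k in \<open>force intro: add_increasing2\<close>)
  then show ?thesis using lip_env_le_self[OF x] f_bound[OF x] by auto
qed

lemma lip_env_Lipschitz:
  assumes x: "x \<in> D01" "z \<in> D01"
  shows "\<bar>lip_env f k x - lip_env f k z\<bar> \<le> k * skorohod_dist x z"
proof -
  have *: "lip_env f k x \<le> lip_env f k z + k * skorohod_dist x z" if x: "x \<in> D01" "z \<in> D01" for x z
  proof -
    have "lip_env f k x - k * skorohod_dist x z \<le> lip_env f k z"
    proof (rule lip_env_ge)
      fix y assume y: "y \<in> D01"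
      have "lip_env f k x \<le> f y + k * skorohod_dist x y" using lip_env_le x y by blast
      also have "k * skorohod_dist x y \<le> k * (skorohod_dist x z + skorohod_dist z y)"
        using k x y by (intro mult_left_mono skorohod.triangle) auto
      finally show "lip_env f k x - k * skorohod_dist x z \<le> f y + k * skorohod_dist z y"
        by (simp add: distrib_left)
    qed
    then show ?thesis by simp
  qed
  show ?thesis using *[OF x] *[OF x(2,1)] skorohod_dist_commute[of x z] by (simp add: abs_le_iff)
qed

end

lemma lip_env_tendsto:
  assumes f: "continuous_map skorohod_topology euclideanreal f"
    and B: "\<And>x. x \<in> D01 \<Longrightarrow> \<bar>f x\<bar> \<le> B" and x: "x \<in> D01"
  shows "(\<lambda>n. lip_env f (real n) x) \<longlonglongrightarrow> f x"
proof (rule LIMSEQ_I)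
  fix e :: real assume e: "e > 0"
  have "openin skorohod_topology {y \<in> D01. f y \<in> {f x - e / 2<..}}"
    using openin_continuous_map_preimage[OF f, of "{f x - e / 2<..}"] by simp
  then obtain r where r: "r > 0" "\<And>y. y \<in> D01 \<Longrightarrow> skorohod_dist x y < r \<Longrightarrow> f x - e / 2 < f y"
    using x e unfolding openin_skorohod by fastforce
  \<comment> \<open>From distance r on, the penalty is at least 2 B, so points far from x cannot
    pull the infimum below f x; for the near ones continuity of f decides.\<close>
  obtain n0 :: nat where n0: "2 * B / r \<le> real n0" using real_arch_simple by blast
  have "norm (lip_env f (real n) x - f x) < e" if n: "n \<ge> n0" for n
  proof -
    have "f x - e / 2 \<le> lip_env f (real n) x"
    proof (rule lip_env_ge[OF B])
      fix y assume y: "y \<in> D01"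
      show "f x - e / 2 \<le> f y + real n * skorohod_dist x y"
      proof (cases "skorohod_dist x y < r")
        case True
        then show ?thesis using r(2)[OF y] by (smt (verit) mult_nonneg_nonneg of_nat_0_le_iff skorohod.nonneg)
      next
        case False
        have "2 * B \<le> real n0 * r" using n0 r by (simp add: pos_divide_le_eq)
        also have "\<dots> \<le> real n * skorohod_dist x y" using n False r by (intro mult_mono) auto
        finally show ?thesis using B[OF x] B[OF y] e by auto
      qed
    qed auto
    moreover have "lip_env f (real n) x \<le> f x" by (rule lip_env_le_self[OF B _ x]) auto
    ultimately show ?thesis using e by auto
  qed
  then show "\<exists>no. \<forall>n\<ge>no. norm (lip_env f (real n) x - f x) < e" by blast
qed

text \<open>The envelope h of the indicator of U is Lipschitz and positive exactly on U.
  Measurability of h along the sequence passes to the pointwise limit and yields the preimage of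
  U.\<close>

lemma measurable_skorohod_limit:
  assumes F: "\<And>n. F n \<in> measurable M skorohod_borel"
    and G: "\<And>\<omega>. \<omega> \<in> space M \<Longrightarrow> G \<omega> \<in> D01"
    and lim: "\<And>\<omega>. \<omega> \<in> space M \<Longrightarrow> (\<lambda>n. skorohod_dist (F n \<omega>) (G \<omega>)) \<longlonglongrightarrow> 0"
  shows "G \<in> measurable M skorohod_borel"
proof (rule measurable_skorohodI[OF G])
  fix U assume U: "openin skorohod_topology U"
  define f where "f y = (if y \<in> U then 1 else 0::real)" for y
  have B: "\<bar>f x\<bar> \<le> 1" for x by (simp add: f_def)
  define h where "h = lip_env f 1"
  have hL: "\<bar>h x - h y\<bar> \<le> 1 * skorohod_dist x y" if "x \<in> D01" "y \<in> D01" for x y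
    unfolding h_def by (rule lip_env_Lipschitz) (use B that in auto)
  have hU: "h x > 0 \<longleftrightarrow> x \<in> U" if x: "x \<in> D01" for x
  proof
    assume "h x > 0"
    moreover have "h x \<le> f x" unfolding h_def by (rule lip_env_le_self) (use B x in auto)
    ultimately show "x \<in> U" by (auto simp: f_def split: if_splits)
  next
    assume "x \<in> U"
    then obtain r where r: "r > 0" "\<And>y. y \<in> D01 \<Longrightarrow> skorohod_dist x y < r \<Longrightarrow> y \<in> U"
      using U unfolding openin_skorohod by auto
    have "min 1 r \<le> h x" unfolding h_def
    proof (rule lip_env_ge[where B = 1])
      fix y assume y: "y \<in> D01"
      show "min 1 r \<le> f y + 1 * skorohod_dist x y"
      proof (cases "skorohod_dist x y < r")
        case True
        then have "f y = 1" using r(2)[OF y] by (simp add: f_def)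
        then show ?thesis using skorohod.nonneg[of x y] by linarith
      next
        case False
        moreover have "f y \<ge> 0" by (simp add: f_def)
        ultimately show ?thesis by linarith
      qed
    qed (use B in auto)
    then show "h x > 0" using r by auto
  qed
  have hF: "(\<lambda>\<omega>. h (F n \<omega>)) \<in> borel_measurable M" for n
    using measurable_compose[OF F continuous_map_skorohod_measurable[OF Lipschitz_continuous_map_skorohod[OF hL]]] .
  have "(\<lambda>\<omega>. h (G \<omega>)) \<in> borel_measurable M"
  proof (rule borel_measurable_LIMSEQ_real[OF _ hF])
    fix \<omega> assume \<omega>: "\<omega> \<in> space M"
    have FD: "F n \<omega> \<in> D01" for n using measurable_space[OF F \<omega>] by simp
    show "(\<lambda>n. h (F n \<omega>)) \<longlonglongrightarrow> h (G \<omega>)"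
      by (rule LIM_zero_cancel, rule Lim_null_comparison[OF _ lim[OF \<omega>]])
         (use hL[OF FD G[OF \<omega>]] in auto)
  qed
  then have "{\<omega> \<in> space M. h (G \<omega>) > 0} \<in> sets M" by measurable
  moreover have "{\<omega> \<in> space M. h (G \<omega>) > 0} = G -` U \<inter> space M" using hU G by auto
  ultimately show "G -` U \<inter> space M \<in> sets M" by simp
qed

text \<open>The envelopes converge to f from below, so the Lipschitz case bounds the lower limit of
  the expectations from below; the same argument for -f bounds the upper limit.\<close>

lemma portmanteau_skorohod:
  fixes F :: "nat \<Rightarrow> 'a \<Rightarrow> real \<Rightarrow> real" and G :: "'b \<Rightarrow> real \<Rightarrow> real"
  assumes M: "prob_space M" and N: "prob_space N"
    and F: "\<And>n. F n \<in> measurable M skorohod_borel" and G: "G \<in> measurable N skorohod_borel"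
    and Lip: "\<And>f L B. \<lbrakk>\<And>x y. x \<in> D01 \<Longrightarrow> y \<in> D01 \<Longrightarrow> \<bar>f x - f y\<bar> \<le> L * skorohod_dist x y; L \<ge> 0;
        \<And>x. x \<in> D01 \<Longrightarrow> \<bar>f x\<bar> \<le> B\<rbrakk> \<Longrightarrow> (\<lambda>n. \<integral>\<omega>. f (F n \<omega>) \<partial>M) \<longlonglongrightarrow> (\<integral>\<omega>. f (G \<omega>) \<partial>N)"
    and f: "continuous_map skorohod_topology euclideanreal f" and B: "\<And>x. x \<in> D01 \<Longrightarrow> \<bar>f x\<bar> \<le> B"
  shows "(\<lambda>n. \<integral>\<omega>. f (F n \<omega>) \<partial>M) \<longlonglongrightarrow> (\<integral>\<omega>. f (G \<omega>) \<partial>N)"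
proof -
  interpret M: prob_space M by (rule M)
  interpret N: prob_space N by (rule N)
  have FD: "F n \<omega> \<in> D01" if "\<omega> \<in> space M" for n \<omega> using measurable_space[OF F that] by simp
  have GD: "G \<omega> \<in> D01" if "\<omega> \<in> space N" for \<omega> using measurable_space[OF G that] by simp
  have lower: "\<forall>\<^sub>F n in sequentially. (\<integral>\<omega>. f (G \<omega>) \<partial>N) - e < (\<integral>\<omega>. f (F n \<omega>) \<partial>M)"
    if f: "continuous_map skorohod_topology euclideanreal f" and B: "\<And>x. x \<in> D01 \<Longrightarrow> \<bar>f x\<bar> \<le> B" and e: "e > 0"
        for f e
  proof -
    have L: "\<bar>lip_env f (real k) x - lip_env f (real k) y\<bar> \<le> real k * skorohod_dist x y"
        if "x \<in> D01" "y \<in> D01" for k x y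
      by (rule lip_env_Lipschitz[OF B]) (use that in auto)
    have LB: "\<bar>lip_env f (real k) x\<bar> \<le> B" if "x \<in> D01" for k x
      by (rule lip_env_bound[OF B]) (use that in auto)
    note cL = continuous_map_skorohod_measurable[OF Lipschitz_continuous_map_skorohod[OF L]]
    note mf = continuous_map_skorohod_measurable[OF f]
    have "(\<lambda>k. \<integral>\<omega>. lip_env f (real k) (G \<omega>) \<partial>N) \<longlonglongrightarrow> (\<integral>\<omega>. f (G \<omega>) \<partial>N)"
    proof (rule integral_dominated_convergence[where w = "\<lambda>_. B"])
      show "(\<lambda>\<omega>. f (G \<omega>)) \<in> borel_measurable N" by (rule measurable_compose[OF G mf])
      show "(\<lambda>\<omega>. lip_env f (real k) (G \<omega>)) \<in> borel_measurable N" for k by (rule measurable_compose[OF G cL])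
      show "AE \<omega> in N. (\<lambda>k. lip_env f (real k) (G \<omega>)) \<longlonglongrightarrow> f (G \<omega>)"
        by (intro AE_I2 lip_env_tendsto[OF f B] GD)
      show "AE \<omega> in N. norm (lip_env f (real k) (G \<omega>)) \<le> B" for k
        using LB GD by (intro AE_I2) auto
    qed simp
    from order_tendstoD(1)[OF this, of "(\<integral>\<omega>. f (G \<omega>) \<partial>N) - e"] e
    obtain k where k: "(\<integral>\<omega>. f (G \<omega>) \<partial>N) - e < (\<integral>\<omega>. lip_env f (real k) (G \<omega>) \<partial>N)"
      by (auto simp: eventually_sequentially)
    have "(\<lambda>n. \<integral>\<omega>. lip_env f (real k) (F n \<omega>) \<partial>M) \<longlonglongrightarrow> (\<integral>\<omega>. lip_env f (real k) (G \<omega>) \<partial>N)"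
      by (rule Lip[where L = "real k" and B = B]) (use L LB in auto)
    from order_tendstoD(1)[OF this k]
    show ?thesis
    proof eventually_elim
      case (elim n)
      have "(\<integral>\<omega>. lip_env f (real k) (F n \<omega>) \<partial>M) \<le> (\<integral>\<omega>. f (F n \<omega>) \<partial>M)"
      proof (rule integral_mono)
        show "integrable M (\<lambda>\<omega>. lip_env f (real k) (F n \<omega>))"
          using LB FD by (intro M.integrable_const_bound[of _ B] AE_I2 measurable_compose[OF F cL]) auto
        show "integrable M (\<lambda>\<omega>. f (F n \<omega>))"
          using B FD by (intro M.integrable_const_bound[of _ B] AE_I2 measurable_compose[OF F mf]) auto
        show "lip_env f (real k) (F n \<omega>) \<le> f (F n \<omega>)" if "\<omega> \<in> space M" for \<omega>
          by (rule lip_env_le_self[OF B _ FD[OF that]]) auto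
      qed
      then show ?case using elim by linarith
    qed
  qed
  show ?thesis
  proof (rule order_tendstoI)
    fix a assume "a < (\<integral>\<omega>. f (G \<omega>) \<partial>N)"
    then show "\<forall>\<^sub>F n in sequentially. a < (\<integral>\<omega>. f (F n \<omega>) \<partial>M)"
      using lower[OF f B, of "(\<integral>\<omega>. f (G \<omega>) \<partial>N) - a"] by simp
  next
    fix a assume "(\<integral>\<omega>. f (G \<omega>) \<partial>N) < a"
    moreover have "continuous_map skorohod_topology euclideanreal (\<lambda>x. - f x)"
      using f by (rule continuous_map_minus)
    ultimately show "\<forall>\<^sub>F n in sequentially. (\<integral>\<omega>. f (F n \<omega>) \<partial>M) < a"
      using lower[of "\<lambda>x. - f x" "a - (\<integral>\<omega>. f (G \<omega>) \<partial>N)"] B by simp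
  qed
qed

section \<open>Finite-dimensional convergence from characteristic functions\<close>

text \<open>Generated by monomials and addition only, so that convergence of expectations extends by
  induction from characteristic functions. Closure under products comes from writing Re a Re b as Re
  (a b / 2) + Re (a cnj b / 2).\<close>

inductive_set trig_poly :: "nat \<Rightarrow> ((nat \<Rightarrow> complex) \<Rightarrow> real) set" for m :: nat where
  monomial: "(\<lambda>z. Re (c * (\<Prod>i\<le>m. z i ^ p i * cnj (z i) ^ q i))) \<in> trig_poly m"
| add: "f \<in> trig_poly m \<Longrightarrow> g \<in> trig_poly m \<Longrightarrow> (\<lambda>z. f z + g z) \<in> trig_poly m"

lemma trig_poly_mult_monomial:
  assumes "g \<in> trig_poly m"
  shows "(\<lambda>z. Re (c * (\<Prod>i\<le>m. z i ^ p i * cnj (z i) ^ q i)) * g z) \<in> trig_poly m"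
  using assms
proof (induction g)
  case (monomial c' p' q')
  have re: "Re a * Re b = Re (a * b / 2) + Re (a * cnj b / 2)" for a b :: complex
    by (simp add: complex_eq_iff field_simps)
  have 1: "c * (\<Prod>i\<le>m. z i ^ p i * cnj (z i) ^ q i) * (c' * (\<Prod>i\<le>m. z i ^ p' i * cnj (z i) ^ q' i)) / 2
      = (c * c' / 2) * (\<Prod>i\<le>m. z i ^ (p i + p' i) * cnj (z i) ^ (q i + q' i))" for z :: "nat \<Rightarrow> complex"
    by (simp add: power_add prod.distrib mult_ac)
  have 2: "c * (\<Prod>i\<le>m. z i ^ p i * cnj (z i) ^ q i) * cnj (c' * (\<Prod>i\<le>m. z i ^ p' i * cnj (z i) ^ q' i)) / 2
      = (c * cnj c' / 2) * (\<Prod>i\<le>m. z i ^ (p i + q' i) * cnj (z i) ^ (q i + p' i))" for z :: "nat \<Rightarrow> complex"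
    by (simp add: power_add prod.distrib mult_ac)
  show ?case unfolding re 1 2 by (intro trig_poly.intros)
next
  case (add f g)
  then show ?case by (simp only: distrib_left) (rule trig_poly.add)
qed

lemma trig_poly_mult:
  assumes f: "f \<in> trig_poly m" and h: "h \<in> trig_poly m"
  shows "(\<lambda>z. f z * h z) \<in> trig_poly m"
  using f
proof (induction f)
  case (monomial c p q)
  show ?case using h by (rule trig_poly_mult_monomial)
next
  case (add f g)
  then show ?case by (simp only: distrib_right) (rule trig_poly.add)
qed

text \<open>The coordinates beyond m are pinned to 1, so that functions of the first m + 1
  coordinates separate points, as Stone-Weierstrass requires.\<close>

definition torus :: "nat \<Rightarrow> (nat \<Rightarrow> complex) set" where
  "torus m = PiE UNIV (\<lambda>i. if i \<le> m then sphere 0 1 else {1})"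

lemma compact_torus: "compact (torus m)"
proof -
  have "compactin (product_topology (\<lambda>i. euclidean) UNIV) (torus m)"
    unfolding torus_def compactin_PiE by auto
  then show ?thesis by (simp add: euclidean_product_topology)
qed

lemma function_ring_trig_poly: "function_ring_on (trig_poly m) (torus m)"
proof
  show "compact (torus m)" by (rule compact_torus)
next
  fix f assume "f \<in> trig_poly m"
  then show "continuous_on (torus m) f"
  proof induction
    case (monomial c p q)
    have "continuous_on (torus m) (\<lambda>z. z i)" for i
      by (rule continuous_on_subset[OF continuous_on_product_coordinates]) auto
    then show ?case by (intro continuous_intros)
  qed (auto intro: continuous_intros)
next
  fix f g assume "f \<in> trig_poly m" "g \<in> trig_poly m"
  then show "(\<lambda>x. f x + g x) \<in> trig_poly m" "(\<lambda>x. f x * g x) \<in> trig_poly m"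
    by (auto intro: trig_poly.add trig_poly_mult)
next
  fix c :: real
  show "(\<lambda>_. c) \<in> trig_poly m"
    using trig_poly.monomial[of "of_real c" "\<lambda>_. 0" "\<lambda>_. 0" m] by simp
next
  fix z w assume zw: "z \<in> torus m" "w \<in> torus m" "z \<noteq> w"
  then obtain i where i: "z i \<noteq> w i" by auto
  have im: "i \<le> m" using zw i by (auto simp: torus_def PiE_iff split: if_splits) metis
  have coord: "(\<lambda>z. Re (c * z i)) \<in> trig_poly m" for c
  proof -
    have "(\<Prod>j\<le>m. z j ^ (if j = i then 1 else 0) * cnj (z j) ^ 0) = z i" for z :: "nat \<Rightarrow> complex"
    proof -
      have "(\<Prod>j\<le>m. z j ^ (if j = i then 1 else 0) * cnj (z j) ^ 0) = (\<Prod>j\<le>m. if j = i then z i else 1)"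
        by (intro prod.cong) auto
      then show ?thesis using im by simp
    qed
    then show ?thesis using trig_poly.monomial[of c "\<lambda>j. if j = i then 1 else 0" "\<lambda>_. 0" m] by simp
  qed
  show "\<exists>f\<in>trig_poly m. f z \<noteq> f w"
  proof (cases "Re (z i) = Re (w i)")
    case True
    \<comment> \<open>The real part of -i w is Im w, so imaginary parts are available as real parts
      of monomials.\<close>
    then have "Re (- \<i> * z i) \<noteq> Re (- \<i> * w i)" using i by (simp add: complex_eq_iff)
    then show ?thesis by (rule bexI[OF _ coord])
  next
    case False
    then have "Re (1 * z i) \<noteq> Re (1 * w i)" by simp
    then show ?thesis by (rule bexI[OF _ coord])
  qed
qed

definition torus_map :: "nat \<Rightarrow> real \<Rightarrow> (nat \<Rightarrow> real) \<Rightarrow> nat \<Rightarrow> complex" where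
  "torus_map m L v i = (if i \<le> m then iexp (v i / L) else 1)"

lemma torus_map_in: "torus_map m L v \<in> torus m"
  by (auto simp: torus_def torus_map_def PiE_iff)

text \<open>On the image of \<open>torus_map\<close> a monomial is a constant times
  \<open>iexp\<close> of a linear form with coefficients (p i - q i) / L, so the hypothesis
  \<open>char\<close> applies. Integrability is carried along because the sum case needs it to split
  the integral.\<close>

lemma trig_poly_expectation_tendsto:
  fixes V :: "nat \<Rightarrow> 'a \<Rightarrow> nat \<Rightarrow> real" and W :: "'b \<Rightarrow> nat \<Rightarrow> real"
  assumes M: "prob_space M" and N: "prob_space N"
    and V[measurable]: "\<And>n i. (\<lambda>\<omega>. V n \<omega> i) \<in> borel_measurable M"
        and W[measurable]: "\<And>i. (\<lambda>\<omega>. W \<omega> i) \<in> borel_measurable N"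
    and char: "\<And>a. (\<lambda>n. CLINT \<omega>|M. iexp (\<Sum>i\<le>m. a i * V n \<omega> i)) \<longlonglongrightarrow> (CLINT \<omega>|N. iexp (\<Sum>i\<le>m. a i * W \<omega> i))"
    and r: "r \<in> trig_poly m"
  shows "(\<forall>n. integrable M (\<lambda>\<omega>. r (torus_map m L (V n \<omega>)))) \<and> integrable N (\<lambda>\<omega>. r (torus_map m L (W \<omega>))) \<and>
    (\<lambda>n. \<integral>\<omega>. r (torus_map m L (V n \<omega>)) \<partial>M) \<longlonglongrightarrow> (\<integral>\<omega>. r (torus_map m L (W \<omega>)) \<partial>N)"
  using r
proof (induction r)
  case (monomial c p q)
  interpret M: prob_space M by (rule M)
  interpret N: prob_space N by (rule N)
  define a where "a i = (real (p i) - real (q i)) / L" for i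
  have eq: "Re (c * (\<Prod>i\<le>m. torus_map m L v i ^ p i * cnj (torus_map m L v i) ^ q i))
      = Re (c * iexp (\<Sum>i\<le>m. a i * v i))" for v
  proof -
    have "torus_map m L v i ^ p i * cnj (torus_map m L v i) ^ q i = iexp (a i * v i)" if "i \<le> m" for i
    proof -
      have "torus_map m L v i ^ p i = iexp (real (p i) * (v i / L))"
        using that by (simp add: torus_map_def exp_of_nat_mult[symmetric] mult_ac)
      moreover have "cnj (torus_map m L v i) = iexp (- (v i / L))"
        using that by (simp add: torus_map_def exp_cnj)
      then have "cnj (torus_map m L v i) ^ q i = iexp (- real (q i) * (v i / L))"
        by (simp add: exp_of_nat_mult[symmetric] mult_ac)
      ultimately show ?thesis by (simp add: exp_add[symmetric] a_def algebra_simps diff_divide_distrib)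
    qed
    then have "(\<Prod>i\<le>m. torus_map m L v i ^ p i * cnj (torus_map m L v i) ^ q i) = (\<Prod>i\<le>m. iexp (a i * v i))"
      by (intro prod.cong) auto
    also have "\<dots> = iexp (\<Sum>i\<le>m. a i * v i)" by (simp add: exp_sum[symmetric] sum_distrib_left)
    finally show ?thesis by simp
  qed
  have intV: "integrable M (\<lambda>\<omega>. c * iexp (\<Sum>i\<le>m. a i * V n \<omega> i))" for n
    by (intro integrable_mult_right M.integrable_iexp) auto
  have intW: "integrable N (\<lambda>\<omega>. c * iexp (\<Sum>i\<le>m. a i * W \<omega> i))"
    by (intro integrable_mult_right N.integrable_iexp) auto
  have "(\<lambda>n. Re (c * (CLINT \<omega>|M. iexp (\<Sum>i\<le>m. a i * V n \<omega> i)))) \<longlonglongrightarrow> Re (c * (CLINT \<omega>|N. iexp (\<Sum>i\<le>m. a i * W \<omega> i)))"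
    by (intro tendsto_intros char)
  moreover have "(\<integral>\<omega>. Re (c * iexp (\<Sum>i\<le>m. a i * V n \<omega> i)) \<partial>M)
      = Re (c * (CLINT \<omega>|M. iexp (\<Sum>i\<le>m. a i * V n \<omega> i)))" for n
    by (simp only: integral_bounded_linear[OF bounded_linear_Re intV] integral_mult_right_zero)
  moreover have "(\<integral>\<omega>. Re (c * iexp (\<Sum>i\<le>m. a i * W \<omega> i)) \<partial>N) = Re (c * (CLINT \<omega>|N. iexp (\<Sum>i\<le>m. a i * W \<omega> i)))"
    by (simp only: integral_bounded_linear[OF bounded_linear_Re intW] integral_mult_right_zero)
  ultimately show ?case
    unfolding eq
    using integrable_bounded_linear[OF bounded_linear_Re intV] integrable_bounded_linear[OF bounded_linear_Re intW]
    by (simp only: simp_thms)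
next
  case (add f g)
  then show ?case by (auto intro: tendsto_add)
qed

text \<open>Stone-Weierstrass approximates g uniformly on the compact torus, so the same error bound
  holds under every law involved.\<close>

lemma continuous_torus_expectation_tendsto:
  fixes V :: "nat \<Rightarrow> 'a \<Rightarrow> nat \<Rightarrow> real" and W :: "'b \<Rightarrow> nat \<Rightarrow> real" and g :: "(nat \<Rightarrow> complex) \<Rightarrow> real"
  assumes M: "prob_space M" and N: "prob_space N"
    and V[measurable]: "\<And>n i. (\<lambda>\<omega>. V n \<omega> i) \<in> borel_measurable M"
        and W[measurable]: "\<And>i. (\<lambda>\<omega>. W \<omega> i) \<in> borel_measurable N"
    and char: "\<And>a. (\<lambda>n. CLINT \<omega>|M. iexp (\<Sum>i\<le>m. a i * V n \<omega> i)) \<longlonglongrightarrow> (CLINT \<omega>|N. iexp (\<Sum>i\<le>m. a i * W \<omega> i))"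
    and g: "continuous_on (torus m) g"
    and gV: "\<And>n. integrable M (\<lambda>\<omega>. g (torus_map m L (V n \<omega>)))"
        and gW: "integrable N (\<lambda>\<omega>. g (torus_map m L (W \<omega>)))"
  shows "(\<lambda>n. \<integral>\<omega>. g (torus_map m L (V n \<omega>)) \<partial>M) \<longlonglongrightarrow> (\<integral>\<omega>. g (torus_map m L (W \<omega>)) \<partial>N)"
proof (rule LIMSEQ_I)
  interpret M: prob_space M by (rule M)
  interpret N: prob_space N by (rule N)
  fix e :: real assume e: "e > 0"
  interpret function_ring_on "trig_poly m" "torus m" by (rule function_ring_trig_poly)
  obtain r where r: "r \<in> trig_poly m" "\<And>z. z \<in> torus m \<Longrightarrow> \<bar>g z - r z\<bar> < e / 3"
    using Stone_Weierstrass_basic[OF g, of "e / 3"] e by auto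
  note t = trig_poly_expectation_tendsto[OF M N V W char r(1), of L]
  have close: "\<bar>(\<integral>\<omega>. g (f \<omega>) \<partial>K) - (\<integral>\<omega>. r (f \<omega>) \<partial>K)\<bar> \<le> e / 3"
    if "prob_space K" "integrable K (\<lambda>\<omega>. g (f \<omega>))" "integrable K (\<lambda>\<omega>. r (f \<omega>))" "\<And>\<omega>. f \<omega> \<in> torus m"
        for K :: "'c measure" and f
  proof -
    interpret K: prob_space K by (rule that)
    have "\<bar>(\<integral>\<omega>. g (f \<omega>) \<partial>K) - (\<integral>\<omega>. r (f \<omega>) \<partial>K)\<bar> = \<bar>\<integral>\<omega>. g (f \<omega>) - r (f \<omega>) \<partial>K\<bar>"
      using that by simp
    also have "\<dots> \<le> (\<integral>\<omega>. \<bar>g (f \<omega>) - r (f \<omega>)\<bar> \<partial>K)" by (rule integral_abs_bound)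
    also have "\<dots> \<le> (\<integral>\<omega>. e / 3 \<partial>K)"
      using that r(2) by (intro integral_mono) (auto intro: less_imp_le)
    also have "\<dots> = e / 3" by (simp add: K.prob_space)
    finally show ?thesis .
  qed
  have cW: "\<bar>(\<integral>\<omega>. g (torus_map m L (W \<omega>)) \<partial>N) - (\<integral>\<omega>. r (torus_map m L (W \<omega>)) \<partial>N)\<bar> \<le> e / 3"
    using close[OF N gW] t torus_map_in by blast
  have cV: "\<bar>(\<integral>\<omega>. g (torus_map m L (V n \<omega>)) \<partial>M) - (\<integral>\<omega>. r (torus_map m L (V n \<omega>)) \<partial>M)\<bar> \<le> e / 3" for n
    using close[OF M gV[of n]] t torus_map_in by blast
  obtain n0 where n0: "\<And>n. n \<ge> n0 \<Longrightarrow> \<bar>(\<integral>\<omega>. r (torus_map m L (V n \<omega>)) \<partial>M)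
      - (\<integral>\<omega>. r (torus_map m L (W \<omega>)) \<partial>N)\<bar> < e / 3"
    using LIMSEQ_D[OF conjunct2[OF conjunct2[OF t]], of "e / 3"] e by auto
  have "norm ((\<integral>\<omega>. g (torus_map m L (V n \<omega>)) \<partial>M) - (\<integral>\<omega>. g (torus_map m L (W \<omega>)) \<partial>N)) < e" if "n \<ge> n0" for n
    using n0[OF that] cW cV[of n] unfolding real_norm_def by linarith
  then show "\<exists>no. \<forall>n\<ge>no. norm ((\<integral>\<omega>. g (torus_map m L (V n \<omega>)) \<partial>M) - (\<integral>\<omega>. g (torus_map m L (W \<omega>)) \<partial>N)) < e"
      by blast
qed

text \<open>For \<open>\<bar>v i\<bar> < pi / 2 * L\<close> the argument of \<open>H\<close> at \<open>torus_map m L v\<close> is \<open>v\<close> itself, while the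
  factors \<open>max 0 (Re (z i))\<close> hide the discontinuities of \<open>arctan (Im / Re)\<close>.\<close>

definition torus_cutoff :: "nat \<Rightarrow> real \<Rightarrow> ((nat \<Rightarrow> real) \<Rightarrow> real) \<Rightarrow> (nat \<Rightarrow> complex) \<Rightarrow> real" where
  "torus_cutoff m L H z = (\<Prod>i\<le>m. max 0 (Re (z i))) * H (\<lambda>i. if i
      \<le> m then L * arctan (Im (z i) / Re (z i)) else 0)"

text \<open>Where all real parts up to index m are positive, the formula composes continuous maps.
  At the other points the product of cutoffs vanishes and, H being bounded, squeezes the whole to
  0.\<close>

lemma continuous_torus_cutoff:
  assumes H: "continuous_on UNIV H" and B: "\<And>v. \<bar>H v\<bar> \<le> B"
  shows "continuous_on UNIV (torus_cutoff m L H)"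
proof -
  let ?P = "\<Inter>i\<in>{..m}. {z::nat \<Rightarrow> complex. 0 < Re (z i)}"
  have co: "continuous_on S (\<lambda>z::nat \<Rightarrow> complex. z i)" for S i
    by (rule continuous_on_subset[OF continuous_on_product_coordinates]) auto
  have oP: "open ?P" by (intro open_INT finite_atMost ballI open_Collect_less continuous_intros co)
  have contP: "continuous_on ?P (torus_cutoff m L H)"
    unfolding torus_cutoff_def
  proof (intro continuous_on_mult)
    show "continuous_on ?P (\<lambda>z. \<Prod>i\<le>m. max 0 (Re (z i)))" by (intro continuous_intros co)
    have "continuous_on ?P (\<lambda>z i. if i \<le> m then L * arctan (Im (z i) / Re (z i)) else 0)"
    proof (rule continuous_on_coordinatewise_then_product)
      fix i
      show "continuous_on ?P (\<lambda>z. if i \<le> m then L * arctan (Im (z i) / Re (z i)) else 0)"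
      proof (cases "i \<le> m")
        case True
        then have "Re (z i) \<noteq> 0" if "z \<in> ?P" for z using INT_D[OF that, of i] by simp
        then have "continuous_on ?P (\<lambda>z. L * arctan (Im (z i) / Re (z i)))"
          by (intro continuous_intros co) auto
        then show ?thesis using True by simp
      qed simp
    qed
    then show "continuous_on ?P (\<lambda>z. H (\<lambda>i. if i \<le> m then L * arctan (Im (z i) / Re (z i)) else 0))"
      by (rule continuous_on_compose2[OF H]) auto
  qed
  have "isCont (torus_cutoff m L H) z" for z
  proof (cases "z \<in> ?P")
    case True
    then show ?thesis using contP oP by (simp add: continuous_on_eq_continuous_at)
  next
    case False
    then obtain i where i: "i \<le> m" "Re (z i) \<le> 0" by auto
    define h where "h z = B * (\<Prod>i\<le>m. max 0 (Re (z i)))" for z :: "nat \<Rightarrow> complex"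
    have h0: "(\<Prod>i\<le>m. max 0 (Re (z i))) = 0" using i by (intro prod_zero) (auto intro!: bexI[of _ i])
    have "continuous_on UNIV h" unfolding h_def by (intro continuous_intros co)
    then have "(h \<longlongrightarrow> h z) (at z)" by (simp add: continuous_on_def)
    then have lim: "(h \<longlongrightarrow> 0) (at z)" using h0 by (simp add: h_def)
    have "norm (torus_cutoff m L H w) \<le> h w" for w
    proof -
      have "norm (torus_cutoff m L H w) = (\<Prod>i\<le>m. max 0 (Re (w i))) * \<bar>H (\<lambda>i. if i
          \<le> m then L * arctan (Im (w i) / Re (w i)) else 0)\<bar>"
        unfolding torus_cutoff_def by (simp add: abs_mult prod_nonneg)
      also have "\<dots> \<le> (\<Prod>i\<le>m. max 0 (Re (w i))) * B"
        by (intro mult_left_mono B prod_nonneg) auto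
      finally show ?thesis by (simp add: h_def mult.commute)
    qed
    then have "(torus_cutoff m L H \<longlongrightarrow> 0) (at z)"
      by (intro Lim_null_comparison[OF _ lim] always_eventually) auto
    moreover have "torus_cutoff m L H z = 0" unfolding torus_cutoff_def h0 by simp
    ultimately show ?thesis by (simp add: isCont_def)
  qed
  then show ?thesis by (simp add: continuous_at_imp_continuous_on)
qed

text \<open>If all |v i / L| are below 1, then arctan inverts tan and the only error is 1 minus a
  product of cosines, at most the sum of the (v i / L)^2. Otherwise that sum is at least 1 and the
  trivial bound 2 B suffices.\<close>

lemma torus_cutoff_approx:
  assumes B: "\<And>v. \<bar>H v\<bar> \<le> B" and L: "L > 0"
    and dep: "\<And>v w. (\<And>i. i \<le> m \<Longrightarrow> v i = w i) \<Longrightarrow> H v = H w"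
  shows "\<bar>torus_cutoff m L H (torus_map m L v)\<bar> \<le> B"
    and "\<bar>torus_cutoff m L H (torus_map m L v) - H v\<bar> \<le> 2 * B * (\<Sum>i\<le>m. (v i / L)\<^sup>2)"
proof -
  define c where "c = (\<Prod>i\<le>m. max 0 (cos (v i / L)))"
  define H' where "H' = H (\<lambda>i. if i \<le> m then L * arctan (tan (v i / L)) else 0)"
  have B0: "B \<ge> 0" using B[of v] by linarith
  have eq: "torus_cutoff m L H (torus_map m L v) = c * H'"
    unfolding torus_cutoff_def c_def H'_def
    by (intro arg_cong2[of _ _ _ _ "(*)"] prod.cong arg_cong[of _ _ H] ext)
       (auto simp: torus_map_def tan_def Re_exp Im_exp)
  have c01: "0 \<le> c" "c \<le> 1" unfolding c_def by (auto intro!: prod_nonneg prod_le_1)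
  have "\<bar>c * H'\<bar> \<le> 1 * B" unfolding abs_mult using c01 B by (intro mult_mono) (auto simp: H'_def)
  then show b: "\<bar>torus_cutoff m L H (torus_map m L v)\<bar> \<le> B" unfolding eq by simp
  show "\<bar>torus_cutoff m L H (torus_map m L v) - H v\<bar> \<le> 2 * B * (\<Sum>i\<le>m. (v i / L)\<^sup>2)"
  proof (cases "\<forall>i\<le>m. \<bar>v i / L\<bar> < 1")
    case True
    have ab: "\<bar>v i / L\<bar> < pi / 2" if "i \<le> m" for i
    proof -
      have "\<bar>v i / L\<bar> < 1" using True that by blast
      then show ?thesis using pi_ge_two by linarith
    qed
    then have rng: "- (pi / 2) < v i / L" "v i / L < pi / 2" if "i \<le> m" for i
      using ab[OF that] unfolding abs_less_iff by linarith+
    have "H' = H v" unfolding H'_def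
    proof (rule dep)
      fix i assume "i \<le> m"
      then show "(if i \<le> m then L * arctan (tan (v i / L)) else 0) = v i"
        using arctan_tan[OF rng] L by simp
    qed
    then have "c * H' - H v = - (H v * (1 - c))" by (simp add: algebra_simps)
    then have "\<bar>torus_cutoff m L H (torus_map m L v) - H v\<bar> = \<bar>H v\<bar> * (1 - c)"
      unfolding eq using c01 by (simp add: abs_mult)
    also have "\<dots> \<le> B * (\<Sum>i\<le>m. (v i / L)\<^sup>2)"
    proof (intro mult_mono B)
      have "norm ((\<Prod>i\<le>m. 1) - (\<Prod>i\<le>m. max 0 (cos (v i / L)))) \<le> (\<Sum>i\<le>m. norm (1 - max 0 (cos (v i / L))))"
        by (rule norm_prod_diff) auto
      then have "1 - c \<le> (\<Sum>i\<le>m. \<bar>1 - max 0 (cos (v i / L))\<bar>)"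
        using c01 by (simp add: c_def)
      also have "\<dots> \<le> (\<Sum>i\<le>m. (v i / L)\<^sup>2)"
      proof (rule sum_mono)
        fix i assume "i \<in> {..m}"
        have "\<bar>1 - max 0 (cos (v i / L))\<bar> \<le> 1 - cos (v i / L)" by (auto simp: max_def)
        also have "\<dots> = 2 * (sin (v i / L / 2))\<^sup>2" using cos_double_sin[of "v i / L / 2"] by simp
        also have "(sin (v i / L / 2))\<^sup>2 \<le> (v i / L / 2)\<^sup>2"
          using abs_sin_x_le_abs_x[of "v i / L / 2"] by (simp only: abs_le_square_iff)
        finally have "\<bar>1 - max 0 (cos (v i / L))\<bar> \<le> 2 * (v i / L / 2)\<^sup>2" by simp
        moreover have "2 * (y / 2)\<^sup>2 \<le> y\<^sup>2" for y :: real by (simp add: power_divide)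
        ultimately show "\<bar>1 - max 0 (cos (v i / L))\<bar> \<le> (v i / L)\<^sup>2" by (rule order_trans)
      qed
      finally show "1 - c \<le> (\<Sum>i\<le>m. (v i / L)\<^sup>2)" .
    qed (use B0 c01 in auto)
    also have "\<dots> \<le> 2 * B * (\<Sum>i\<le>m. (v i / L)\<^sup>2)"
      using B0 by (intro mult_right_mono sum_nonneg) auto
    finally show ?thesis .
  next
    case False
    then obtain i where i: "i \<le> m" "1 \<le> \<bar>v i / L\<bar>" by force
    have "1 \<le> (v i / L)\<^sup>2" using i(2) abs_le_square_iff[of 1 "v i / L"] by simp
    also have "\<dots> \<le> (\<Sum>i\<le>m. (v i / L)\<^sup>2)" by (rule member_le_sum) (use i in auto)
    finally have "2 * B * 1 \<le> 2 * B * (\<Sum>i\<le>m. (v i / L)\<^sup>2)" using B0 by (intro mult_left_mono) auto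
    then show ?thesis using b B[of v] by linarith
  qed
qed

text \<open>Integrating the cutoff error against the common second moment bound C gives D / L^2 for
  every n and for the limit. This does the work of a tightness argument: L is fixed before
  n.\<close>

lemma cramer_wold_tendsto:
  fixes V :: "nat \<Rightarrow> 'a \<Rightarrow> nat \<Rightarrow> real" and W :: "'b \<Rightarrow> nat \<Rightarrow> real" and H :: "(nat \<Rightarrow> real) \<Rightarrow> real"
  assumes M: "prob_space M" and N: "prob_space N"
    and V[measurable]: "\<And>n i. (\<lambda>\<omega>. V n \<omega> i) \<in> borel_measurable M"
        and W[measurable]: "\<And>i. (\<lambda>\<omega>. W \<omega> i) \<in> borel_measurable N"
    and char: "\<And>a. (\<lambda>n. CLINT \<omega>|M. iexp (\<Sum>i\<le>m. a i * V n \<omega> i)) \<longlonglongrightarrow> (CLINT \<omega>|N. iexp (\<Sum>i\<le>m. a i * W \<omega> i))"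
    and V2: "\<And>n i. i \<le> m \<Longrightarrow> integrable M (\<lambda>\<omega>. (V n \<omega> i)\<^sup>2)" "\<And>n i. i \<le> m \<Longrightarrow> (\<integral>\<omega>. (V n \<omega> i)\<^sup>2 \<partial>M) \<le> C"
    and W2: "\<And>i. i \<le> m \<Longrightarrow> integrable N (\<lambda>\<omega>. (W \<omega> i)\<^sup>2)" "\<And>i. i \<le> m \<Longrightarrow> (\<integral>\<omega>. (W \<omega> i)\<^sup>2 \<partial>N) \<le> C"
    and H: "continuous_on UNIV H" and B: "\<And>v. \<bar>H v\<bar> \<le> B"
    and dep: "\<And>v w. (\<And>i. i \<le> m \<Longrightarrow> v i = w i) \<Longrightarrow> H v = H w"
  shows "(\<lambda>n. \<integral>\<omega>. H (V n \<omega>) \<partial>M) \<longlonglongrightarrow> (\<integral>\<omega>. H (W \<omega>) \<partial>N)"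
proof (rule LIMSEQ_I)
  interpret M: prob_space M by (rule M)
  interpret N: prob_space N by (rule N)
  fix e :: real assume e: "e > 0"
  have B0: "B \<ge> 0" using B[of undefined] by linarith
  have "0 \<le> (\<integral>\<omega>. (V 0 \<omega> 0)\<^sup>2 \<partial>M)" by simp
  then have C0: "C \<ge> 0" using V2(2)[of 0 0] by linarith
  define D where "D = 2 * B * (real (Suc m) * C)"
  have D0: "D \<ge> 0" using B0 C0 by (simp add: D_def)
  \<comment> \<open>With this choice D / L^2 is e / 3 times D / (D + 1), which is below e /
    3.\<close>
  define L where "L = sqrt (3 * (D + 1) / e)"
  have L: "L > 0" "D / L\<^sup>2 < e / 3" using e D0 by (auto simp: L_def field_simps)
  let ?g = "\<lambda>v. torus_cutoff m L H (torus_map m L v)"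
  note approx = torus_cutoff_approx[OF B L(1) dep, of m]
  have Hm: "H \<in> borel_measurable borel" by (rule borel_measurable_continuous_onI[OF H])
  have gm: "?g \<in> borel_measurable borel"
  proof -
    have "torus_cutoff m L H \<in> borel_measurable borel"
      by (rule borel_measurable_continuous_onI[OF continuous_torus_cutoff[OF H B]])
    moreover have "torus_map m L \<in> borel_measurable borel"
    proof (rule measurable_coordinatewise_then_product)
      fix i
      have "(\<lambda>v::nat \<Rightarrow> real. v i) \<in> borel_measurable borel"
        by (rule borel_measurable_continuous_onI[OF continuous_on_product_coordinates])
      then show "(\<lambda>v. torus_map m L v i) \<in> borel_measurable borel"
        unfolding torus_map_def by (cases "i \<le> m") auto
    qed
    ultimately show ?thesis using measurable_compose by blast
  qed
  have close: "\<bar>(\<integral>\<omega>. ?g (U \<omega>) \<partial>K) - (\<integral>\<omega>. H (U \<omega>) \<partial>K)\<bar> < e / 3 \<and> integrable K (\<lambda>\<omega>. ?g (U \<omega>))"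
    if K: "prob_space K" and U: "\<And>i. (\<lambda>\<omega>. U \<omega> i) \<in> borel_measurable K"
      and U2: "\<And>i. i \<le> m \<Longrightarrow> integrable K (\<lambda>\<omega>. (U \<omega> i)\<^sup>2)" "\<And>i. i \<le> m \<Longrightarrow> (\<integral>\<omega>. (U \<omega> i)\<^sup>2 \<partial>K) \<le> C"
    for K :: "'c measure" and U
  proof -
    interpret K: prob_space K by (rule K)
    have Um: "U \<in> borel_measurable K" using U by (rule measurable_coordinatewise_then_product)
    have ig: "integrable K (\<lambda>\<omega>. ?g (U \<omega>))"
      by (rule K.integrable_const_bound[of _ B]) (use approx(1) measurable_compose[OF Um gm] in auto)
    have iH: "integrable K (\<lambda>\<omega>. H (U \<omega>))"
      by (rule K.integrable_const_bound[of _ B]) (use B measurable_compose[OF Um Hm] in auto)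
    have iU: "integrable K (\<lambda>\<omega>. 2 * B * (\<Sum>i\<le>m. (U \<omega> i / L)\<^sup>2))"
      using U2(1) by (intro integrable_mult_right Bochner_Integration.integrable_sum) (simp add: power_divide)
    have "\<bar>(\<integral>\<omega>. ?g (U \<omega>) \<partial>K) - (\<integral>\<omega>. H (U \<omega>) \<partial>K)\<bar> = \<bar>\<integral>\<omega>. ?g (U \<omega>) - H (U \<omega>) \<partial>K\<bar>"
      using ig iH by simp
    also have "\<dots> \<le> (\<integral>\<omega>. \<bar>?g (U \<omega>) - H (U \<omega>)\<bar> \<partial>K)" by (rule integral_abs_bound)
    also have "\<dots> \<le> (\<integral>\<omega>. 2 * B * (\<Sum>i\<le>m. (U \<omega> i / L)\<^sup>2) \<partial>K)"
      by (intro integral_mono integrable_abs Bochner_Integration.integrable_diff ig iH iU approx(2))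
    also have "\<dots> = 2 * B * (\<Sum>i\<le>m. (\<integral>\<omega>. (U \<omega> i)\<^sup>2 \<partial>K) / L\<^sup>2)"
      using U2(1) by (simp add: power_divide Bochner_Integration.integral_sum)
    also have "\<dots> \<le> 2 * B * (\<Sum>i\<le>m. C / L\<^sup>2)"
      using U2(2) B0 by (intro mult_left_mono sum_mono divide_right_mono) auto
    also have "\<dots> = D / L\<^sup>2" by (simp add: D_def)
    finally show ?thesis using L(2) ig by (meson order_le_less_trans)
  qed
  have gV: "\<bar>(\<integral>\<omega>. ?g (V n \<omega>) \<partial>M) - (\<integral>\<omega>. H (V n \<omega>) \<partial>M)\<bar> < e / 3" "integrable M (\<lambda>\<omega>. ?g (V n \<omega>))" for n
    using close[OF M V V2] by auto
  have gW: "\<bar>(\<integral>\<omega>. ?g (W \<omega>) \<partial>N) - (\<integral>\<omega>. H (W \<omega>) \<partial>N)\<bar> < e / 3" "integrable N (\<lambda>\<omega>. ?g (W \<omega>))"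
    using close[OF N W W2] by auto
  have "(\<lambda>n. \<integral>\<omega>. ?g (V n \<omega>) \<partial>M) \<longlonglongrightarrow> (\<integral>\<omega>. ?g (W \<omega>) \<partial>N)"
    by (rule continuous_torus_expectation_tendsto[OF M N V W char _ gV(2) gW(2)])
       (rule continuous_on_subset[OF continuous_torus_cutoff[OF H B]], simp)
  from LIMSEQ_D[OF this, of "e / 3"] e obtain n0 where n0: "\<And>n. n \<ge> n0
      \<Longrightarrow> \<bar>(\<integral>\<omega>. ?g (V n \<omega>) \<partial>M) - (\<integral>\<omega>. ?g (W \<omega>) \<partial>N)\<bar> < e / 3"
    by auto
  have "norm ((\<integral>\<omega>. H (V n \<omega>) \<partial>M) - (\<integral>\<omega>. H (W \<omega>) \<partial>N)) < e" if "n \<ge> n0" for n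
    using n0[OF that] gV(1)[of n] gW(1) unfolding real_norm_def by linarith
  then show "\<exists>no. \<forall>n\<ge>no. norm ((\<integral>\<omega>. H (V n \<omega>) \<partial>M) - (\<integral>\<omega>. H (W \<omega>) \<partial>N)) < e" by blast
qed

section \<open>A maximal inequality\<close>

text \<open>A grid point of level q is at most one step of length 2^q away from a grid point of
  level q + 1, obtained by halving its index. The induction descends from the coarsest level
  p.\<close>

lemma dyadic_chaining:
  fixes f :: "nat \<Rightarrow> real"
  assumes e: "\<And>q i. q \<le> p \<Longrightarrow> i < 2 ^ (p - q) \<Longrightarrow> \<bar>f (Suc i * 2 ^ q) - f (i * 2 ^ q)\<bar> \<le> e q"
    and e0: "\<And>q. e q \<ge> 0"
  shows "q \<le> p \<Longrightarrow> i \<le> 2 ^ (p - q) \<Longrightarrow> \<bar>f (i * 2 ^ q) - f 0\<bar> \<le> (\<Sum>r=q..p. e r)"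
proof (induction q arbitrary: i rule: inc_induct)
  case base
  then have "i = 0 \<or> i = 1" by auto
  then show ?case using e[of p 0] e0[of p] by auto
next
  case (step q)
  obtain i' where i': "i = 2 * i' \<or> i = Suc (2 * i')" by (metis evenE oddE Suc_eq_plus1)
  have pq: "(2::nat) ^ (p - q) = 2 * 2 ^ (p - Suc q)" using step.hyps by (metis Suc_diff_Suc power_Suc)
  have le: "i' \<le> 2 ^ (p - Suc q)" using i' step.prems pq by auto
  have IH: "\<bar>f (i' * 2 ^ Suc q) - f 0\<bar> \<le> (\<Sum>r=Suc q..p. e r)" by (rule step.IH[OF le])
  have s: "(\<Sum>r=q..p. e r) = e q + (\<Sum>r=Suc q..p. e r)" using step.hyps by (simp add: sum.atLeast_Suc_atMost)
  from i' show ?case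
  proof
    assume "i = 2 * i'"
    then show ?thesis using IH e0[of q] unfolding s by (simp add: mult_ac)
  next
    assume i: "i = Suc (2 * i')"
    have "2 * i' < 2 ^ (p - q)" using i step.prems by simp
    then have "\<bar>f (i * 2 ^ q) - f (2 * i' * 2 ^ q)\<bar> \<le> e q" unfolding i using step.hyps by (intro e) auto
    moreover have "2 * i' * 2 ^ q = i' * 2 ^ Suc q" by simp
    ultimately have "\<bar>f (i * 2 ^ q) - f (i' * 2 ^ Suc q)\<bar> \<le> e q" by (simp only:)
    then show ?thesis using IH unfolding s by linarith
  qed
qed

text \<open>The squared increments of length 2^q have total expectation at most K 2^(p-q) 2^(q
  (1+2d)) = K 2^p x^(2q); since x > 1, all levels together cost a constant multiple of the last one.
  The maximum over k is represented by a dominating integrable T.\<close>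

lemma maximal_inequality_dyadic:
  fixes S :: "nat \<Rightarrow> 'a \<Rightarrow> real"
  assumes d: "d > 0"
    and inc: "\<And>i l. integrable M (\<lambda>\<omega>. (S (i + l) \<omega> - S i \<omega>)\<^sup>2)"
    and bnd: "\<And>i l. (\<integral>\<omega>. (S (i + l) \<omega> - S i \<omega>)\<^sup>2 \<partial>M) \<le> K * real l powr (1 + 2 * d)"
  defines "x \<equiv> 2 powr d"
  shows "\<exists>T. integrable M T \<and> (\<forall>\<omega> k. k \<le> 2 ^ p \<longrightarrow> (S (a + k) \<omega> - S a \<omega>)\<^sup>2 \<le> T \<omega>) \<and>
    (\<integral>\<omega>. T \<omega> \<partial>M) \<le> K * (x / (x - 1))\<^sup>2 * real (2 ^ p) powr (1 + 2 * d)"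
proof -
  have x: "x > 1" unfolding x_def using d by simp
  have K: "K \<ge> 0"
    using order_trans[OF _ bnd[of 0 1]] by (simp add: integral_nonneg)
  define E where "E q \<omega> = (\<Sum>i<2 ^ (p - q). (S (a + Suc i * 2 ^ q) \<omega> - S (a + i * 2 ^ q) \<omega>)\<^sup>2)" for q \<omega>
  \<comment> \<open>Cauchy--Schwarz with weights \<open>x ^ q\<close>, which make both sums geometric of the same order.\<close>
  define T where "T \<omega> = (\<Sum>q\<le>p. x ^ q) * (\<Sum>q\<le>p. E q \<omega> / x ^ q)" for \<omega>
  have inc': "integrable M (\<lambda>\<omega>. (S (a + Suc i * 2 ^ q) \<omega> - S (a + i * 2 ^ q) \<omega>)\<^sup>2)"
    and bnd': "(\<integral>\<omega>. (S (a + Suc i * 2 ^ q) \<omega> - S (a + i * 2 ^ q) \<omega>)\<^sup>2 \<partial>M)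
        \<le> K * real (2 ^ q) powr (1 + 2 * d)" for i q
    using inc[of "a + i * 2 ^ q" "2 ^ q"] bnd[of "a + i * 2 ^ q" "2 ^ q"] by (simp_all add: add_ac)
  have intE: "integrable M (E q)" for q unfolding E_def using inc' by (intro Bochner_Integration.integrable_sum)
  have E0: "E q \<omega> \<ge> 0" for q \<omega> unfolding E_def by (intro sum_nonneg) auto
  have powx: "real (2 ^ q) powr (1 + 2 * d) = 2 ^ q * (x ^ q)\<^sup>2" for q
  proof -
    have "real (2 ^ q) powr (1 + 2 * d) = real (2 ^ q) powr 1 * real (2 ^ q) powr (d + d)"
      by (subst powr_add[symmetric]) (simp add: algebra_simps)
    also have "real (2 ^ q) powr (d + d) = (real (2 ^ q) powr d)\<^sup>2" unfolding power2_eq_square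
        by (rule powr_add)
    also have "real (2 ^ q) powr d = x ^ q"
      by (simp add: x_def powr_realpow[symmetric] powr_powr mult.commute)
    finally show ?thesis by simp
  qed
  have intEq: "(\<integral>\<omega>. E q \<omega> \<partial>M) \<le> K * 2 ^ p * (x ^ q)\<^sup>2" if q: "q \<le> p" for q
  proof -
    have "(\<integral>\<omega>. E q \<omega> \<partial>M) = (\<Sum>i<2 ^ (p - q). \<integral>\<omega>. (S (a + Suc i * 2 ^ q) \<omega> - S (a + i * 2 ^ q) \<omega>)\<^sup>2 \<partial>M)"
      unfolding E_def using inc' by (intro Bochner_Integration.integral_sum)
    also have "\<dots> \<le> (\<Sum>i<(2::nat) ^ (p - q). K * real (2 ^ q) powr (1 + 2 * d))" by (intro sum_mono bnd')
    also have "\<dots> = K * (2 ^ (p - q) * 2 ^ q) * (x ^ q)\<^sup>2" unfolding powx by simp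
    also have "(2::real) ^ (p - q) * 2 ^ q = 2 ^ p" using q by (simp add: power_add[symmetric])
    finally show ?thesis .
  qed
  have gp: "(\<Sum>q\<le>p. x ^ q) \<le> x / (x - 1) * x ^ p"
  proof -
    have "(x - 1) * (\<Sum>q\<le>p. x ^ q) = x ^ Suc p - 1" by (induction p) (auto simp: algebra_simps)
    then have "(\<Sum>q\<le>p. x ^ q) = (x ^ Suc p - 1) / (x - 1)" using x by (simp add: field_simps)
    also have "\<dots> \<le> x ^ Suc p / (x - 1)" using x by (intro divide_right_mono) auto
    finally show ?thesis by simp
  qed
  have gp0: "(\<Sum>q\<le>p. x ^ q) \<ge> 0" using x by (intro sum_nonneg) auto
  show ?thesis
  proof (intro exI[of _ T] conjI allI impI)
    show "integrable M T" unfolding T_def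
      by (intro integrable_mult_right Bochner_Integration.integrable_sum integrable_divide intE)
  next
    fix \<omega> k assume k: "k \<le> (2::nat) ^ p"
    have "\<bar>S (a + k * 2 ^ 0) \<omega> - S (a + 0) \<omega>\<bar> \<le> (\<Sum>r=0..p. sqrt (E r \<omega>))"
    proof (rule dyadic_chaining[where f = "\<lambda>k. S (a + k) \<omega>" and q = 0 and p = p])
      fix q i assume qi: "q \<le> p" "i < (2::nat) ^ (p - q)"
      have "(S (a + Suc i * 2 ^ q) \<omega> - S (a + i * 2 ^ q) \<omega>)\<^sup>2 \<le> E q \<omega>"
        unfolding E_def by (rule member_le_sum) (use qi in auto)
      then show "\<bar>S (a + Suc i * 2 ^ q) \<omega> - S (a + i * 2 ^ q) \<omega>\<bar> \<le> sqrt (E q \<omega>)"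
        by (intro real_le_rsqrt) simp
    qed (use k E0 in auto)
    then have "\<bar>S (a + k) \<omega> - S a \<omega>\<bar> \<le> (\<Sum>q\<le>p. sqrt (x ^ q) * sqrt (E q \<omega> / x ^ q))"
      using x by (simp add: atMost_atLeast0 real_sqrt_divide)
    then have "\<bar>S (a + k) \<omega> - S a \<omega>\<bar>\<^sup>2 \<le> (\<Sum>q\<le>p. sqrt (x ^ q) * sqrt (E q \<omega> / x ^ q))\<^sup>2"
      by (rule power_mono) simp
    also have "\<dots> \<le> (\<Sum>q\<le>p. (sqrt (x ^ q))\<^sup>2) * (\<Sum>q\<le>p. (sqrt (E q \<omega> / x ^ q))\<^sup>2)"
      by (rule Cauchy_Schwarz_ineq_sum)
    also have "\<dots> = T \<omega>" unfolding T_def using x E0 by simp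
    finally show "(S (a + k) \<omega> - S a \<omega>)\<^sup>2 \<le> T \<omega>" by simp
  next
    have "(\<integral>\<omega>. T \<omega> \<partial>M) = (\<Sum>q\<le>p. x ^ q) * (\<Sum>q\<le>p. (\<integral>\<omega>. E q \<omega> \<partial>M) / x ^ q)"
      unfolding T_def using intE by (simp add: Bochner_Integration.integral_sum)
    also have "\<dots> \<le> (\<Sum>q\<le>p. x ^ q) * (\<Sum>q\<le>p. K * 2 ^ p * x ^ q)"
    proof (intro mult_left_mono sum_mono gp0)
      fix q assume "q \<in> {..p}"
      then have "(\<integral>\<omega>. E q \<omega> \<partial>M) / x ^ q \<le> K * 2 ^ p * (x ^ q)\<^sup>2 / x ^ q"
        using x by (intro divide_right_mono intEq) auto
      then show "(\<integral>\<omega>. E q \<omega> \<partial>M) / x ^ q \<le> K * 2 ^ p * x ^ q" using x by (simp add: power2_eq_square)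
    qed
    also have "\<dots> = K * 2 ^ p * (\<Sum>q\<le>p. x ^ q)\<^sup>2"
      by (simp add: sum_distrib_left[symmetric] power2_eq_square)
    also have "\<dots> \<le> K * 2 ^ p * (x / (x - 1) * x ^ p)\<^sup>2"
      using K by (intro mult_left_mono power_mono gp gp0) auto
    also have "\<dots> = K * (x / (x - 1))\<^sup>2 * real (2 ^ p) powr (1 + 2 * d)"
      unfolding powx by (simp only: power_mult_distrib mult_ac)
    finally show "(\<integral>\<omega>. T \<omega> \<partial>M) \<le> K * (x / (x - 1))\<^sup>2 * real (2 ^ p) powr (1 + 2 * d)" .
  qed
qed

text \<open>Rounding n up to a power of two not exceeding 2 n costs the factor 2^(1+2d).\<close>

lemma maximal_inequality:
  fixes S :: "nat \<Rightarrow> 'a \<Rightarrow> real"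
  assumes d: "d > 0"
    and inc: "\<And>i l. integrable M (\<lambda>\<omega>. (S (i + l) \<omega> - S i \<omega>)\<^sup>2)"
    and bnd: "\<And>i l. (\<integral>\<omega>. (S (i + l) \<omega> - S i \<omega>)\<^sup>2 \<partial>M) \<le> K * real l powr (1 + 2 * d)"
  obtains C where "C \<ge> 0" "\<And>a n. n \<ge> 1 \<Longrightarrow> \<exists>T. integrable M T \<and> (\<forall>\<omega> k. k \<le> n \<longrightarrow> (S (a + k) \<omega> - S a \<omega>)\<^sup>2 \<le> T \<omega>) \<and>
    (\<integral>\<omega>. T \<omega> \<partial>M) \<le> C * real n powr (1 + 2 * d)"
proof -
  define x where "x = 2 powr d"
  define C where "C = K * (x / (x - 1))\<^sup>2 * 2 powr (1 + 2 * d)"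
  have K: "K \<ge> 0"
    using order_trans[OF _ bnd[of 0 1]] by (simp add: integral_nonneg)
  have C0: "C \<ge> 0" using K by (simp add: C_def)
  have "\<exists>T. integrable M T \<and> (\<forall>\<omega> k. k \<le> n \<longrightarrow> (S (a + k) \<omega> - S a \<omega>)\<^sup>2 \<le> T \<omega>) \<and>
    (\<integral>\<omega>. T \<omega> \<partial>M) \<le> C * real n powr (1 + 2 * d)" if n: "n \<ge> 1" for a n
  proof -
    obtain p where p: "n \<le> 2 ^ p" "2 ^ p \<le> 2 * n"
    proof -
      have "\<exists>p. n \<le> 2 ^ p" by (rule exI[of _ n], rule less_imp_le, rule less_exp)
      then obtain p where p: "n \<le> 2 ^ p" "\<And>r. r < p \<Longrightarrow> \<not> n \<le> 2 ^ r" using exists_least_iff[of "\<lambda>p. n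
          \<le> 2 ^ p"] by auto
      have "2 ^ p \<le> 2 * n"
      proof (cases p)
        case (Suc r)
        then show ?thesis using p(2)[of r] by simp
      qed (use n in simp)
      with p(1) show thesis by (rule that)
    qed
    obtain T where T: "integrable M T" "\<And>\<omega> k. k \<le> 2 ^ p \<Longrightarrow> (S (a + k) \<omega> - S a \<omega>)\<^sup>2 \<le> T \<omega>"
      "(\<integral>\<omega>. T \<omega> \<partial>M) \<le> K * (x / (x - 1))\<^sup>2 * real (2 ^ p) powr (1 + 2 * d)"
      using maximal_inequality_dyadic[OF d inc bnd, of p a] unfolding x_def by blast
    have "real (2 ^ p) powr (1 + 2 * d) \<le> real (2 * n) powr (1 + 2 * d)"
      using p(2) d by (intro powr_mono2) (auto simp flip: of_nat_power of_nat_mult)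
    also have "\<dots> = 2 powr (1 + 2 * d) * real n powr (1 + 2 * d)" by (simp add: powr_mult)
    finally have "K * (x / (x - 1))\<^sup>2 * real (2 ^ p) powr (1 + 2 * d) \<le> C * real n powr (1 + 2 * d)"
      using K unfolding C_def by (simp add: mult.assoc mult_left_mono)
    with T p(1) show ?thesis by (intro exI[of _ T]) auto
  qed
  with C0 show thesis by (rule that)
qed

section \<open>Covariances\<close>

lemma tendsto_of_smallo:
  fixes f g :: "nat \<Rightarrow> real"
  assumes fg: "f \<in> o(g)" and g: "(\<lambda>j. g j * p j) \<longlonglongrightarrow> K" "K \<noteq> 0"
  shows "(\<lambda>j. f j * p j) \<longlonglongrightarrow> 0"
proof -
  have "(\<lambda>j. f j / g j * (g j * p j)) \<longlonglongrightarrow> 0 * K"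
    by (intro tendsto_mult smalloD_tendsto fg g)
  moreover have "\<forall>\<^sub>F j in sequentially. g j * p j \<noteq> 0"
    using tendsto_imp_eventually_ne[OF g] .
  then have "\<forall>\<^sub>F j in sequentially. f j / g j * (g j * p j) = f j * p j" by eventually_elim auto
  ultimately show ?thesis by (auto intro: Lim_transform_eventually)
qed

lemma asymp_equiv_of_tendsto:
  fixes f g :: "nat \<Rightarrow> real"
  assumes "(\<lambda>t. f t * real t powr p) \<longlonglongrightarrow> K" "(\<lambda>t. g t * real t powr p) \<longlonglongrightarrow> K" "K \<noteq> 0"
  shows "f \<sim>[at_top] g"
proof (rule asymp_equivI')
  have "(\<lambda>t. (f t * real t powr p) / (g t * real t powr p)) \<longlonglongrightarrow> K / K" by (intro tendsto_divide assms)
  then have "(\<lambda>t. (f t * real t powr p) / (g t * real t powr p)) \<longlonglongrightarrow> 1" using assms(3) by simp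
  then show "(\<lambda>t. f t / g t) \<longlonglongrightarrow> 1"
    by (rule Lim_transform_eventually) (rule eventually_mono[OF eventually_gt_at_top[of 0]], auto)
qed

lemma Beta_pos: "a > 0 \<Longrightarrow> b > 0 \<Longrightarrow> Beta a (b::real) > 0"
  by (auto simp: Beta_def Gamma_real_pos)

text \<open>Bounding the inner series over k from below by its k = 0 term c^2 leaves the sum of
  \<alpha>^2.\<close>

lemma K_Q_summable:
  assumes "K_Q c \<alpha> \<beta> < \<infinity>" "c > 0"
  shows "summable (\<lambda>i. (\<alpha> i)\<^sup>2)"
proof -
  have "(\<Sum>i. ennreal ((\<alpha> i)\<^sup>2 * c\<^sup>2)) \<le> K_Q c \<alpha> \<beta>"
    unfolding K_Q_def
  proof (intro suminf_le summableI)
    fix i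
    have "ennreal (c\<^sup>2) = (\<Sum>k\<in>{0}. ennreal (c ^ (2 * k + 2)) * chain_sum \<beta> k i)" by (simp add: power2_eq_square)
    also have "\<dots> \<le> (\<Sum>k. ennreal (c ^ (2 * k + 2)) * chain_sum \<beta> k i)" by (rule sum_le_suminf) auto
    finally show "ennreal ((\<alpha> i)\<^sup>2 * c\<^sup>2) \<le> ennreal ((\<alpha> i)\<^sup>2) * (\<Sum>k. ennreal (c ^ (2 * k + 2))
        * chain_sum \<beta> k i)"
      by (simp add: ennreal_mult mult_left_mono)
  qed
  then have "(\<Sum>i. ennreal ((\<alpha> i)\<^sup>2 * c\<^sup>2)) \<noteq> \<top>" using assms(1) by (auto simp: top_unique)
  then have "summable (\<lambda>i. (\<alpha> i)\<^sup>2 * c\<^sup>2)" by (intro summable_suminf_not_top) auto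
  then have "summable (\<lambda>i. (\<alpha> i)\<^sup>2 * c\<^sup>2 / c\<^sup>2)" by (rule summable_divide)
  then show ?thesis using assms(2) by simp
qed

section \<open>Decay rates of kernels, covariances and partial sums\<close>

locale long_memory_model = projective_model +
  fixes \<kappa> d :: real
  assumes c\<^sub>Q_pos: "c\<^sub>Q > 0" and K_fin: "K_Q c\<^sub>Q \<alpha> \<beta> < \<infinity>"
    and \<kappa>: "\<kappa> > 0" and d: "0 < d" "d < 1/2"
    and b_asymp: "(\<lambda>j. Q (\<alpha> j)) \<sim>[at_top] (\<lambda>j. \<kappa> * real j powr (d - 1))"
    and beta_bar: "beta_bar \<beta> \<in> o(\<lambda>j. Q (\<alpha> j))"
begin

lemma b_tendsto: "(\<lambda>j. Q (\<alpha> j) * real j powr (1 - d)) \<longlonglongrightarrow> \<kappa>"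
proof -
  have "(\<lambda>j. Q (\<alpha> j) / (\<kappa> * real j powr (d - 1))) \<longlonglongrightarrow> 1"
    by (rule asymp_equivD_strong[OF b_asymp])
       (use \<kappa> in \<open>auto intro!: eventually_mono[OF eventually_gt_at_top[of 0]]\<close>)
  from tendsto_mult[OF tendsto_const[of \<kappa>] this]
  have "(\<lambda>j. \<kappa> * (Q (\<alpha> j) / (\<kappa> * real j powr (d - 1)))) \<longlonglongrightarrow> \<kappa>" by simp
  then show ?thesis
    by (rule Lim_transform_eventually)
       (rule eventually_mono[OF eventually_gt_at_top[of 0]], use \<kappa> in \<open>auto simp: powr_diff field_simps\<close>)
qed

lemma beta_bar_tendsto: "(\<lambda>j. beta_bar \<beta> j * real j powr (1 - d)) \<longlonglongrightarrow> 0"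
  using tendsto_of_smallo[OF beta_bar b_tendsto] \<kappa> by simp

lemma beta_le: "i < j \<Longrightarrow> (\<beta> i (j - i))\<^sup>2 \<le> (beta_bar \<beta> j)\<^sup>2"
proof -
  assume "i < j"
  then have "\<bar>\<beta> i (j - i)\<bar> \<le> beta_bar \<beta> j" unfolding beta_bar_def by (intro Max_ge) auto
  then have "\<bar>\<beta> i (j - i)\<bar>\<^sup>2 \<le> (beta_bar \<beta> j)\<^sup>2" by (intro power_mono) auto
  then show ?thesis by simp
qed

lemma summable_square_of_tendsto:
  "(\<lambda>k. x k * real k powr (1 - d)) \<longlonglongrightarrow> a \<Longrightarrow> summable (\<lambda>k. (x k)\<^sup>2)"
  using power_sequences_correlation(1)[OF d, of x a x a 0] by (simp add: power2_eq_square)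

text \<open>Finiteness of \<open>K_Q\<close> makes \<alpha> square summable, and the rate o(j^(d-1))
  with d < 1/2 does the same for \<open>beta_bar\<close>, which dominates every \<beta> i (j - i)
  with i < j.\<close>

lemma summable_mb: "summable mb"
  by (rule summable_mom_bound[OF K_Q_summable[OF K_fin c\<^sub>Q_pos] summable_square_of_tendsto[OF beta_bar_tendsto] beta_le])

text \<open>\<open>beta_bar\<close> can be pulled out of the sum defining \<open>eps\<close>,
  leaving the convergent series of \<open>mb\<close>; so \<open>eps\<close> inherits the rate
  o(j^(d-1)).\<close>

lemma eps_tendsto: "(\<lambda>j. eps j * real j powr (1 - d)) \<longlonglongrightarrow> 0"
proof -
  have le: "eps j \<le> c\<^sub>L * sqrt (suminf mb) * \<bar>beta_bar \<beta> j\<bar>" for j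
  proof -
    have "(\<Sum>i<j. (\<beta> i (j - i))\<^sup>2 * mb i) \<le> (\<Sum>i<j. (beta_bar \<beta> j)\<^sup>2 * mb i)"
      by (intro sum_mono mult_right_mono beta_le mom_bound_nonneg) auto
    also have "\<dots> = (beta_bar \<beta> j)\<^sup>2 * (\<Sum>i<j. mb i)" by (simp add: sum_distrib_left)
    also have "\<dots> \<le> (beta_bar \<beta> j)\<^sup>2 * suminf mb"
      by (intro mult_left_mono sum_le_suminf summable_mb mom_bound_nonneg) auto
    finally have "eps j \<le> sqrt (c\<^sub>L\<^sup>2 * ((beta_bar \<beta> j)\<^sup>2 * suminf mb))"
      unfolding eps_def by (intro real_sqrt_le_mono mult_left_mono) auto
    then show ?thesis using Q_Lip(1) by (simp add: real_sqrt_mult mult_ac)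
  qed
  have "(\<lambda>j. c\<^sub>L * sqrt (suminf mb) * \<bar>beta_bar \<beta> j * real j powr (1 - d)\<bar>) \<longlonglongrightarrow> c\<^sub>L * sqrt (suminf mb) * \<bar>0\<bar>"
    by (intro tendsto_intros beta_bar_tendsto)
  then have lim: "(\<lambda>j. c\<^sub>L * sqrt (suminf mb) * \<bar>beta_bar \<beta> j * real j powr (1 - d)\<bar>) \<longlonglongrightarrow> 0" by simp
  show ?thesis
  proof (rule Lim_null_comparison[OF always_eventually lim], rule allI)
    fix j
    have "norm (eps j * real j powr (1 - d)) = eps j * real j powr (1 - d)" by (simp add: eps_nonneg)
    also have "\<dots> \<le> c\<^sub>L * sqrt (suminf mb) * \<bar>beta_bar \<beta> j\<bar> * real j powr (1 - d)"
      by (intro mult_right_mono le) auto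
    finally show "norm (eps j * real j powr (1 - d)) \<le> c\<^sub>L * sqrt (suminf mb) * \<bar>beta_bar \<beta> j
        * real j powr (1 - d)\<bar>"
      by (simp add: abs_mult mult.assoc)
  qed
qed

sublocale projective_model_l2
  by unfold_locales (rule summable_square_of_tendsto[OF b_tendsto] summable_square_of_tendsto[OF eps_tendsto])+

lemma b_tendsto': "(\<lambda>j. b j * real j powr (1 - d)) \<longlonglongrightarrow> \<kappa>" "(\<lambda>j. \<bar>b j\<bar> * real j powr (1 - d)) \<longlonglongrightarrow> \<kappa>"
  using b_tendsto tendsto_rabs[OF b_tendsto] \<kappa> by (simp_all add: b_def[abs_def] abs_mult)

lemma bound_tendsto: "(\<lambda>j. bound j * real j powr (1 - d)) \<longlonglongrightarrow> \<kappa>"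
  using tendsto_add[OF b_tendsto'(2) eps_tendsto] by (simp add: bound_def distrib_right)

lemmas corr_tendsto = power_sequences_correlation(2)[OF d, folded corr_def]

definition K2 :: real where "K2 = \<kappa>\<^sup>2 * Beta d (1 - 2 * d)"

lemma K2_pos: "K2 > 0" unfolding K2_def using \<kappa> d by (intro mult_pos_pos Beta_pos) auto

lemma corr_b_tendsto: "(\<lambda>t. corr b b t * real t powr (1 - 2 * d)) \<longlonglongrightarrow> K2"
  using corr_tendsto[OF b_tendsto'(1,1)] by (simp add: K2_def power2_eq_square)

text \<open>In each of the three error correlations at least one kernel is \<open>eps\<close>, whose
  normalized limit 0 annihilates the Beta constant.\<close>

lemma covariance_tendsto: "(\<lambda>t. expectation (\<lambda>\<omega>. X 0 \<omega> * X (int t) \<omega>) * real t powr (1 - 2 * d)) \<longlonglongrightarrow> K2"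
proof -
  let ?e = "\<lambda>t. corr (\<lambda>k. \<bar>b k\<bar>) eps t + corr eps (\<lambda>k. \<bar>b k\<bar>) t + corr eps eps t"
  have "(\<lambda>t. corr (\<lambda>k. \<bar>b k\<bar>) eps t * real t powr (1 - 2 * d) + corr eps (\<lambda>k. \<bar>b k\<bar>) t * real t powr (1 - 2 * d)
     + corr eps eps t * real t powr (1 - 2 * d)) \<longlonglongrightarrow> \<kappa> * 0 * Beta d (1 - 2 * d) + 0 * \<kappa> * Beta d (1 - 2 * d)
         + 0 * 0 * Beta d (1 - 2 * d)"
    by (intro tendsto_add corr_tendsto b_tendsto' eps_tendsto)
  then have lim: "(\<lambda>t. ?e t * real t powr (1 - 2 * d)) \<longlonglongrightarrow> 0" by (simp add: distrib_right)
  have "(\<lambda>t. (expectation (\<lambda>\<omega>. X 0 \<omega> * X (int t) \<omega>) - corr b b t) * real t powr (1 - 2 * d)) \<longlonglongrightarrow> 0"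
    by (rule Lim_null_comparison[OF always_eventually lim])
       (use covariance_approx in \<open>auto simp: abs_mult intro!: mult_right_mono\<close>)
  from tendsto_add[OF this corr_b_tendsto] show ?thesis by (simp add: left_diff_distrib)
qed

lemma covsum_b_tendsto: "(\<lambda>n. covsum (corr b b) n n * real n powr (- 1 - 2 * d)) \<longlonglongrightarrow> K2 / (d * (1 + 2 * d))"
  by (rule covsum_asymp[OF d corr_b_tendsto])

lemma covsum_eps_tendsto: "(\<lambda>n. covsum (corr eps eps) n n * real n powr (- 1 - 2 * d)) \<longlonglongrightarrow> 0"
  using covsum_asymp[OF d corr_tendsto[OF eps_tendsto eps_tendsto]] by simp

text \<open>The majorant \<open>bound\<close> is again of order j^(d-1), so its double sum converges
  after normalization and is therefore bounded over all n.\<close>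

lemma partial_sum_growth:
  obtains K where "K \<ge> 0" "\<And>p n. expectation (\<lambda>\<omega>. (\<Sum>k=p+1..p+n. X (int k) \<omega>)\<^sup>2) \<le> K * real n powr (1 + 2 * d)"
proof -
  have "Bseq (\<lambda>n. covsum (corr bound bound) n n * real n powr (- 1 - 2 * d))"
    using covsum_asymp[OF d corr_tendsto[OF bound_tendsto bound_tendsto]] convergent_imp_Bseq convergent_def
        by blast
  then obtain K where K: "K > 0" "\<And>n. norm (covsum (corr bound bound) n n * real n powr (- 1 - 2 * d)) \<le> K"
      by (auto simp: Bseq_def)
  have "expectation (\<lambda>\<omega>. (\<Sum>k=p+1..p+n. X (int k) \<omega>)\<^sup>2) \<le> K * real n powr (1 + 2 * d)" for p n
  proof (cases "n = 0")
    case False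
    have "expectation (\<lambda>\<omega>. (\<Sum>k=p+1..p+n. X (int k) \<omega>)\<^sup>2) \<le> covsum (corr bound bound) n n"
        by (rule partial_sum_bound)
    also have "\<dots> = covsum (corr bound bound) n n * real n powr (- 1 - 2 * d) * real n powr (1 + 2 * d)"
      using False by (simp add: mult.assoc powr_add[symmetric])
    also have "\<dots> \<le> K * real n powr (1 + 2 * d)"
      using K(2)[of n] by (intro mult_right_mono) auto
    finally show ?thesis .
  qed simp
  with K(1) show thesis by (intro that[of K]) auto
qed

end

section \<open>Fractional Brownian motion\<close>

text \<open>The conclusion mentions only the second moment, so the parameters \<mu> and \<sigma>,
  known merely to exist, drop out. Degenerate combinations with \<sigma> = 0 are almost surely
  constant and are handled apart.\<close>

lemma gaussian_char:
  assumes N: "prob_space N" and U[measurable]: "U \<in> borel_measurable N"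
    and g: "distr N borel U = gaussian_measure \<mu> \<sigma>" and \<sigma>: "0 \<le> \<sigma>"
  shows "integrable N (\<lambda>\<omega>. (U \<omega>)\<^sup>2)"
    and "(\<integral>\<omega>. U \<omega> \<partial>N) = 0 \<Longrightarrow> (CLINT \<omega>|N. iexp (U \<omega>)) = of_real (exp (- ((\<integral>\<omega>. (U \<omega>)\<^sup>2 \<partial>N) / 2)))"
proof -
  interpret N: prob_space N by (rule N)
  have "integrable N (\<lambda>\<omega>. (U \<omega>)\<^sup>2) \<and> ((\<integral>\<omega>. U \<omega> \<partial>N) = 0 \<longrightarrow> (CLINT \<omega>|N. iexp (U \<omega>))
      = of_real (exp (- ((\<integral>\<omega>. (U \<omega>)\<^sup>2 \<partial>N) / 2))))"
  proof (cases "\<sigma> = 0")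
    case True
    then have d: "distr N borel U = return borel \<mu>" using g by (simp add: gaussian_measure_def)
    have "AE x in distr N borel U. x = \<mu>" unfolding d by (subst AE_return) auto
    then have ae: "AE \<omega> in N. U \<omega> = \<mu>" by (subst (asm) AE_distr_iff) auto
    have 1: "integrable N (\<lambda>\<omega>. (U \<omega>)\<^sup>2)"
      by (subst integrable_cong_AE[where g = "\<lambda>_. \<mu>\<^sup>2"]) (use ae in auto)
    have 2: "(\<integral>\<omega>. U \<omega> \<partial>N) = \<mu>"
      by (subst integral_cong_AE[where g = "\<lambda>_. \<mu>"]) (use ae in \<open>auto simp: N.prob_space\<close>)
    have 3: "(\<integral>\<omega>. (U \<omega>)\<^sup>2 \<partial>N) = \<mu>\<^sup>2"
      by (subst integral_cong_AE[where g = "\<lambda>_. \<mu>\<^sup>2"]) (use ae in \<open>auto simp: N.prob_space\<close>)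
    have 4: "(CLINT \<omega>|N. iexp (U \<omega>)) = iexp \<mu>"
      by (subst integral_cong_AE[where g = "\<lambda>_. iexp \<mu>"]) (use ae in \<open>auto simp: N.prob_space\<close>)
    show ?thesis using 1 2 3 4 by simp
  next
    case False
    then have s: "\<sigma> > 0" using \<sigma> by simp
    have D: "distributed N lborel U (\<lambda>x. ennreal (normal_density \<mu> \<sigma> x))"
    proof -
      have "distr N lborel U = distr N borel U" by (rule distr_cong) auto
      also have "\<dots> = density lborel (\<lambda>x. ennreal (normal_density \<mu> \<sigma> x))"
        using g False by (simp add: gaussian_measure_def)
      finally show ?thesis by (auto simp: distributed_def)
    qed
    have D': "distributed N lborel (\<lambda>\<omega>. (U \<omega> - \<mu>) / \<sigma>) (\<lambda>x. ennreal (std_normal_density x))"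
      using N.normal_standard_normal_convert[OF s, of U \<mu>] D by simp
    have m: "(\<integral>\<omega>. U \<omega> \<partial>N) = \<mu>" by (rule N.normal_distributed_expectation[OF s D])
    have v: "N.variance U = \<sigma>\<^sup>2" by (rule N.normal_distributed_variance[OF s D])
    have dd: "distr N borel (\<lambda>\<omega>. (U \<omega> - \<mu>) / \<sigma>) = std_normal_distribution"
    proof -
      have "distr N borel (\<lambda>\<omega>. (U \<omega> - \<mu>) / \<sigma>) = distr N lborel (\<lambda>\<omega>. (U \<omega> - \<mu>) / \<sigma>)" by (rule distr_cong) auto
      then show ?thesis using D' by (simp add: distributed_def)
    qed
    have "integrable (distr N borel (\<lambda>\<omega>. (U \<omega> - \<mu>) / \<sigma>)) (\<lambda>x. x ^ 2)"
      unfolding dd by (rule integrable_std_normal_distribution_moment)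
    then have i: "integrable N (\<lambda>\<omega>. ((U \<omega> - \<mu>) / \<sigma>)\<^sup>2)" by (subst (asm) integrable_distr_eq) auto
    have "integrable N (\<lambda>\<omega>. (\<sigma> * ((U \<omega> - \<mu>) / \<sigma>))\<^sup>2)"
      unfolding power_mult_distrib by (rule integrable_mult_right[OF i])
    then have "integrable N (\<lambda>\<omega>. (\<sigma> * ((U \<omega> - \<mu>) / \<sigma>) + \<mu>)\<^sup>2)"
      by (intro integrable_square_add) auto
    then have iU: "integrable N (\<lambda>\<omega>. (U \<omega>)\<^sup>2)" using s by simp
    have "(CLINT \<omega>|N. iexp (U \<omega>)) = of_real (exp (- ((\<integral>\<omega>. (U \<omega>)\<^sup>2 \<partial>N) / 2)))" if "(\<integral>\<omega>. U \<omega> \<partial>N) = 0"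
    proof -
      have \<mu>0: "\<mu> = 0" using that m by simp
      have v2: "(\<integral>\<omega>. (U \<omega>)\<^sup>2 \<partial>N) = \<sigma>\<^sup>2" using v that by simp
      have "(CLINT \<omega>|N. iexp (U \<omega>)) = char (distr N borel (\<lambda>\<omega>. (U \<omega> - \<mu>) / \<sigma>)) \<sigma>"
        unfolding char_def using s \<mu>0 by (subst integral_distr) auto
      also have "\<dots> = of_real (exp (- (\<sigma>\<^sup>2) / 2))" unfolding dd char_std_normal_distribution by simp
      finally show ?thesis unfolding v2 by simp
    qed
    then show ?thesis using iU by blast
  qed
  then show "integrable N (\<lambda>\<omega>. (U \<omega>)\<^sup>2)"
    "(\<integral>\<omega>. U \<omega> \<partial>N) = 0 \<Longrightarrow> (CLINT \<omega>|N. iexp (U \<omega>)) = of_real (exp (- ((\<integral>\<omega>. (U \<omega>)\<^sup>2 \<partial>N) / 2)))" by auto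
qed

definition fbm_cov :: "real \<Rightarrow> real \<Rightarrow> real \<Rightarrow> real" where
  "fbm_cov h s t = (s powr (2 * h) + t powr (2 * h) - \<bar>t - s\<bar> powr (2 * h)) / 2"

locale fbm =
  fixes N :: "'b measure" and h :: real and B :: "real \<Rightarrow> 'b \<Rightarrow> real"
  assumes fbm: "fractional_brownian_motion N h B"
begin

sublocale prob_space N using fbm by (simp add: fractional_brownian_motion_def)

lemma B_measurable: "t \<ge> 0 \<Longrightarrow> B t \<in> borel_measurable N"
  using fbm by (auto simp: fractional_brownian_motion_def gaussian_process_def)

lemma B_gaussian:
  assumes "finite I" "I \<subseteq> {0..}"
  shows "\<exists>\<mu> \<sigma>. 0 \<le> \<sigma> \<and> distr N borel (\<lambda>\<omega>. \<Sum>t\<in>I. a t * B t \<omega>) = gaussian_measure \<mu> \<sigma>"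
  using fbm assms unfolding fractional_brownian_motion_def gaussian_process_def by blast

lemma B_square: assumes t: "t \<ge> 0" shows "integrable N (\<lambda>\<omega>. (B t \<omega>)\<^sup>2)"
proof -
  obtain \<mu> \<sigma> where g: "0 \<le> \<sigma>" "distr N borel (\<lambda>\<omega>. \<Sum>t\<in>{t}. 1 * B t \<omega>) = gaussian_measure \<mu> \<sigma>"
    using B_gaussian[of "{t}" "\<lambda>_. 1"] t by auto
  then show ?thesis
    using gaussian_char(1)[OF prob_space_axioms B_measurable[OF t], of \<mu> \<sigma>] by simp
qed

lemma B_mean: "t \<ge> 0 \<Longrightarrow> expectation (B t) = 0"
  using fbm by (auto simp: fractional_brownian_motion_def)

lemma B_cov: "s \<ge> 0 \<Longrightarrow> t \<ge> 0 \<Longrightarrow> expectation (\<lambda>\<omega>. B s \<omega> * B t \<omega>) = fbm_cov h s t"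
  using fbm by (auto simp: fractional_brownian_motion_def fbm_cov_def)

lemma B_continuous: "\<omega> \<in> space N \<Longrightarrow> continuous_on {0..} (\<lambda>t. B t \<omega>)"
  using fbm by (auto simp: fractional_brownian_motion_def)

text \<open>Mean zero and \<open>B_cov\<close> reduce the law of a Gaussian combination to the
  quadratic form of the covariance.\<close>

lemma B_char:
  assumes I: "finite I" "I \<subseteq> {0..}"
  shows "(CLINT \<omega>|N. iexp (\<Sum>t\<in>I. a t * B t \<omega>)) = of_real (exp (- ((\<Sum>s\<in>I. \<Sum>t\<in>I. a s * a t
      * fbm_cov h s t) / 2)))"
proof -
  obtain \<mu> \<sigma> where g: "0 \<le> \<sigma>" "distr N borel (\<lambda>\<omega>. \<Sum>t\<in>I. a t * B t \<omega>) = gaussian_measure \<mu> \<sigma>"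
    using B_gaussian[OF I] by blast
  have pos: "t \<ge> 0" if "t \<in> I" for t using I that by auto
  have [measurable]: "(\<lambda>\<omega>. \<Sum>t\<in>I. a t * B t \<omega>) \<in> borel_measurable N"
    by (intro borel_measurable_sum borel_measurable_times borel_measurable_const B_measurable pos)
  have iB: "integrable N (B t)" if "t \<ge> 0" for t
    by (rule expectation_abs_le_sqrt(1)[OF B_measurable[OF that] B_square[OF that]])
  have iBB: "integrable N (\<lambda>\<omega>. B s \<omega> * B t \<omega>)" if "s \<ge> 0" "t \<ge> 0" for s t
    by (intro integrable_mult_square B_measurable B_square that)
  have m: "(\<integral>\<omega>. (\<Sum>t\<in>I. a t * B t \<omega>) \<partial>N) = 0"
    using iB pos B_mean by (subst Bochner_Integration.integral_sum) auto
  have "(\<integral>\<omega>. (\<Sum>t\<in>I. a t * B t \<omega>)\<^sup>2 \<partial>N) = (\<integral>\<omega>. (\<Sum>s\<in>I. \<Sum>t\<in>I. a s * a t * (B s \<omega> * B t \<omega>)) \<partial>N)"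
    by (simp add: power2_eq_square sum_product mult_ac)
  also have "\<dots> = (\<Sum>s\<in>I. \<Sum>t\<in>I. a s * a t * fbm_cov h s t)"
    using iBB pos B_cov
    by (subst Bochner_Integration.integral_sum; (intro Bochner_Integration.integrable_sum integrable_mult_right sum.cong refl)?; simp)
  finally show ?thesis
    using gaussian_char(2)[OF prob_space_axioms _ g(2,1) m] by simp
qed

end

text \<open>Uniform continuity on [0,1]: each t lies within 1 / (m + 1) of the grid point at which
  the step path reads f. Writing \<open>Suc m\<close> avoids the empty mesh.\<close>

lemma step_path_approximates_continuous:
  assumes f: "continuous_on {0..1} f" and x: "x = restrict f {0..1}"
  shows "(\<lambda>m. skorohod_dist (step_path (Suc m) (\<lambda>i. f (real i / real (Suc m)))) x) \<longlonglongrightarrow> 0"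
proof (rule LIMSEQ_I)
  fix e :: real assume e: "e > 0"
  have "uniformly_continuous_on {0..1} f" by (rule compact_uniformly_continuous[OF f]) simp
  then obtain r where r: "r > 0" "\<And>s t. s \<in> {0..1} \<Longrightarrow> t \<in> {0..1} \<Longrightarrow> dist t s < r \<Longrightarrow> dist (f t) (f s) < e / 2"
    using e unfolding uniformly_continuous_on_def by (metis half_gt_zero)
  obtain m0 :: nat where m0: "1 / r < real m0" using reals_Archimedean2 by blast
  have "norm (skorohod_dist (step_path (Suc m) (\<lambda>i. f (real i / real (Suc m)))) x - 0) < e" if m: "m \<ge> m0" for m
  proof -
    have "skorohod_dist (step_path (Suc m) (\<lambda>i. f (real i / real (Suc m)))) x \<le> e / 2"
    proof (rule skorohod_dist_le_sup[OF step_path_D01])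
      show "x \<in> D01" unfolding x by (rule continuous_path_D01[OF f])
      fix t :: real assume t: "t \<in> {0..1}"
      define i where "i = nat \<lfloor>real (Suc m) * t\<rfloor>"
      have i: "real i \<le> real (Suc m) * t" "real (Suc m) * t < real i + 1" using t unfolding i_def by auto
      have "t < (real i + 1) / real (Suc m)" "real i / real (Suc m) \<le> t"
        using i by (simp_all only: pos_less_divide_eq pos_divide_le_eq of_nat_0_less_iff zero_less_Suc mult.commute)
      then have it: "real i / real (Suc m) \<le> t" "t - real i / real (Suc m) < 1 / real (Suc m)"
        by (auto simp: add_divide_distrib)
      have "1 / real (Suc m) \<le> r"
      proof -
        have "1 / r < real (Suc m)" using m0 m by linarith
        then show ?thesis using r(1) by (simp add: field_simps)
      qed
      then have "dist (real i / real (Suc m)) t < r"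
        using it unfolding dist_real_def by linarith
      moreover have "real i / real (Suc m) \<in> {0..1}"
        unfolding atLeastAtMost_iff by (intro conjI order_trans[OF it(1)]) (use t in auto)
      ultimately have "dist (f (real i / real (Suc m))) (f t) < e / 2" using t by (intro r(2)) auto
      then show "\<bar>step_path (Suc m) (\<lambda>i. f (real i / real (Suc m))) t - x t\<bar> \<le> e / 2"
        using t unfolding x step_path_def i_def[symmetric] by (simp add: dist_real_def i_def)
    qed (use e in simp)
    then show ?thesis using e skorohod.nonneg[of _ x] by simp
  qed
  then show "\<exists>no. \<forall>m\<ge>no. norm (skorohod_dist (step_path (Suc m) (\<lambda>i. f (real i / real (Suc m)))) x - 0) < e"
      by blast
qed

section \<open>The invariance principle\<close>

lemma covsum_polarization':
  "2 * covsum r p q = covsum r p p + covsum r q q - covsum r (nat \<bar>int q - int p\<bar>) (nat \<bar>int q - int p\<bar>)"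
proof (cases "p \<le> q")
  case True
  then have e: "nat \<bar>int q - int p\<bar> = q - p" by simp
  show ?thesis unfolding e by (rule covsum_polarization[OF True])
next
  case False
  then have e: "nat \<bar>int q - int p\<bar> = p - q" and qp: "q \<le> p" by simp_all
  show ?thesis unfolding e using covsum_polarization[OF qp, of r] covsum_commute[of r p q] by linarith
qed

text \<open>The expression is w (k n) times the power 1 + 2 d of k n / n. For u > 0 the index k n
  tends to infinity; for u = 0 it need not, but w is bounded and the power tends to 0.\<close>

lemma covsum_scaled:
  assumes d: "d > 0" and v: "(\<lambda>n. covsum r n n * real n powr (- 1 - 2 * d)) \<longlonglongrightarrow> K"
    and k: "(\<lambda>n. real (k n) / real n) \<longlonglongrightarrow> u"
  shows "(\<lambda>n. covsum r (k n) (k n) * real n powr (- 1 - 2 * d)) \<longlonglongrightarrow> K * u powr (1 + 2 * d)"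
proof -
  define w where "w j = covsum r j j * real j powr (- 1 - 2 * d)" for j
  have u: "u \<ge> 0" by (rule LIMSEQ_le_const[OF k]) auto
  have eq: "\<forall>\<^sub>F n in sequentially. w (k n) * (real (k n) / real n) powr (1 + 2 * d)
      = covsum r (k n) (k n) * real n powr (- 1 - 2 * d)"
  proof (rule eventually_mono[OF eventually_gt_at_top[of 0]])
    fix n :: nat assume n: "n > 0"
    show "w (k n) * (real (k n) / real n) powr (1 + 2 * d) = covsum r (k n) (k n) * real n powr (- 1 - 2 * d)"
    proof (cases "k n = 0")
      case True
      then show ?thesis by (simp add: covsum_def)
    next
      case False
      have cancel: "c * x powr (- e) * (x / y) powr e = c * y powr (- e)" if "x > 0" "y > 0" for c e x y :: real
        using that by (simp add: powr_divide powr_minus field_simps)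
      have e: "- 1 - 2 * d = - (1 + 2 * d)" by simp
      show ?thesis unfolding w_def e by (rule cancel) (use n False in auto)
    qed
  qed
  have p: "(\<lambda>n. (real (k n) / real n) powr (1 + 2 * d)) \<longlonglongrightarrow> u powr (1 + 2 * d)"
    by (rule tendsto_powr'[OF k tendsto_const]) (use d u in \<open>auto intro!: always_eventually\<close>)
  have "(\<lambda>n. w (k n) * (real (k n) / real n) powr (1 + 2 * d)) \<longlonglongrightarrow> K * u powr (1 + 2 * d)"
  proof (cases "u = 0")
    case True
    have "Bseq w" using v convergent_imp_Bseq convergent_def unfolding w_def by blast
    then obtain C where C: "C > 0" "\<And>j. norm (w j) \<le> C" by (auto simp: Bseq_def)
    have "(\<lambda>n. C * (real (k n) / real n) powr (1 + 2 * d)) \<longlonglongrightarrow> C * u powr (1 + 2 * d)" by (intro tendsto_intros p)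
    then have lim: "(\<lambda>n. C * (real (k n) / real n) powr (1 + 2 * d)) \<longlonglongrightarrow> 0" using True by simp
    have "(\<lambda>n. w (k n) * (real (k n) / real n) powr (1 + 2 * d)) \<longlonglongrightarrow> 0"
      by (rule Lim_null_comparison[OF always_eventually lim])
         (use C(2) in \<open>auto simp: abs_mult intro!: mult_right_mono\<close>)
    then show ?thesis using True by simp
  next
    case False
    then have u: "u > 0" using u by simp
    have ev: "\<forall>\<^sub>F n in sequentially. real (k n) / real n * real n = real (k n)"
      using eventually_gt_at_top[of "0::nat"] by eventually_elim auto
    have fl: "filterlim (\<lambda>n. real (k n) / real n * real n) at_top sequentially"
      by (rule filterlim_tendsto_pos_mult_at_top[OF k u filterlim_real_sequentially])
    have "filterlim (\<lambda>n. real (k n)) at_top sequentially"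
      using fl unfolding filterlim_cong[OF refl refl ev] .
    then have kt: "filterlim k at_top sequentially"
      unfolding filterlim_at_top by (auto dest: spec[of _ "real _"])
    have "(\<lambda>n. w (k n)) \<longlonglongrightarrow> K" using filterlim_compose[OF v kt] by (simp add: w_def)
    then show ?thesis by (intro tendsto_mult p)
  qed
  then show ?thesis by (rule Lim_transform_eventually) (rule eq)
qed

lemma floor_scaled_tendsto:
  assumes "u \<ge> 0" shows "(\<lambda>n. real (nat \<lfloor>real n * u\<rfloor>) / real n) \<longlonglongrightarrow> u"
  using assms by (cases "u = 0") (simp, real_asymp)

text \<open>Brings a combination of partial sums into the form required by
  \<open>char_combination\<close>: the k-th term is counted with weight a i for every p i that k
  does not exceed.\<close>

lemma sum_step_weights:
  fixes a :: "nat \<Rightarrow> real" and g :: "nat \<Rightarrow> nat \<Rightarrow> real"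
  assumes p: "\<And>i. i \<le> m \<Longrightarrow> p i \<le> n"
  defines "w k \<equiv> \<Sum>i\<le>m. a i * (if k \<le> p i then 1 else 0)"
  shows "(\<Sum>k=1..n. w k * x k) = (\<Sum>i\<le>m. a i * (\<Sum>k=1..p i. x k))"
    and "(\<Sum>k=1..n. \<Sum>l=1..n. w k * w l * g k l) = (\<Sum>i\<le>m. \<Sum>j\<le>m. a i * a j * (\<Sum>k=1..p i. \<Sum>l=1..p j. g k l))"
proof -
  have cut: "(\<Sum>k=1..p i. y k) = (\<Sum>k=1..n. (if k \<le> p i then 1 else 0) * y k)" if "i \<le> m" for i
      and y :: "nat \<Rightarrow> real"
    by (rule sum.mono_neutral_cong_left) (use p[OF that] in auto)
  have gen: "(\<Sum>k=1..n. w k * y k) = (\<Sum>i\<le>m. a i * (\<Sum>k=1..p i. y k))" for y :: "nat \<Rightarrow> real"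
  proof -
    have "(\<Sum>k=1..n. w k * y k) = (\<Sum>k=1..n. \<Sum>i\<le>m. a i * ((if k \<le> p i then 1 else 0) * y k))"
      unfolding w_def sum_distrib_right by (simp add: mult.assoc)
    also have "\<dots> = (\<Sum>i\<le>m. \<Sum>k=1..n. a i * ((if k \<le> p i then 1 else 0) * y k))" by (rule sum.swap)
    also have "\<dots> = (\<Sum>i\<le>m. a i * (\<Sum>k=1..p i. y k))"
      by (intro sum.cong refl) (simp only: cut atMost_iff sum_distrib_left)
    finally show ?thesis .
  qed
  show "(\<Sum>k=1..n. w k * x k) = (\<Sum>i\<le>m. a i * (\<Sum>k=1..p i. x k))" by (rule gen)
  have "(\<Sum>k=1..n. \<Sum>l=1..n. w k * w l * g k l) = (\<Sum>k=1..n. w k * (\<Sum>l=1..n. w l * g k l))"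
    by (simp add: sum_distrib_left mult.assoc)
  also have "\<dots> = (\<Sum>i\<le>m. a i * (\<Sum>k=1..p i. \<Sum>j\<le>m. a j * (\<Sum>l=1..p j. g k l)))"
    unfolding gen ..
  also have "\<dots> = (\<Sum>i\<le>m. \<Sum>j\<le>m. a i * a j * (\<Sum>k=1..p i. \<Sum>l=1..p j. g k l))"
  proof (rule sum.cong[OF refl])
    fix i
    have "(\<Sum>k=1..p i. \<Sum>j\<le>m. a j * (\<Sum>l=1..p j. g k l)) = (\<Sum>j\<le>m. \<Sum>k=1..p i. a j * (\<Sum>l=1..p j. g k l))"
      by (rule sum.swap)
    then show "a i * (\<Sum>k=1..p i. \<Sum>j\<le>m. a j * (\<Sum>l=1..p j. g k l))
        = (\<Sum>j\<le>m. a i * a j * (\<Sum>k=1..p i. \<Sum>l=1..p j. g k l))"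
      by (simp add: sum_distrib_left mult.assoc)
  qed
  finally show "(\<Sum>k=1..n. \<Sum>l=1..n. w k * w l * g k l) = (\<Sum>i\<le>m. \<Sum>j\<le>m. a i * a j
      * (\<Sum>k=1..p i. \<Sum>l=1..p j. g k l))" .
qed

section \<open>Rescaled partial sums and their finite-dimensional limits\<close>

context long_memory_model
begin

definition S :: "nat \<Rightarrow> 'a \<Rightarrow> real" where "S k \<omega> = (\<Sum>j=1..k. X (int j) \<omega>)"
definition scl :: "nat \<Rightarrow> real" where "scl n = real n powr (- 1/2 - d)"

lemma scl_nonneg: "scl n \<ge> 0" by (simp add: scl_def)

lemma scl_square: "(scl n)\<^sup>2 = real n powr (- 1 - 2 * d)"
  unfolding scl_def power2_eq_square powr_add[symmetric] by (simp add: algebra_simps)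

lemma S_measurable[measurable]: "S k \<in> borel_measurable M"
  unfolding S_def by measurable

lemma S_increment: "S (i + l) \<omega> - S i \<omega> = (\<Sum>k=i+1..i+l. X (int k) \<omega>)"
proof -
  have "S (i + l) \<omega> = S i \<omega> + (\<Sum>k=i+1..i+l. X (int k) \<omega>)" unfolding S_def by (rule sum.ub_add_nat) simp
  then show ?thesis by simp
qed

lemma S_increment_square: "integrable M (\<lambda>\<omega>. (S (i + l) \<omega> - S i \<omega>)\<^sup>2)"
  unfolding S_increment using combination_square(2)[where K = "{i+1..i+l}" and a = "\<lambda>_. 1"] by simp

lemma path01_partial_sums:
  "path01 (\<lambda>\<tau> \<omega>. real n powr (- 1/2 - d) * (\<Sum>t\<in>{1..\<lfloor>real n * \<tau>\<rfloor>}. X t \<omega>)) \<omega> = step_path n (\<lambda>k. scl n * S k \<omega>)"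
proof -
  have "(\<Sum>t\<in>{1..z}. X t \<omega>) = (\<Sum>j=1..nat z. X (int j) \<omega>)" for z :: int
    by (rule sum.reindex_bij_witness[of _ int nat]) auto
  then show ?thesis by (simp add: path01_def step_path_def scl_def S_def)
qed

definition c2 :: real where "c2 = K2 / (d * (1 + 2 * d))"

lemma c2_pos: "c2 > 0" unfolding c2_def using K2_pos d by (intro divide_pos_pos mult_pos_pos) auto

text \<open>Polarization reduces the mixed covariance to three diagonal ones, at s, t and |t - s|;
  with 2 H = 1 + 2 d they assemble to the fractional Brownian covariance.\<close>

lemma scaled_covsum_tendsto:
  assumes "s \<ge> 0" "t \<ge> 0"
  shows "(\<lambda>n. (scl n)\<^sup>2 * covsum (corr b b) (nat \<lfloor>real n * s\<rfloor>) (nat \<lfloor>real n * t\<rfloor>)) \<longlonglongrightarrow> c2 * fbm_cov (d + 1/2) s t"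
proof -
  let ?p = "\<lambda>n. nat \<lfloor>real n * s\<rfloor>" and ?q = "\<lambda>n. nat \<lfloor>real n * t\<rfloor>"
  let ?v = "\<lambda>k. covsum (corr b b) k k"
  note f = floor_scaled_tendsto[OF assms(1)] floor_scaled_tendsto[OF assms(2)]
  have "(\<lambda>n. \<bar>real (?q n) / real n - real (?p n) / real n\<bar>) \<longlonglongrightarrow> \<bar>t - s\<bar>"
    by (intro tendsto_intros f)
  moreover have "\<bar>real (?q n) / real n - real (?p n) / real n\<bar>
      = real (nat \<bar>int (?q n) - int (?p n)\<bar>) / real n" for n
    by (simp add: diff_divide_distrib[symmetric])
  ultimately have k: "(\<lambda>n. real (nat \<bar>int (?q n) - int (?p n)\<bar>) / real n) \<longlonglongrightarrow> \<bar>t - s\<bar>" by simp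
  have "(\<lambda>n. (?v (?p n) * real n powr (- 1 - 2 * d) + ?v (?q n) * real n powr (- 1 - 2 * d)
      - ?v (nat \<bar>int (?q n) - int (?p n)\<bar>) * real n powr (- 1 - 2 * d)) / 2)
     \<longlonglongrightarrow> (c2 * s powr (1 + 2 * d) + c2 * t powr (1 + 2 * d) - c2 * \<bar>t - s\<bar> powr (1 + 2 * d)) / 2"
    unfolding c2_def by (intro tendsto_intros covsum_scaled[OF d(1) covsum_b_tendsto] f k) auto
  moreover have "(?v (?p n) * real n powr (- 1 - 2 * d) + ?v (?q n) * real n powr (- 1 - 2 * d)
      - ?v (nat \<bar>int (?q n) - int (?p n)\<bar>) * real n powr (- 1 - 2 * d)) / 2
          = (scl n)\<^sup>2 * covsum (corr b b) (?p n) (?q n)" for n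
  proof -
    have "(scl n)\<^sup>2 * covsum (corr b b) (?p n) (?q n) = (scl n)\<^sup>2 * (2
        * covsum (corr b b) (?p n) (?q n)) / 2" by simp
    also have "\<dots> = (?v (?p n) * real n powr (- 1 - 2 * d) + ?v (?q n) * real n powr (- 1 - 2 * d)
      - ?v (nat \<bar>int (?q n) - int (?p n)\<bar>) * real n powr (- 1 - 2 * d)) / 2"
      unfolding covsum_polarization' scl_square by (simp add: algebra_simps)
    finally show ?thesis by simp
  qed
  moreover have "(c2 * s powr (1 + 2 * d) + c2 * t powr (1 + 2 * d) - c2 * \<bar>t - s\<bar> powr (1 + 2 * d)) / 2
      = c2 * fbm_cov (d + 1/2) s t"
    by (simp add: fbm_cov_def algebra_simps)
  ultimately show ?thesis by simp
qed

text \<open>The bound of \<open>char_combination\<close> is evaluated with weights of order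
  n^(-1/2-d): linearization costs the square root of a normalized double sum of \<open>eps\<close>,
  and the innovation coefficients are at most of order n^(-d), so both errors vanish.\<close>

lemma char_partial_sums_tendsto:
  assumes m: "m > 0"
  shows "(\<lambda>n. CLINT \<omega>|M. iexp (\<Sum>i\<le>m. a i * (scl n * S (nat \<lfloor>real n * (real i / real m)\<rfloor>) \<omega>))) \<longlonglongrightarrow>
    of_real (exp (- ((\<Sum>i\<le>m. \<Sum>j\<le>m. a i * a j * (c2 * fbm_cov (d
        + 1/2) (real i / real m) (real j / real m))) / 2)))"
proof -
  define p where "p n i = nat \<lfloor>real n * (real i / real m)\<rfloor>" for n i
  define a0 where "a0 = (\<Sum>i\<le>m. \<bar>a i\<bar>)"
  define A where "A n k = (\<Sum>i\<le>m. (scl n * a i) * (if k \<le> p n i then 1 else 0))" for n k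
  define \<sigma>2 where "\<sigma>2 n = (\<Sum>k=1..n. \<Sum>l=1..n. A n k * A n l * corr b b (nat \<bar>int k - int l\<bar>))" for n
  define \<mu> where "\<mu> n = (scl n * a0) * sqrt (real n * (\<Sum>k. (b k)\<^sup>2))" for n
  have p: "p n i \<le> n" if "i \<le> m" for n i
  proof -
    have "real n * (real i / real m) \<le> real n * 1" using that m by (intro mult_left_mono) auto
    then show ?thesis unfolding p_def by linarith
  qed
  have A: "\<bar>A n k\<bar> \<le> scl n * a0" for n k
  proof -
    have "\<bar>A n k\<bar> \<le> (\<Sum>i\<le>m. \<bar>(scl n * a i) * (if k \<le> p n i then 1 else 0)\<bar>)" unfolding A_def by (rule sum_abs)
    also have "\<dots> \<le> (\<Sum>i\<le>m. scl n * \<bar>a i\<bar>)" using scl_nonneg by (intro sum_mono) (auto simp: abs_mult)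
    finally show ?thesis by (simp add: a0_def sum_distrib_left)
  qed
  have lin: "(\<Sum>i\<le>m. a i * (scl n * S (p n i) \<omega>)) = (\<Sum>k=1..n. A n k * X (int k) \<omega>)" for n \<omega>
    unfolding A_def using sum_step_weights(1)[OF p, where a = "\<lambda>i. scl n * a i" and x = "\<lambda>k. X (int k) \<omega>"]
    by (simp add: S_def mult_ac)
  have s2: "\<sigma>2 n = (\<Sum>i\<le>m. \<Sum>j\<le>m. a i * a j * ((scl n)\<^sup>2 * covsum (corr b b) (p n i) (p n j)))" for n
    unfolding \<sigma>2_def A_def
    using sum_step_weights(2)[OF p, where a = "\<lambda>i. scl n * a i" and g = "\<lambda>k l. corr b b (nat \<bar>int k - int l\<bar>)"]
    by (simp add: covsum_def power2_eq_square mult_ac)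
  have \<sigma>lim: "\<sigma>2 \<longlonglongrightarrow> (\<Sum>i\<le>m. \<Sum>j\<le>m. a i * a j * (c2 * fbm_cov (d + 1/2) (real i / real m) (real j / real m)))"
    unfolding s2[abs_def] p_def by (intro tendsto_intros scaled_covsum_tendsto) auto
  have \<mu>lim: "\<mu> \<longlonglongrightarrow> 0"
  proof -
    have "(\<lambda>n. a0 * sqrt (\<Sum>k. (b k)\<^sup>2) * (real n powr (- 1/2 - d) * sqrt (real n)))
        \<longlonglongrightarrow> a0 * sqrt (\<Sum>k. (b k)\<^sup>2) * 0"
      by (intro tendsto_intros) (use d in real_asymp)
    then show ?thesis unfolding \<mu>_def[abs_def] scl_def by (simp add: real_sqrt_mult mult_ac)
  qed
  have "(\<lambda>n. a0\<^sup>2 * (covsum (corr eps eps) n n * real n powr (- 1 - 2 * d))) \<longlonglongrightarrow> a0\<^sup>2 * 0"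
    by (intro tendsto_intros covsum_eps_tendsto)
  then have elim: "(\<lambda>n. (scl n * a0)\<^sup>2 * covsum (corr eps eps) n n) \<longlonglongrightarrow> 0"
    unfolding power_mult_distrib scl_square by (simp add: mult_ac)
  have "(\<lambda>n. sqrt ((scl n * a0)\<^sup>2 * covsum (corr eps eps) n n) + \<sigma>2 n * (psi (\<mu> n) + (\<mu> n)\<^sup>2 / 8)) \<longlonglongrightarrow>
     sqrt 0 + (\<Sum>i\<le>m. \<Sum>j\<le>m. a i * a j * (c2 * fbm_cov (d + 1/2) (real i / real m) (real j / real m))) * (0
         + 0\<^sup>2 / 8)"
    by (intro tendsto_intros elim \<sigma>lim \<mu>lim psi_tendsto) auto
  then have err: "(\<lambda>n. sqrt ((scl n * a0)\<^sup>2 * covsum (corr eps eps) n n) + \<sigma>2 n * (psi (\<mu> n) + (\<mu> n)\<^sup>2 / 8))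
      \<longlonglongrightarrow> 0" by simp
  have "(\<lambda>n. (CLINT \<omega>|M. iexp (\<Sum>k=1..n. A n k * X (int k) \<omega>)) - of_real (exp (- (\<sigma>2 n / 2)))) \<longlonglongrightarrow> 0"
    by (rule Lim_null_comparison[OF always_eventually err], rule allI)
       (unfold \<sigma>2_def \<mu>_def, rule char_combination[OF A])
  moreover have "(\<lambda>n. complex_of_real (exp (- (\<sigma>2 n / 2)))) \<longlonglongrightarrow>
    of_real (exp (- ((\<Sum>i\<le>m. \<Sum>j\<le>m. a i * a j * (c2 * fbm_cov (d
        + 1/2) (real i / real m) (real j / real m))) / 2)))"
    by (intro tendsto_intros \<sigma>lim) auto
  ultimately have "(\<lambda>n. (CLINT \<omega>|M. iexp (\<Sum>k=1..n. A n k * X (int k) \<omega>)) - of_real (exp (- (\<sigma>2 n / 2)))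
      + complex_of_real (exp (- (\<sigma>2 n / 2)))) \<longlonglongrightarrow>
    0 + of_real (exp (- ((\<Sum>i\<le>m. \<Sum>j\<le>m. a i * a j * (c2 * fbm_cov (d
        + 1/2) (real i / real m) (real j / real m))) / 2)))"
    by (rule tendsto_add)
  then show ?thesis unfolding lin[symmetric] by (simp add: p_def)
qed

text \<open>On each grid interval the two paths differ by at most the maximal increment over a block
  of l steps from p i. Taking the sum of the T i instead of their maximum costs the factor m + 1,
  which the power 1 + 2 d of the block length outweighs.\<close>

lemma step_discretization_bound:
  assumes f: "\<And>x y. x \<in> D01 \<Longrightarrow> y \<in> D01 \<Longrightarrow> \<bar>f x - f y\<bar> \<le> L * skorohod_dist x y" and L: "L \<ge> 0"
    and B: "\<And>x. x \<in> D01 \<Longrightarrow> \<bar>f x\<bar> \<le> B" and mn: "m > 0" "n > 0"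
    and C: "\<And>a n. n \<ge> 1 \<Longrightarrow> \<exists>T. integrable M T \<and> (\<forall>\<omega> k. k \<le> n \<longrightarrow> (S (a + k) \<omega> - S a \<omega>)\<^sup>2 \<le> T \<omega>) \<and>
      expectation T \<le> C * real n powr (1 + 2 * d)"
  shows "\<bar>expectation (\<lambda>\<omega>. f (step_path n (\<lambda>k. scl n * S k \<omega>)))
      - expectation (\<lambda>\<omega>. f (step_path m (\<lambda>i. scl n * S (nat \<lfloor>real n * (real i / real m)\<rfloor>) \<omega>)))\<bar>
    \<le> L * sqrt (real (Suc m) * C * (real (n div m + 2) / real n) powr (1 + 2 * d))"
proof -
  define p where "p i = nat \<lfloor>real n * (real i / real m)\<rfloor>" for i
  \<comment> \<open>A grid interval spans n / m steps; \<open>n div m\<close> loses less than 1 of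
    this and the floor in p i loses less than 1 as well, hence + 2.\<close>
  define l where "l = n div m + 2"
  have "\<forall>i. \<exists>T. integrable M T \<and> (\<forall>\<omega> k. k \<le> l \<longrightarrow> (S (p i + k) \<omega> - S (p i) \<omega>)\<^sup>2 \<le> T \<omega>) \<and>
      expectation T \<le> C * real l powr (1 + 2 * d)"
    by (intro allI C) (simp add: l_def)
  then obtain T where T: "\<And>i. integrable M (T i)" "\<And>i \<omega> k. k \<le> l \<Longrightarrow> (S (p i + k) \<omega> - S (p i) \<omega>)\<^sup>2 \<le> T i \<omega>"
    "\<And>i. expectation (T i) \<le> C * real l powr (1 + 2 * d)"
    by metis
  have T0: "T i \<omega> \<ge> 0" for i \<omega> using T(2)[of 0 i \<omega>] by simp
  define U where "U \<omega> = sqrt ((scl n)\<^sup>2 * (\<Sum>i\<le>m. T i \<omega>))" for \<omega>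
  have U0: "U \<omega> \<ge> 0" for \<omega> unfolding U_def by (intro real_sqrt_ge_zero mult_nonneg_nonneg sum_nonneg T0) auto
  have U2: "(U \<omega>)\<^sup>2 = (scl n)\<^sup>2 * (\<Sum>i\<le>m. T i \<omega>)" for \<omega>
    unfolding U_def by (intro real_sqrt_pow2 mult_nonneg_nonneg sum_nonneg T0) auto
  have [measurable]: "T i \<in> borel_measurable M" for i using T(1) by auto
  have [measurable]: "U \<in> borel_measurable M" unfolding U_def by measurable
  have iU2: "integrable M (\<lambda>\<omega>. (U \<omega>)\<^sup>2)" unfolding U2 using T(1)
      by (intro integrable_mult_right Bochner_Integration.integrable_sum)
  let ?F = "\<lambda>\<omega>. step_path n (\<lambda>k. scl n * S k \<omega>)" and ?P = "\<lambda>\<omega>. step_path m (\<lambda>i. scl n * S (p i) \<omega>)"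
  have dist: "skorohod_dist (?F \<omega>) (?P \<omega>) \<le> U \<omega>" for \<omega>
  proof (rule skorohod_dist_le_sup[OF step_path_D01 step_path_D01 U0])
    fix t :: real assume t: "t \<in> {0..1}"
    define i where "i = nat \<lfloor>real m * t\<rfloor>"
    define q where "q = nat \<lfloor>real n * t\<rfloor>"
    have i: "real i \<le> real m * t" "real m * t < real i + 1" using t unfolding i_def by auto
    have im: "i \<le> m"
    proof -
      have "real m * t \<le> real m * 1" using t by (intro mult_left_mono) auto
      then show ?thesis using i(1) by linarith
    qed
    have it: "real i / real m \<le> t" "t \<le> real i / real m + 1 / real m"
      using i mn by (auto simp: field_simps)
    have pq: "p i \<le> q"
      unfolding p_def q_def by (intro nat_mono floor_mono mult_left_mono it) auto
    have "q \<le> p i + l"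
    proof -
      have "real q \<le> real n * t" using t unfolding q_def by auto
      also have "\<dots> \<le> real n * (real i / real m + 1 / real m)" by (intro mult_left_mono it) auto
      also have "\<dots> = real n * (real i / real m) + real n / real m" by (simp add: distrib_left)
      also have "\<dots> < (real (p i) + 1) + (real (n div m) + 1)"
      proof (rule add_strict_mono)
        show "real n * (real i / real m) < real (p i) + 1" unfolding p_def by linarith
        show "real n / real m < real (n div m) + 1"
          using floor_divide_of_nat_eq[where ?'a = real, of n m] by linarith
      qed
      finally show ?thesis unfolding l_def by linarith
    qed
    then have "(S (p i + (q - p i)) \<omega> - S (p i) \<omega>)\<^sup>2 \<le> T i \<omega>" by (intro T(2)) auto
    then have "(S q \<omega> - S (p i) \<omega>)\<^sup>2 \<le> T i \<omega>" using pq by simp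
    also have "T i \<omega> \<le> (\<Sum>i\<le>m. T i \<omega>)" by (rule member_le_sum) (use im T0 in auto)
    finally have "(scl n)\<^sup>2 * (S q \<omega> - S (p i) \<omega>)\<^sup>2 \<le> (U \<omega>)\<^sup>2" unfolding U2 by (rule mult_left_mono) simp
    then have "(scl n * (S q \<omega> - S (p i) \<omega>))\<^sup>2 \<le> (U \<omega>)\<^sup>2" by (simp only: power_mult_distrib)
    then have "\<bar>scl n * (S q \<omega> - S (p i) \<omega>)\<bar> \<le> U \<omega>" using U0[of \<omega>] by (simp add: abs_le_square_iff[symmetric])
    then show "\<bar>?F \<omega> t - ?P \<omega> t\<bar> \<le> U \<omega>"
      using t by (simp add: step_path_def q_def[symmetric] i_def[symmetric] right_diff_distrib)
  qed
  note mf = continuous_map_skorohod_measurable[OF Lipschitz_continuous_map_skorohod[OF f]]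
  have iF: "integrable M (\<lambda>\<omega>. f (?F \<omega>))"
    by (rule integrable_const_bound[of _ B])
       (use B step_path_D01 in \<open>auto intro!: measurable_compose[OF measurable_step_path mf]\<close>)
  have iP: "integrable M (\<lambda>\<omega>. f (?P \<omega>))"
    by (rule integrable_const_bound[of _ B])
       (use B step_path_D01 in \<open>auto intro!: measurable_compose[OF measurable_step_path mf]\<close>)
  have iU: "integrable M U" by (rule expectation_abs_le_sqrt(1)[OF _ iU2]) simp
  have "\<bar>expectation (\<lambda>\<omega>. f (?F \<omega>)) - expectation (\<lambda>\<omega>. f (?P \<omega>))\<bar> = \<bar>expectation (\<lambda>\<omega>. f (?F \<omega>) - f (?P \<omega>))\<bar>"
    using iF iP by simp
  also have "\<dots> \<le> expectation (\<lambda>\<omega>. \<bar>f (?F \<omega>) - f (?P \<omega>)\<bar>)" by (rule integral_abs_bound)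
  also have "\<dots> \<le> expectation (\<lambda>\<omega>. L * U \<omega>)"
  proof (rule integral_mono)
    show "integrable M (\<lambda>\<omega>. \<bar>f (?F \<omega>) - f (?P \<omega>)\<bar>)" using iF iP by auto
    show "integrable M (\<lambda>\<omega>. L * U \<omega>)" using iU by auto
    show "\<bar>f (?F \<omega>) - f (?P \<omega>)\<bar> \<le> L * U \<omega>" for \<omega>
      by (rule order_trans[OF f[OF step_path_D01 step_path_D01] mult_left_mono[OF dist L]])
  qed
  also have "\<dots> = L * expectation (\<lambda>\<omega>. \<bar>U \<omega>\<bar>)" using U0 by simp
  also have "\<dots> \<le> L * sqrt (expectation (\<lambda>\<omega>. (U \<omega>)\<^sup>2))"
    by (intro mult_left_mono expectation_abs_le_sqrt(2) iU2 L) simp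
  also have "expectation (\<lambda>\<omega>. (U \<omega>)\<^sup>2) \<le> real (Suc m) * C * (real l / real n) powr (1 + 2 * d)"
  proof -
    have "expectation (\<lambda>\<omega>. (U \<omega>)\<^sup>2) = (scl n)\<^sup>2 * (\<Sum>i\<le>m. expectation (T i))"
      unfolding U2 using T(1) by (simp add: Bochner_Integration.integral_sum)
    also have "\<dots> \<le> (scl n)\<^sup>2 * (\<Sum>i\<le>m. C * real l powr (1 + 2 * d))"
      by (intro mult_left_mono sum_mono T) auto
    also have "\<dots> = real (Suc m) * C * (real l powr (1 + 2 * d) * real n powr (- (1 + 2 * d)))"
      unfolding scl_square by simp
    also have "real l powr (1 + 2 * d) * real n powr (- (1 + 2 * d)) = (real l / real n) powr (1 + 2 * d)"
      by (simp only: powr_divide powr_minus of_nat_0_le_iff) (simp only: divide_inverse)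
    finally show ?thesis .
  qed
  finally show ?thesis using L unfolding l_def p_def by (simp add: mult_left_mono)
qed

end

section \<open>From discretized paths to weak convergence\<close>

context long_memory_model
begin

text \<open>A bounded Lipschitz functional of a discretized path is a bounded continuous function of
  m + 1 coordinates, so \<open>cramer_wold_tendsto\<close> applies with the characteristic functions
  computed on both sides.\<close>

lemma discretized_paths_tendsto:
  fixes N :: "'b measure" and B :: "real \<Rightarrow> 'b \<Rightarrow> real"
  assumes fbm: "fractional_brownian_motion N (d + 1/2) B" and m: "m > 0"
    and f: "\<And>x y. x \<in> D01 \<Longrightarrow> y \<in> D01 \<Longrightarrow> \<bar>f x - f y\<bar> \<le> L * skorohod_dist x y"
    and bnd: "\<And>x. x \<in> D01 \<Longrightarrow> \<bar>f x\<bar> \<le> D"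
  shows "(\<lambda>n. expectation (\<lambda>\<omega>. f (step_path m (\<lambda>i. scl n * S (nat \<lfloor>real n * (real i / real m)\<rfloor>) \<omega>))))
    \<longlonglongrightarrow> (\<integral>\<omega>. f (step_path m (\<lambda>i. sqrt c2 * B (real i / real m) \<omega>)) \<partial>N)"
proof -
  interpret F: fbm N "d + 1/2" B by unfold_locales (rule fbm)
  obtain K where K: "K \<ge> 0" "\<And>p n. expectation (\<lambda>\<omega>. (\<Sum>k=p+1..p+n. X (int k) \<omega>)\<^sup>2) \<le> K * real n powr (1 + 2 * d)"
    by (rule partial_sum_growth) auto
  define p where "p n i = nat \<lfloor>real n * (real i / real m)\<rfloor>" for n i
  define V where "V n \<omega> i = scl n * S (p n i) \<omega>" for n \<omega> i
  define W where "W \<omega> i = sqrt c2 * B (real i / real m) \<omega>" for \<omega> i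
  define C where "C = max K (Max ((\<lambda>i. \<integral>\<omega>. (W \<omega> i)\<^sup>2 \<partial>N) ` {..m}))"
  have t0: "real i / real m \<ge> 0" for i by simp
  have [measurable]: "B (real i / real m) \<in> borel_measurable N" for i by (rule F.B_measurable[OF t0])
  have S2: "integrable M (\<lambda>\<omega>. (S k \<omega>)\<^sup>2)" "expectation (\<lambda>\<omega>. (S k \<omega>)\<^sup>2) \<le> K * real k powr (1 + 2 * d)" for k
    using S_increment_square[of 0 k] K(2)[of 0 k] by (simp_all add: S_def)
  have "(\<lambda>n. expectation (\<lambda>\<omega>. f (step_path m (V n \<omega>)))) \<longlonglongrightarrow> (\<integral>\<omega>. f (step_path m (W \<omega>)) \<partial>N)"
  proof (rule cramer_wold_tendsto[where H = "\<lambda>v. f (step_path m v)" and m = m and B = D and C = C])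
    show "prob_space M" by unfold_locales
    show "prob_space N" by unfold_locales
    show "(\<lambda>\<omega>. V n \<omega> i) \<in> borel_measurable M" for n i unfolding V_def by measurable
    show "(\<lambda>\<omega>. W \<omega> i) \<in> borel_measurable N" for i unfolding W_def by measurable
    show "continuous_on UNIV (\<lambda>v. f (step_path m v))"
      by (rule continuous_step_path[OF Lipschitz_continuous_map_skorohod[OF f]])
    show "\<bar>f (step_path m v)\<bar> \<le> D" for v by (rule bnd[OF step_path_D01])
    show "f (step_path m v) = f (step_path m w)" if vw: "\<And>i. i \<le> m \<Longrightarrow> v i = w i" for v w
    proof -
      have "step_path m v = step_path m w"
        unfolding step_path_def
      proof (rule restrict_ext)
        fix t :: real assume "t \<in> {0..1}"
        then have "real m * t \<le> real m * 1" by (intro mult_left_mono) auto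
        then have "nat \<lfloor>real m * t\<rfloor> \<le> m" by linarith
        then show "v (nat \<lfloor>real m * t\<rfloor>) = w (nat \<lfloor>real m * t\<rfloor>)" by (rule vw)
      qed
      then show ?thesis by simp
    qed
  next
    fix n i assume i: "i \<le> m"
    show "integrable M (\<lambda>\<omega>. (V n \<omega> i)\<^sup>2)" unfolding V_def power_mult_distrib by (intro integrable_mult_right S2)
    have "expectation (\<lambda>\<omega>. (V n \<omega> i)\<^sup>2) = (scl n)\<^sup>2 * expectation (\<lambda>\<omega>. (S (p n i) \<omega>)\<^sup>2)"
      unfolding V_def power_mult_distrib by simp
    also have "\<dots> \<le> (scl n)\<^sup>2 * (K * real (p n i) powr (1 + 2 * d))" by (intro mult_left_mono S2) auto
    also have "\<dots> \<le> (scl n)\<^sup>2 * (K * real n powr (1 + 2 * d))"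
    proof -
      have "real n * (real i / real m) \<le> real n * 1" using i m by (intro mult_left_mono) auto
      then have "p n i \<le> n" unfolding p_def by linarith
      then show ?thesis using K(1) d by (intro mult_left_mono powr_mono2) auto
    qed
    also have "\<dots> = K * (real n powr (- 1 - 2 * d) * real n powr (1 + 2 * d))" unfolding scl_square by simp
    also have "\<dots> \<le> K * 1" using K(1) by (intro mult_left_mono) (auto simp: powr_add[symmetric])
    also have "\<dots> \<le> C" by (simp add: C_def)
    finally show "expectation (\<lambda>\<omega>. (V n \<omega> i)\<^sup>2) \<le> C" .
  next
    fix i assume i: "i \<le> m"
    show "integrable N (\<lambda>\<omega>. (W \<omega> i)\<^sup>2)" unfolding W_def power_mult_distrib
      by (intro integrable_mult_right F.B_square t0)
    have "(\<integral>\<omega>. (W \<omega> i)\<^sup>2 \<partial>N) \<le> Max ((\<lambda>i. \<integral>\<omega>. (W \<omega> i)\<^sup>2 \<partial>N) ` {..m})" using i by (intro Max_ge) auto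
    then show "(\<integral>\<omega>. (W \<omega> i)\<^sup>2 \<partial>N) \<le> C" by (simp add: C_def)
  next
    fix a :: "nat \<Rightarrow> real"
    let ?I = "(\<lambda>i. real i / real m) ` {..m}"
    \<comment> \<open>\<open>B_char\<close> sums over a set of times, not over indices. Since m > 0,
      the index is recovered from the time t = i / m as the floor of m t.\<close>
    define a' where "a' t = sqrt c2 * a (nat \<lfloor>real m * t\<rfloor>)" for t
    have inj: "inj_on (\<lambda>i. real i / real m) {..m}" using m by (auto simp: inj_on_def)
    have a': "a' (real i / real m) = sqrt c2 * a i" for i using m by (simp add: a'_def)
    have sI: "(\<Sum>t\<in>?I. g t) = (\<Sum>i\<le>m. g (real i / real m))" for g :: "real \<Rightarrow> real"
      by (subst sum.reindex[OF inj]) simp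
    have "(CLINT \<omega>|N. iexp (\<Sum>t\<in>?I. a' t * B t \<omega>)) = of_real (exp (- ((\<Sum>s\<in>?I. \<Sum>t\<in>?I. a' s * a' t * fbm_cov (d
        + 1/2) s t) / 2)))"
      by (rule F.B_char) auto
    moreover have "(\<Sum>s\<in>?I. \<Sum>t\<in>?I. a' s * a' t * fbm_cov (d + 1/2) s t)
      = (\<Sum>i\<le>m. \<Sum>j\<le>m. a i * a j * (c2 * fbm_cov (d + 1/2) (real i / real m) (real j / real m)))"
    proof -
      have "a' s * a' t = a (nat \<lfloor>real m * s\<rfloor>) * a (nat \<lfloor>real m * t\<rfloor>) * c2" for s t
        using c2_pos by (simp add: a'_def)
      then show ?thesis unfolding sI using m by (simp add: mult.assoc)
    qed
    moreover have "(\<Sum>t\<in>?I. a' t * B t \<omega>) = (\<Sum>i\<le>m. a i * W \<omega> i)" for \<omega>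
      unfolding sI a' W_def by (simp add: mult_ac)
    ultimately have "(CLINT \<omega>|N. iexp (\<Sum>i\<le>m. a i * W \<omega> i)) =
      of_real (exp (- ((\<Sum>i\<le>m. \<Sum>j\<le>m. a i * a j * (c2 * fbm_cov (d
          + 1/2) (real i / real m) (real j / real m))) / 2)))"
      by simp
    then show "(\<lambda>n. CLINT \<omega>|M. iexp (\<Sum>i\<le>m. a i * V n \<omega> i)) \<longlonglongrightarrow> (CLINT \<omega>|N. iexp (\<Sum>i\<le>m. a i * W \<omega> i))"
      using char_partial_sums_tendsto[OF m, of a] unfolding V_def p_def by simp
  qed
  then show ?thesis unfolding V_def p_def W_def .
qed

text \<open>The continuous limit path is a pointwise Skorohod limit of its step paths, which gives
  both its measurability and, by dominated convergence, the limit of the expectations.\<close>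

lemma discretized_limit:
  fixes N :: "'b measure" and B :: "real \<Rightarrow> 'b \<Rightarrow> real"
  assumes fbm: "fractional_brownian_motion N (d + 1/2) B"
  defines "Z \<equiv> path01 (\<lambda>\<tau> \<omega>. sqrt c2 * B \<tau> \<omega>)"
  shows "Z \<in> measurable N skorohod_borel"
    and "continuous_map skorohod_topology euclideanreal f \<Longrightarrow> (\<And>x. x \<in> D01 \<Longrightarrow> \<bar>f x\<bar> \<le> D) \<Longrightarrow>
      (\<lambda>m. \<integral>\<omega>. f (step_path (Suc m) (\<lambda>i. sqrt c2 * B (real i / real (Suc m)) \<omega>)) \<partial>N) \<longlonglongrightarrow> (\<integral>\<omega>. f (Z \<omega>) \<partial>N)"
proof -
  interpret F: fbm N "d + 1/2" B by unfold_locales (rule fbm)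
  let ?P = "\<lambda>m \<omega>. step_path (Suc m) (\<lambda>i. sqrt c2 * B (real i / real (Suc m)) \<omega>)"
  have cont: "continuous_on {0..1} (\<lambda>t. sqrt c2 * B t \<omega>)" if "\<omega> \<in> space N" for \<omega>
    by (intro continuous_intros continuous_on_subset[OF F.B_continuous[OF that]]) auto
  have Zr: "Z \<omega> = restrict (\<lambda>t. sqrt c2 * B t \<omega>) {0..1}" for \<omega> by (simp add: Z_def path01_def)
  have ZD: "Z \<omega> \<in> D01" if "\<omega> \<in> space N" for \<omega> unfolding Zr by (rule continuous_path_D01[OF cont[OF that]])
  have lim: "(\<lambda>m. skorohod_dist (?P m \<omega>) (Z \<omega>)) \<longlonglongrightarrow> 0" if "\<omega> \<in> space N" for \<omega>
    by (rule step_path_approximates_continuous[OF cont[OF that] Zr])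
  have mP: "?P m \<in> measurable N skorohod_borel" for m
    by (intro measurable_step_path borel_measurable_times borel_measurable_const F.B_measurable) auto
  show mZ: "Z \<in> measurable N skorohod_borel"
    by (rule measurable_skorohod_limit[OF mP ZD lim])
  assume f: "continuous_map skorohod_topology euclideanreal f" and D: "\<And>x. x \<in> D01 \<Longrightarrow> \<bar>f x\<bar> \<le> D"
  note mf = continuous_map_skorohod_measurable[OF f]
  show "(\<lambda>m. \<integral>\<omega>. f (?P m \<omega>) \<partial>N) \<longlonglongrightarrow> (\<integral>\<omega>. f (Z \<omega>) \<partial>N)"
  proof (rule integral_dominated_convergence[where w = "\<lambda>_. D"])
    show "(\<lambda>\<omega>. f (Z \<omega>)) \<in> borel_measurable N" by (rule measurable_compose[OF mZ mf])
    show "(\<lambda>\<omega>. f (?P m \<omega>)) \<in> borel_measurable N" for m by (rule measurable_compose[OF mP mf])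
    show "AE \<omega> in N. norm (f (?P m \<omega>)) \<le> D" for m using D[OF step_path_D01] by (intro AE_I2) simp
    show "AE \<omega> in N. (\<lambda>m. f (?P m \<omega>)) \<longlonglongrightarrow> f (Z \<omega>)"
    proof (intro AE_I2 tendstoI)
      fix \<omega> e assume \<omega>: "\<omega> \<in> space N" and e: "(e::real) > 0"
      have "openin skorohod_topology {x \<in> topspace skorohod_topology. f x \<in> ball (f (Z \<omega>)) e}"
        by (rule openin_continuous_map_preimage[OF f]) simp
      then obtain r where r: "r > 0" "\<And>y. y \<in> D01 \<Longrightarrow> skorohod_dist (Z \<omega>) y < r \<Longrightarrow> f y \<in> ball (f (Z \<omega>)) e"
        unfolding openin_skorohod using ZD[OF \<omega>] e by auto
      show "\<forall>\<^sub>F m in sequentially. dist (f (?P m \<omega>)) (f (Z \<omega>)) < e"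
        using order_tendstoD(2)[OF lim[OF \<omega>] r(1)]
      proof eventually_elim
        case (elim m)
        then have "f (?P m \<omega>) \<in> ball (f (Z \<omega>)) e"
          by (intro r(2) step_path_D01) (simp add: skorohod_dist_commute)
        then show ?case by (simp add: dist_commute)
      qed
    qed
  qed simp
qed

lemma weak_convergence:
  fixes N :: "'b measure" and B :: "real \<Rightarrow> 'b \<Rightarrow> real"
  assumes fbm: "fractional_brownian_motion N (d + 1/2) B"
  shows "weak_conv_D01 M
      (\<lambda>n \<tau> \<omega>. real n powr (- 1/2 - d) * (\<Sum>t\<in>{1..\<lfloor>real n * \<tau>\<rfloor>}. X t \<omega>))
      N (\<lambda>\<tau> \<omega>. sqrt c2 * B \<tau> \<omega>)"
proof -
  interpret F: fbm N "d + 1/2" B by unfold_locales (rule fbm)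
  let ?F = "\<lambda>n \<omega>. step_path n (\<lambda>k. scl n * S k \<omega>)"
  define Z where "Z = path01 (\<lambda>\<tau> \<omega>. sqrt c2 * B \<tau> \<omega>)"
  obtain K where K: "K \<ge> 0" "\<And>p n. expectation (\<lambda>\<omega>. (\<Sum>k=p+1..p+n. X (int k) \<omega>)\<^sup>2) \<le> K * real n powr (1 + 2 * d)"
    by (rule partial_sum_growth) auto
  obtain C where C: "C \<ge> 0" "\<And>a n. n \<ge> 1 \<Longrightarrow> \<exists>T. integrable M T \<and> (\<forall>\<omega> k. k \<le> n \<longrightarrow> (S (a + k) \<omega> - S a \<omega>)\<^sup>2 \<le> T \<omega>) \<and>
    expectation T \<le> C * real n powr (1 + 2 * d)"
  proof (rule maximal_inequality[OF d(1), of M S K])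
    show "integrable M (\<lambda>\<omega>. (S (i + l) \<omega> - S i \<omega>)\<^sup>2)" for i l by (rule S_increment_square)
    show "expectation (\<lambda>\<omega>. (S (i + l) \<omega> - S i \<omega>)\<^sup>2) \<le> K * real l powr (1 + 2 * d)" for i l
      unfolding S_increment by (rule K(2))
  qed auto
  have mF: "?F n \<in> measurable M skorohod_borel" for n
    by (intro measurable_step_path) measurable
  have mZ: "Z \<in> measurable N skorohod_borel" unfolding Z_def by (rule discretized_limit(1)[OF fbm])
  have Lip: "(\<lambda>n. expectation (\<lambda>\<omega>. f (?F n \<omega>))) \<longlonglongrightarrow> (\<integral>\<omega>. f (Z \<omega>) \<partial>N)"
    if f: "\<And>x y. x \<in> D01 \<Longrightarrow> y \<in> D01 \<Longrightarrow> \<bar>f x - f y\<bar> \<le> L * skorohod_dist x y" and L: "L \<ge> 0"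
      and D: "\<And>x. x \<in> D01 \<Longrightarrow> \<bar>f x\<bar> \<le> D" for f L D
  proof (rule LIMSEQ_I)
    fix e :: real assume e: "e > 0"
    let ?P = "\<lambda>m n \<omega>. step_path (Suc m) (\<lambda>i. scl n * S (nat \<lfloor>real n * (real i / real (Suc m))\<rfloor>) \<omega>)"
    let ?Q = "\<lambda>m. \<integral>\<omega>. f (step_path (Suc m) (\<lambda>i. sqrt c2 * B (real i / real (Suc m)) \<omega>)) \<partial>N"
    \<comment> \<open>The limit, as n tends to infinity, of the discretization error at mesh 1 / (m
      + 1). It is of order m^(-d): under the root, m + 2 blocks each contribute the power 1 + 2 d of
      the mesh.\<close>
    define err where "err m = L * sqrt (real (Suc (Suc m)) * C * (1 / real (Suc m)) powr (1 + 2 * d))" for m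
    have "(\<lambda>m. real (Suc (Suc m)) * (1 / real (Suc m)) powr (1 + 2 * d)) \<longlonglongrightarrow> 0"
      using d by real_asymp
    from tendsto_mult[OF tendsto_const[of L] tendsto_real_sqrt[OF tendsto_mult[OF tendsto_const[of C] this]]]
    have "err \<longlonglongrightarrow> 0" unfolding err_def[abs_def] by (simp add: mult_ac)
    then have "\<forall>\<^sub>F m in sequentially. err m < e / 3" using e by (intro order_tendstoD(2)) auto
    moreover have "\<forall>\<^sub>F m in sequentially. dist (?Q m) (\<integral>\<omega>. f (Z \<omega>) \<partial>N) < e / 3"
      unfolding Z_def
      by (rule tendstoD[OF discretized_limit(2)[OF fbm Lipschitz_continuous_map_skorohod[OF f] D]])
          (use e in auto)
    ultimately have "\<forall>\<^sub>F m in sequentially. err m < e / 3 \<and> dist (?Q m) (\<integral>\<omega>. f (Z \<omega>) \<partial>N) < e / 3"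
        by eventually_elim auto
    \<comment> \<open>From here on the mesh is fixed and only n tends to infinity.\<close>
    then obtain m where m: "err m < e / 3" "dist (?Q m) (\<integral>\<omega>. f (Z \<omega>) \<partial>N) < e / 3"
      by (auto simp: eventually_sequentially)
    have ratio: "(\<lambda>n. real (n div Suc m + 2) / real n) \<longlonglongrightarrow> 1 / real (Suc m)"
    proof (rule tendsto_sandwich)
      show "\<forall>\<^sub>F n in sequentially. 1 / real (Suc m) \<le> real (n div Suc m + 2) / real n"
      proof (rule eventually_mono[OF eventually_gt_at_top[of 0]])
        fix n :: nat assume n: "n > 0"
        have "real n / real (Suc m) \<le> real (n div Suc m + 2)"
          using floor_divide_of_nat_eq[where ?'a = real, of n "Suc m"] by linarith
        from divide_right_mono[OF this, of "real n"] n
        show "1 / real (Suc m) \<le> real (n div Suc m + 2) / real n" by simp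
      qed
      show "\<forall>\<^sub>F n in sequentially. real (n div Suc m + 2) / real n \<le> 1 / real (Suc m) + 2 / real n"
      proof (rule eventually_mono[OF eventually_gt_at_top[of 0]])
        fix n :: nat assume n: "n > 0"
        have "real (n div Suc m + 2) \<le> real n / real (Suc m) + 2"
          using floor_divide_of_nat_eq[where ?'a = real, of n "Suc m"] by linarith
        from divide_right_mono[OF this, of "real n"] n
        show "real (n div Suc m + 2) / real n \<le> 1 / real (Suc m) + 2 / real n" by (simp add: add_divide_distrib)
      qed
      have "(\<lambda>n. 1 / real (Suc m) + 2 / real n) \<longlonglongrightarrow> 1 / real (Suc m) + 0"
        by (intro tendsto_add tendsto_const lim_const_over_n)
      then show "(\<lambda>n. 1 / real (Suc m) + 2 / real n) \<longlonglongrightarrow> 1 / real (Suc m)" by simp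
    qed simp
    have "(\<lambda>n. L * sqrt (real (Suc (Suc m)) * C * (real (n div Suc m + 2) / real n) powr (1 + 2 * d))) \<longlonglongrightarrow> err m"
      unfolding err_def
      by (intro tendsto_mult tendsto_real_sqrt tendsto_const tendsto_powr[OF ratio tendsto_const]) simp
    then have e1: "\<forall>\<^sub>F n in sequentially. L * sqrt (real (Suc (Suc m)) * C * (real (n div Suc m
        + 2) / real n) powr (1 + 2 * d)) < e / 3"
      using m(1) by (rule order_tendstoD(2))
    have e2: "\<forall>\<^sub>F n in sequentially. dist (expectation (\<lambda>\<omega>. f (?P m n \<omega>))) (?Q m) < e / 3"
      by (rule tendstoD[OF discretized_paths_tendsto[OF fbm _ f D]]) (use e in auto)
    have "\<forall>\<^sub>F n in sequentially. norm (expectation (\<lambda>\<omega>. f (?F n \<omega>)) - (\<integral>\<omega>. f (Z \<omega>) \<partial>N)) < e"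
      using e1 e2 eventually_gt_at_top[of 0]
    proof eventually_elim
      case (elim n)
      have "\<bar>expectation (\<lambda>\<omega>. f (?F n \<omega>)) - expectation (\<lambda>\<omega>. f (?P m n \<omega>))\<bar>
        \<le> L * sqrt (real (Suc (Suc m)) * C * (real (n div Suc m + 2) / real n) powr (1 + 2 * d))"
        by (rule step_discretization_bound[OF f L D _ _ C(2)]) (use elim in auto)
      then show ?case using elim m(2) unfolding dist_real_def real_norm_def by linarith
    qed
    then show "\<exists>no. \<forall>n\<ge>no. norm (expectation (\<lambda>\<omega>. f (?F n \<omega>)) - (\<integral>\<omega>. f (Z \<omega>) \<partial>N)) < e"
      by (simp add: eventually_sequentially)
  qed
  have pth: "path01 (\<lambda>\<tau> \<omega>. real n powr (- 1/2 - d) * (\<Sum>t\<in>{1..\<lfloor>real n * \<tau>\<rfloor>}. X t \<omega>)) = ?F n" for n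
    by (rule ext) (rule path01_partial_sums)
  show ?thesis
    unfolding weak_conv_D01_def pth Z_def[symmetric]
  proof (intro conjI allI impI mF mZ)
    fix f assume f: "continuous_map skorohod_topology euclideanreal f \<and> bounded (f ` D01)"
    then obtain D where D: "\<And>x. x \<in> D01 \<Longrightarrow> \<bar>f x\<bar> \<le> D" by (auto simp: bounded_iff)
    show "(\<lambda>n. expectation (\<lambda>\<omega>. f (?F n \<omega>))) \<longlonglongrightarrow> (\<integral>\<omega>. f (Z \<omega>) \<partial>N)"
      by (rule portmanteau_skorohod[OF prob_space_axioms F.prob_space_axioms mF mZ Lip _ D]) (use f in auto)
  qed
qed

end

text \<open>Summability is part of the conclusion because \<open>suminf\<close> is total, so that an
  asymptotic equivalence alone would not assert convergence of the series. The Brownian motion may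
  live on any space N, weak convergence being a matter of laws.\<close>

theorem theorem8p1:
  fixes M :: "'a measure" and \<zeta> :: "int \<Rightarrow> 'a \<Rightarrow> real"
    and \<alpha> :: "nat \<Rightarrow> real" and \<beta> :: "nat \<Rightarrow> nat \<Rightarrow> real" and Q :: "real \<Rightarrow> real"
    and c\<^sub>Q c\<^sub>L \<kappa> d :: real and X :: "int \<Rightarrow> 'a \<Rightarrow> real" and b :: "nat \<Rightarrow> real"
    and N :: "'b measure" and B\<^sub>H :: "real \<Rightarrow> 'b \<Rightarrow> real"
  assumes innov: "std_iid M \<zeta>"
    and Q_meas: "Q \<in> borel_measurable borel"
    and Q_bound: "c\<^sub>Q > 0" "\<And>x. \<bar>Q x\<bar> \<le> c\<^sub>Q * \<bar>x\<bar>"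
    and K_fin: "K_Q c\<^sub>Q \<alpha> \<beta> < \<infinity>"
    and sol: "projective_solution M \<zeta> Q \<alpha> \<beta> X"
    and Q_Lip: "c\<^sub>L > 0" "\<And>x y. \<bar>Q x - Q y\<bar> \<le> c\<^sub>L * \<bar>x - y\<bar>"
    and \<kappa>: "\<kappa> > 0" and d: "0 < d" "d < 1/2"
    and b_def: "\<And>j. b j = Q (\<alpha> j)"
    and b_asymp: "b \<sim>[at_top] (\<lambda>j. \<kappa> * real j powr (d - 1))"
    and beta_bar: "beta_bar \<beta> \<in> o(b)"
    and fbm: "fractional_brownian_motion N (d + 1/2) B\<^sub>H"
  shows "(\<forall>t. summable (\<lambda>k. b k * b (t + k))) \<and>
    (\<lambda>t::nat. \<integral>\<omega>. X 0 \<omega> * X (int t) \<omega> \<partial>M) \<sim>[at_top] (\<lambda>t. \<Sum>k. b k * b (t + k)) \<and>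
    (\<lambda>t::nat. \<Sum>k. b k * b (t + k))
      \<sim>[at_top] (\<lambda>t. \<kappa>\<^sup>2 * Beta d (1 - 2 * d) * real t powr (2 * d - 1)) \<and>
    weak_conv_D01 M
      (\<lambda>n \<tau> \<omega>. real n powr (- 1/2 - d) * (\<Sum>t\<in>{1..\<lfloor>real n * \<tau>\<rfloor>}. X t \<omega>))
      N (\<lambda>\<tau> \<omega>. sqrt (\<kappa>\<^sup>2 * Beta d (1 - 2 * d) / (d * (1 + 2 * d))) * B\<^sub>H \<tau> \<omega>)"
proof -
  have b: "b = (\<lambda>j. Q (\<alpha> j))" using b_def by blast
  interpret P: long_memory_model M \<zeta> Q \<alpha> \<beta> X c\<^sub>Q c\<^sub>L \<kappa> d
    by unfold_locales (use assms in \<open>simp_all add: b\<close>)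
  have Pb: "P.b = b" by (simp add: b P.b_def fun_eq_iff)
  have corr: "(\<Sum>k. b k * b (t + k)) = corr P.b P.b t" for t by (simp add: corr_def Pb)
  have K2: "(\<lambda>t. (P.K2 * real t powr (2 * d - 1)) * real t powr (1 - 2 * d)) \<longlonglongrightarrow> P.K2"
    by (rule tendsto_eventually, rule eventually_mono[OF eventually_gt_at_top[of 0]])
       (simp add: mult.assoc powr_add[symmetric])
  show ?thesis
    unfolding corr
  proof (intro conjI allI)
    show "summable (\<lambda>k. b k * b (t + k))" for t
      using summable_corr[OF P.summable_squares(1,1)] unfolding Pb .
    show "(\<lambda>t. \<integral>\<omega>. X 0 \<omega> * X (int t) \<omega> \<partial>M) \<sim>[at_top] (\<lambda>t. corr P.b P.b t)"
      by (rule asymp_equiv_of_tendsto[OF P.covariance_tendsto P.corr_b_tendsto]) (use P.K2_pos in simp)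
    show "(\<lambda>t. corr P.b P.b t) \<sim>[at_top] (\<lambda>t. \<kappa>\<^sup>2 * Beta d (1 - 2 * d) * real t powr (2 * d - 1))"
      unfolding P.K2_def[symmetric]
      by (rule asymp_equiv_of_tendsto[OF P.corr_b_tendsto K2]) (use P.K2_pos in simp)
    show "weak_conv_D01 M
      (\<lambda>n \<tau> \<omega>. real n powr (- 1/2 - d) * (\<Sum>t\<in>{1..\<lfloor>real n * \<tau>\<rfloor>}. X t \<omega>))
      N (\<lambda>\<tau> \<omega>. sqrt (\<kappa>\<^sup>2 * Beta d (1 - 2 * d) / (d * (1 + 2 * d))) * B\<^sub>H \<tau> \<omega>)"
      using P.weak_convergence[OF fbm] unfolding P.c2_def P.K2_def .
  qed
qed

end
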